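(* Let $\mu>0$, $\lambda>0$, $h=-\frac{3}{20}\lambda$ and $V_0=\frac{3\mu^4}{\lambda}$, and let $$\Phi_A(z)=\frac{\sqrt5\,\mu}{2\sqrt\lambda}\left[\operatorname{diag}(1,1,-1,-1,0)+\frac15\tanh\left(\frac{\mu z}{\sqrt2}\right)\operatorname{diag}(1,1,1,1,-4)\right],\qquad z\in\mathbb R.$$ Then $\Phi_A$ is a global minimizer of $E$ in $\mathcal A(\Sigma_A^-,\Sigma_A^+)$. More precisely, $\Phi_A\in\mathcal A(\Sigma_A^-,\Sigma_A^+)$ and $$E(\Psi)\ge E(\Phi_A)=\frac{4\sqrt2\,\mu^3}{3\lambda}\qquad\text{for every }\Psi\in\mathcal A(\Sigma_A^-,\Sigma_A^+).$$ Moreover, $$\mathsf d_V(\Sigma_A^-,\Sigma_A^+)=E(\Phi_A).$$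
   Context: Let $\mathfrak h_0(5)=\{Q\in\mathbb C^{5\times5}:Q^\dagger=Q,\ \operatorname{Tr}Q=0\}$, a real Hilbert space with inner product $\langle A,B\rangle_F=\operatorname{Tr}(AB)$ and norm $\lVert A\rVert_F=(\operatorname{Tr}(A^2))^{1/2}$. The potential is $$V(\Phi)=-\mu^2\operatorname{Tr}(\Phi^2)+h\bigl(\operatorname{Tr}(\Phi^2)\bigr)^2+\lambda\operatorname{Tr}(\Phi^4)+V_0,\qquad \Phi\in\mathfrak h_0(5),$$ with the values of $\mu,\lambda,h,V_0$ given in the claim. Set $u=\frac{\sqrt5\,\mu}{5\sqrt\lambda}$, $\Phi_A^+=u\operatorname{diag}(3,3,-2,-2,-2)$, $\Phi_A^-=u\operatorname{diag}(2,2,-3,-3,2)$, and $\Sigma_A^\pm=\{U^\dagger\Phi_A^\pm U:U\in\operatorname{SU}(5)\}$. For $A^-,A^+\in\mathfrak h_0(5)$, $\mathcal A(A^-,A^+)$ is the set of $\Psi\in H^1_{\mathrm{loc}}(\mathbb R;\mathfrak h_0(5))$ (continuous representatives) with $\Psi'\in L^2(\mathbb R;\mathfrak h_0(5))$, $V(\Psi)\in L^1(\mathbb R)$, $\lim_{z\to-\infty}\Psi(z)=A^-$ and $\lim_{z\to+\infty}\Psi(z)=A^+$. For nonempty compact sets $S^-,S^+\subset\mathfrak h_0(5)$, $\mathcal A(S^-,S^+)=\bigcup_{A^-\in S^-,A^+\in S^+}\mathcal A(A^-,A^+)$. The energy is $E(\Psi)=\int_{\mathbb R}\bigl(\lVert\Psi'(z)\rVert_F^2+V(\Psi(z))\bigr)\,dz$.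 A global minimizer of $E$ in a class is an element of the class whose energy is at most that of every element of the class. The degenerate weighted distance is $$\mathsf d_V(S^-,S^+)=\inf\left\{2\int_0^1\sqrt{V(\gamma(t))}\,\lVert\gamma'(t)\rVert_F\,dt:\ \gamma\in AC([0,1];\mathfrak h_0(5)),\ \gamma(0)\in S^-,\ \gamma(1)\in S^+\right\},$$ where $AC$ denotes absolutely continuous curves. (With the given parameters $V\ge0$ on $\mathfrak h_0(5)$.) *)

theory Defs
  imports "HOL-Analysis.Analysis"
begin

type_synonym cmat5 = "complex^5^5"

definition adj :: "complex^'n^'m \<Rightarrow> complex^'m^'n" where
  "adj A = (\<chi> i j. cnj (A $ j $ i))"

definition diag :: "complex^'n \<Rightarrow> complex^'n^'n" where
  "diag v = (\<chi> i j. if i = j then v $ i else 0)"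

lemma UNIV_5: "(UNIV :: 5 set) = {1, 2, 3, 4, 5}"
proof -
  have "x = 1 \<or> x = 2 \<or> x = 3 \<or> x = 4 \<or> x = 5" for x :: 5
  proof (induct x)
    case (of_int z)
    then have "z = 0 \<or> z = 1 \<or> z = 2 \<or> z = 3 \<or> z = 4" by fastforce
    then show ?case by auto
  qed
  then show ?thesis by auto
qed

lemma vector_5 [simp]:
  "(vector [a, b, c, d, e] :: ('a::zero)^5) $ 1 = a"
  "(vector [a, b, c, d, e] :: ('a::zero)^5) $ 2 = b"
  "(vector [a, b, c, d, e] :: ('a::zero)^5) $ 3 = c"
  "(vector [a, b, c, d, e] :: ('a::zero)^5) $ 4 = d"
  "(vector [a, b, c, d, e] :: ('a::zero)^5) $ 5 = e"
  by (simp_all add: vector_def)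

definition SU5 :: "cmat5 set" where
  "SU5 = {U. adj U ** U = mat 1 \<and> U ** adj U = mat 1 \<and> det U = 1}"

definition h0 :: "cmat5 set" where
  "h0 = {Q. adj Q = Q \<and> trace Q = 0}"

text \<open>Traces of products such as \<open>A ** B\<close> with \<open>A, B\<close> Hermitian, or of powers of a Hermitian
  matrix, are real; taking \<^const>\<open>Re\<close> only changes the type.\<close>

definition frob_inner :: "cmat5 \<Rightarrow> cmat5 \<Rightarrow> real" where
  "frob_inner A B = Re (trace (A ** B))"

definition frob_norm :: "cmat5 \<Rightarrow> real" where
  "frob_norm A = sqrt (frob_inner A A)"

lemma trace_adj: "trace (adj A) = cnj (trace A)"
  by (simp add: trace_def adj_def)

lemma adj_mult: "adj (A ** B) = adj B ** adj A"
  by (simp add: adj_def matrix_matrix_mult_def vec_eq_iff mult.commute)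

lemma trace_mult_real:
  assumes "adj A = A" and "adj B = B"
  shows "trace (A ** B) \<in> \<real>"
proof -
  have "cnj (trace (A ** B)) = trace (adj B ** adj A)"
    by (simp only: trace_adj [symmetric] adj_mult)
  also have "\<dots> = trace (A ** B)"
    by (simp add: assms trace_mul_sym [of A B])
  finally show ?thesis by (simp add: Reals_cnj_iff)
qed

text \<open>On \<open>h0\<close> the library's inner product and norm of \<^typ>\<open>cmat5\<close> are the Frobenius ones, so the
  library's limits, derivatives and measurability refer to the Frobenius structure.\<close>

lemma frob_inner_eq_inner:
  assumes "A \<in> h0"
  shows "frob_inner A B = inner A B"
proof -
  have A: "cnj (A $ k $ i) = A $ i $ k" for i k
    using assms by (simp add: h0_def adj_def vec_eq_iff)
  have *: "Re (A $ i $ k * B $ k $ i) = inner (A $ k $ i) (B $ k $ i)" for i k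
    by (simp only: A [of k i, symmetric] inner_complex_def) simp
  have "frob_inner A B = (\<Sum>i\<in>UNIV. \<Sum>k\<in>UNIV. Re (A $ i $ k * B $ k $ i))"
    by (simp add: frob_inner_def trace_def matrix_matrix_mult_def)
  also have "\<dots> = (\<Sum>i\<in>UNIV. \<Sum>k\<in>UNIV. inner (A $ k $ i) (B $ k $ i))"
    by (simp only: *)
  also have "\<dots> = inner A B"
    by (subst sum.swap) (simp add: inner_vec_def)
  finally show ?thesis .
qed

lemma frob_norm_eq_norm: "A \<in> h0 \<Longrightarrow> frob_norm A = norm A"
  by (simp add: frob_norm_def frob_inner_eq_inner norm_eq_sqrt_inner)

definition potential :: "real \<Rightarrow> real \<Rightarrow> real \<Rightarrow> real \<Rightarrow> cmat5 \<Rightarrow> real" where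
  "potential \<mu> lam h V0 \<Phi> =
     - \<mu>\<^sup>2 * Re (trace (\<Phi> ** \<Phi>)) + h * (Re (trace (\<Phi> ** \<Phi>)))\<^sup>2
     + lam * Re (trace (\<Phi> ** \<Phi> ** \<Phi> ** \<Phi>)) + V0"

definition vac_scale :: "real \<Rightarrow> real \<Rightarrow> real" where
  "vac_scale \<mu> lam = sqrt 5 * \<mu> / (5 * sqrt lam)"

definition Phi_A_plus :: "real \<Rightarrow> real \<Rightarrow> cmat5" where
  "Phi_A_plus \<mu> lam = vac_scale \<mu> lam *\<^sub>R diag (vector [3, 3, -2, -2, -2])"

definition Phi_A_minus :: "real \<Rightarrow> real \<Rightarrow> cmat5" where
  "Phi_A_minus \<mu> lam = vac_scale \<mu> lam *\<^sub>R diag (vector [2, 2, -3, -3, 2])"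

definition SU5_orbit :: "cmat5 \<Rightarrow> cmat5 set" where
  "SU5_orbit \<Phi> = {adj U ** \<Phi> ** U |U. U \<in> SU5}"

definition Sigma_A_plus :: "real \<Rightarrow> real \<Rightarrow> cmat5 set" where
  "Sigma_A_plus \<mu> lam = SU5_orbit (Phi_A_plus \<mu> lam)"

definition Sigma_A_minus :: "real \<Rightarrow> real \<Rightarrow> cmat5 set" where
  "Sigma_A_minus \<mu> lam = SU5_orbit (Phi_A_minus \<mu> lam)"

definition Phi_A :: "real \<Rightarrow> real \<Rightarrow> real \<Rightarrow> cmat5" where
  "Phi_A \<mu> lam z = (sqrt 5 * \<mu> / (2 * sqrt lam)) *\<^sub>R
     (diag (vector [1, 1, -1, -1, 0])
      + (1 / 5 * tanh (\<mu> * z / sqrt 2)) *\<^sub>R diag (vector [1, 1, 1, 1, -4]))"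

definition test_function :: "(real \<Rightarrow> real) \<Rightarrow> bool" where
  "test_function \<phi> \<longleftrightarrow>
     (\<forall>k z. (deriv ^^ k) \<phi> differentiable (at z)) \<and> compact (closure {z. \<phi> z \<noteq> 0})"

definition loc_integrable :: "(real \<Rightarrow> cmat5) \<Rightarrow> bool" where
  "loc_integrable f \<longleftrightarrow> (\<forall>a b. set_integrable lebesgue {a..b} f)"

definition L2 :: "(real \<Rightarrow> cmat5) \<Rightarrow> bool" where
  "L2 f \<longleftrightarrow> f \<in> borel_measurable lebesgue \<and> integrable lebesgue (\<lambda>z. (frob_norm (f z))\<^sup>2)"

definition L2_loc :: "(real \<Rightarrow> cmat5) \<Rightarrow> bool" where
  "L2_loc f \<longleftrightarrow> f \<in> borel_measurable lebesgue \<and>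
     (\<forall>a b. set_integrable lebesgue {a..b} (\<lambda>z. (frob_norm (f z))\<^sup>2))"

definition has_weak_deriv :: "(real \<Rightarrow> cmat5) \<Rightarrow> (real \<Rightarrow> cmat5) \<Rightarrow> bool" where
  "has_weak_deriv \<Psi> g \<longleftrightarrow> (\<forall>z. g z \<in> h0) \<and> loc_integrable \<Psi> \<and> loc_integrable g \<and>
     (\<forall>\<phi>. test_function \<phi> \<longrightarrow>
        (LINT z|lebesgue. deriv \<phi> z *\<^sub>R \<Psi> z) = - (LINT z|lebesgue. \<phi> z *\<^sub>R g z))"

text \<open>The weak derivative is unique up to null sets, and everything below depends only on its
  almost-everywhere class.\<close>

definition weak_deriv :: "(real \<Rightarrow> cmat5) \<Rightarrow> real \<Rightarrow> cmat5" where
  "weak_deriv \<Psi> = (SOME g. has_weak_deriv \<Psi> g)"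

definition H1_loc :: "(real \<Rightarrow> cmat5) set" where
  "H1_loc = {\<Psi>. (\<forall>z. \<Psi> z \<in> h0) \<and> L2_loc \<Psi> \<and> (\<exists>g. has_weak_deriv \<Psi> g \<and> L2_loc g)}"

definition admissible_pts ::
  "(cmat5 \<Rightarrow> real) \<Rightarrow> cmat5 \<Rightarrow> cmat5 \<Rightarrow> (real \<Rightarrow> cmat5) set" where
  "admissible_pts V Am Ap = {\<Psi>. \<Psi> \<in> H1_loc \<and> continuous_on UNIV \<Psi> \<and> L2 (weak_deriv \<Psi>) \<and>
     integrable lebesgue (\<lambda>z. V (\<Psi> z)) \<and> (\<Psi> \<longlongrightarrow> Am) at_bot \<and> (\<Psi> \<longlongrightarrow> Ap) at_top}"

definition admissible ::
  "(cmat5 \<Rightarrow> real) \<Rightarrow> cmat5 set \<Rightarrow> cmat5 set \<Rightarrow> (real \<Rightarrow> cmat5) set" where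
  "admissible V Sm Sp = (\<Union>Am\<in>Sm. \<Union>Ap\<in>Sp. admissible_pts V Am Ap)"

definition energy :: "(cmat5 \<Rightarrow> real) \<Rightarrow> (real \<Rightarrow> cmat5) \<Rightarrow> real" where
  "energy V \<Psi> = (LINT z|lebesgue. (frob_norm (weak_deriv \<Psi> z))\<^sup>2 + V (\<Psi> z))"

definition is_global_minimizer :: "('a \<Rightarrow> real) \<Rightarrow> 'a set \<Rightarrow> 'a \<Rightarrow> bool" where
  "is_global_minimizer E C x \<longleftrightarrow> x \<in> C \<and> (\<forall>y\<in>C. E x \<le> E y)"

definition abs_continuous_on_Icc ::
  "real \<Rightarrow> real \<Rightarrow> (real \<Rightarrow> 'a::real_normed_vector) \<Rightarrow> bool" where
  "abs_continuous_on_Icc a b \<gamma> \<longleftrightarrow>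
     (\<forall>\<epsilon>>0. \<exists>\<delta>>0. \<forall>(n::nat) s t.
        (\<forall>i<n. a \<le> s i \<and> s i \<le> t i \<and> t i \<le> b) \<and>
        disjoint_family_on (\<lambda>i. {s i<..<t i}) {..<n} \<and>
        (\<Sum>i<n. t i - s i) < \<delta>
        \<longrightarrow> (\<Sum>i<n. norm (\<gamma> (t i) - \<gamma> (s i))) < \<epsilon>)"

text \<open>In the next definition \<open>g\<close> is the almost-everywhere derivative \<open>\<gamma>'\<close>: every absolutely continuous
  \<open>\<gamma>\<close> in a finite-dimensional space has one, unique up to null sets, so ranging over
  pairs \<open>(\<gamma>, g)\<close> is ranging over the absolutely continuous curves.  The infimum is taken in
  \<^typ>\<open>ennreal\<close>, where the infimum over the empty set is infinite and no integrability
  convention is involved.\<close>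

definition weighted_dist :: "(cmat5 \<Rightarrow> real) \<Rightarrow> cmat5 set \<Rightarrow> cmat5 set \<Rightarrow> ennreal" where
  "weighted_dist V Sm Sp = Inf
     {2 * (\<integral>\<^sup>+t\<in>{0..1}. ennreal (sqrt (V (\<gamma> t)) * frob_norm (g t)) \<partial>lebesgue) |\<gamma> g.
        abs_continuous_on_Icc 0 1 \<gamma> \<and> (\<forall>t\<in>{0..1}. \<gamma> t \<in> h0) \<and> \<gamma> 0 \<in> Sm \<and> \<gamma> 1 \<in> Sp \<and>
        (AE t in lebesgue_on {0..1}. (\<gamma> has_vector_derivative g t) (at t within {0..1}))}"

end

theory Submission
  imports Defs
begin

text \<open>The calibration is a cubic polynomial \<open>P\<close> of the middle eigenvalue \<open>x\<close> of \<open>\<Phi>\<close>.  Weyl's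
  inequality, with the tracelessness taken into account, makes \<open>x\<close> Lipschitz with constant
  \<open>sqrt (4 / 5)\<close> for the Frobenius norm, and among all \<open>\<Phi>\<close> with a given middle eigenvalue the
  potential is smallest on the straight segment through the two vacua, where it equals
  \<open>lam / 2 * (\<mu>\<^sup>2 / lam - 5 / 4 * x\<^sup>2)\<^sup>2\<close>.  Hence
  \<open>2 sqrt(V) \<parallel>\<gamma>'\<parallel>\<close> dominates \<open>\<bar>(P \<circ> x \<circ> \<gamma>)'\<bar>\<close> along every curve \<open>\<gamma>\<close>, with equality along
  \<open>\<Phi>\<^sub>A\<close>, for which moreover \<open>\<parallel>\<Phi>\<^sub>A'\<parallel>\<^sup>2 = V\<close>; the increment of \<open>P \<circ> x\<close> between the two orbits is
  the claimed minimal energy.\<close>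

section \<open>Absolutely continuous curves\<close>

text \<open>The third eigenvalue in decreasing order is constant on SU(5) orbits, so a single
  function serves all endpoints: the spectra u(2,2,2,-3,-3) and u(3,3,-2,-2,-2) give it the values
  2u and -2u. The value h = -3/20 lam is what makes it work: with S the part of Tr(A^2) left after
  removing 5/4 x^2, the mixed terms in x^2 S from h (Tr A^2)^2 and lam Tr(A^4) cancel, and V splits
  into a function of x, a square in S and a remainder that the order of the eigenvalues keeps
  nonnegative. The cubic is then forced up to sign and constant: |P'| times sqrt(4/5) has to be
  twice the root of that function of x. The obstacle is regularity. The middle eigenvalue is only
  Lipschitz, since eigenvalues may meet (it is triple on both vacuum orbits), so no chain rule
  applies to it along a curve and the calibration inequality is derived from increments over short
  intervals. Competitors come with two notions of derivative, weak and almost everywhere; both are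
  first reduced to one statement, that g is absolutely integrable and integrates to the increments
  of the curve.\<close>

lemma abs_continuous_on_Icc_finite:
  assumes "abs_continuous_on_Icc a b f" and "e > 0"
  shows "\<exists>d>0. \<forall>I s t. finite (I :: 'i set) \<longrightarrow> (\<forall>i\<in>I. a \<le> s i \<and> s i \<le> t i \<and> t i \<le> b) \<longrightarrow>
     disjoint_family_on (\<lambda>i. {s i<..<t i}) I \<longrightarrow> (\<Sum>i\<in>I. t i - s i) < d \<longrightarrow>
     (\<Sum>i\<in>I. norm (f (t i) - f (s i))) < e"
proof -
  obtain d where "d > 0" and d: "\<forall>(n::nat) s t. (\<forall>i<n. a \<le> s i \<and> s i \<le> t i \<and> t i \<le> b) \<and>
        disjoint_family_on (\<lambda>i. {s i<..<t i}) {..<n} \<and> (\<Sum>i<n. t i - s i) < d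
      \<longrightarrow> (\<Sum>i<n. norm (f (t i) - f (s i))) < e"
    using assms unfolding abs_continuous_on_Icc_def by blast
  show ?thesis
  proof (intro exI[of _ d] conjI \<open>d > 0\<close> allI impI)
    fix I :: "'i set" and s t
    assume I: "finite I" "\<forall>i\<in>I. a \<le> s i \<and> s i \<le> t i \<and> t i \<le> b"
      and disj: "disjoint_family_on (\<lambda>i. {s i<..<t i}) I" and less: "(\<Sum>i\<in>I. t i - s i) < d"
    \<comment> \<open>The definition numbers its intervals by naturals, while divisions are finite
      sets of intervals or of tagged intervals; \<open>h\<close> transports one indexing to the
      other.\<close>
    obtain h where h: "bij_betw h {..<card I} I"
      using ex_bij_betw_nat_finite[OF I(1)] by (auto simp: atLeast0LessThan)
    have hI: "h i \<in> I" if "i < card I" for i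
      using h that by (auto simp: bij_betw_def)
    have re: "(\<Sum>i\<in>I. g i) = (\<Sum>i<card I. g (h i))" for g :: "'i \<Rightarrow> real"
      by (rule sum.reindex_bij_betw[OF h, symmetric])
    have "(\<Sum>i<card I. norm (f (t (h i)) - f (s (h i)))) < e"
    proof (rule d[rule_format], intro conjI allI impI)
      show "disjoint_family_on (\<lambda>i. {s (h i)<..<t (h i)}) {..<card I}"
        unfolding disjoint_family_on_def
      proof (intro ballI impI)
        fix i j assume ij: "i \<in> {..<card I}" "j \<in> {..<card I}" "i \<noteq> j"
        then have "h i \<noteq> h j" using h by (auto simp: bij_betw_def inj_on_def)
        then show "{s (h i)<..<t (h i)} \<inter> {s (h j)<..<t (h j)} = {}"
          using disjoint_family_onD[OF disj hI hI] ij by blast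
      qed
    qed (use I hI less re in auto)
    then show "(\<Sum>i\<in>I. norm (f (t i) - f (s i))) < e"
      by (simp add: re)
  qed
qed

lemma abs_continuous_on_Icc_subset:
  assumes "abs_continuous_on_Icc a b f" "a \<le> c" "d \<le> b"
  shows "abs_continuous_on_Icc c d f"
  unfolding abs_continuous_on_Icc_def
proof (intro allI impI)
  fix e :: real assume "e > 0"
  then obtain r where r: "r > 0" "\<And>(n::nat) s t. (\<forall>i<n. a \<le> s i \<and> s i \<le> t i \<and> t i \<le> b) \<and>
        disjoint_family_on (\<lambda>i. {s i<..<t i}) {..<n} \<and> (\<Sum>i<n. t i - s i) < r
      \<Longrightarrow> (\<Sum>i<n. norm (f (t i) - f (s i))) < e"
    using assms(1) unfolding abs_continuous_on_Icc_def by blast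
  have "(\<Sum>i<n. norm (f (t i) - f (s i))) < e"
    if "(\<forall>i<n. c \<le> s i \<and> s i \<le> t i \<and> t i \<le> d) \<and>
        disjoint_family_on (\<lambda>i. {s i<..<t i}) {..<n} \<and> (\<Sum>i<n. t i - s i) < r" for n :: nat and s t
    using that assms(2,3) by (intro r(2)) (meson order_trans)
  with r(1) show "\<exists>\<delta>>0. \<forall>(n::nat) s t. (\<forall>i<n. c \<le> s i \<and> s i \<le> t i \<and> t i \<le> d) \<and>
        disjoint_family_on (\<lambda>i. {s i<..<t i}) {..<n} \<and> (\<Sum>i<n. t i - s i) < \<delta>
        \<longrightarrow> (\<Sum>i<n. norm (f (t i) - f (s i))) < e"
    by blast
qed

text \<open>The Henstock--Kurzweil proof of the fundamental theorem: tags in the exceptional null set get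
  a gauge inside an open set of small measure, where absolute continuity bounds the increments.\<close>

lemma abs_continuous_has_integral:
  fixes f :: "real \<Rightarrow> 'a::banach"
  assumes ab: "a \<le> b" and ac: "abs_continuous_on_Icc a b f" and N: "negligible N"
    and vd: "\<And>x. x \<in> {a..b} - N \<Longrightarrow> (f has_vector_derivative g x) (at x within {a..b})"
  shows "(g has_integral (f b - f a)) {a..b}"
proof (rule has_integral_spike[OF N])
  \<comment> \<open>With the integrand set to zero on \<open>N\<close>, a tag in \<open>N\<close>
    leaves only an increment of \<open>f\<close> in the Riemann sum.\<close>
  define g0 where "g0 x = (if x \<in> N then 0 else g x)" for x
  show "g x = g0 x" if "x \<in> {a..b} - N" for x
    using that by (simp add: g0_def)
  show "(g0 has_integral (f b - f a)) {a..b}"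
    unfolding has_integral_real
  proof (intro allI impI)
    fix e0 :: real
    assume "e0 > 0"
    \<comment> \<open>Error budget: \<open>e * (b - a)\<close> for the tags outside
      \<open>N\<close>, where \<open>f\<close> is differentiable, plus \<open>e\<close> in total for
      the tags in \<open>N\<close>.\<close>
    define e where "e = e0 / (2 * (b - a + 1))"
    have "e > 0" using \<open>e0 > 0\<close> ab by (simp add: e_def)
    have e0: "e * (b - a) + e \<le> e0 / 2"
    proof -
      define c where "c = b - a + 1"
      have "c > 0" using ab by (simp add: c_def)
      then have "e * (b - a + 1) = e0 / 2" by (simp add: e_def flip: c_def)
      then show ?thesis by (simp add: algebra_simps)
    qed
    obtain r where "r > 0" and r: "\<forall>I s t. finite (I :: (real \<times> real set) set) \<longrightarrow>
        (\<forall>i\<in>I. a \<le> s i \<and> s i \<le> t i \<and> t i \<le> b) \<longrightarrow>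
        disjoint_family_on (\<lambda>i. {s i<..<t i}) I \<longrightarrow> (\<Sum>i\<in>I. t i - s i) < r \<longrightarrow>
        (\<Sum>i\<in>I. norm (f (t i) - f (s i))) < e"
      using abs_continuous_on_Icc_finite[OF ac \<open>e > 0\<close>] by blast
    have null: "N \<in> null_sets lebesgue"
      using N negligible_iff_null_sets by blast
    obtain T where T: "open T" "N \<subseteq> T" "T - N \<in> lmeasurable" "emeasure lebesgue (T - N) < ennreal r"
      using sets_lebesgue_outer_open[of N r] null \<open>r > 0\<close> by blast
    have Tm: "T \<in> sets lebesgue" using T(1) by simp
    have emT: "emeasure lebesgue T < ennreal r"
      using T(4) emeasure_Diff_null_set[OF null Tm] by simp
    have Tl: "T \<in> lmeasurable"
      using emT Tm by (intro fmeasurableI) (auto intro: less_trans)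
    have mT: "measure lebesgue T < r"
      using emT Tl \<open>r > 0\<close> by (simp add: emeasure_eq_measure2 ennreal_less_iff)
    have "\<exists>d>0. (x \<in> N \<longrightarrow> ball x d \<subseteq> T) \<and> (x \<in> {a..b} - N \<longrightarrow>
       (\<forall>y\<in>{a..b}. norm (y-x) < d \<longrightarrow> norm (f y - f x - (y-x) *\<^sub>R g x) \<le> e * norm (y-x)))" for x
    proof (cases "x \<in> N")
      case True
      then show ?thesis using T(1,2) by (auto simp: open_contains_ball)
    next
      case False
      then show ?thesis
        using vd[unfolded has_vector_derivative_def has_derivative_within_alt] \<open>e > 0\<close>
        by (cases "x \<in> {a..b}") (force intro: exI[of _ "1::real"])+
    qed
    then obtain d where d: "\<And>x. 0 < d x" "\<And>x. x \<in> N \<Longrightarrow> ball x (d x) \<subseteq> T"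
       "\<And>x y. \<lbrakk>x \<in> {a..b} - N; y \<in> {a..b}; norm (y-x) < d x\<rbrakk>
                        \<Longrightarrow> norm (f y - f x - (y-x) *\<^sub>R g x) \<le> e * norm (y-x)"
      by metis
    show "\<exists>\<gamma>. gauge \<gamma> \<and> (\<forall>p. p tagged_division_of {a..b} \<and> \<gamma> fine p \<longrightarrow>
      norm ((\<Sum>(x, k)\<in>p. measure lborel k *\<^sub>R g0 x) - (f b - f a)) < e0)"
    proof (intro exI conjI allI impI; (elim conjE)?)
      show "gauge (\<lambda>x. ball x (d x))"
        using d(1) gauge_ball_dependent by blast
      fix p
      assume ptag: "p tagged_division_of {a..b}" and finep: "(\<lambda>x. ball x (d x)) fine p"
      have fin: "finite p" using ptag by blast
      have pk: "a \<le> Inf (snd n) \<and> Inf (snd n) \<le> Sup (snd n) \<and> Sup (snd n) \<le> b"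
          "snd n = {Inf (snd n)..Sup (snd n)}" "Inf (snd n) \<in> snd n" "Sup (snd n) \<in> snd n"
          "interior (snd n) = {Inf (snd n)<..<Sup (snd n)}" "snd n \<in> lmeasurable"
          "measure lebesgue (snd n) = Sup (snd n) - Inf (snd n)"
          "fst n \<in> snd n" "fst n \<in> {a..b}" "snd n \<subseteq> ball (fst n) (d (fst n))" if n: "n \<in> p" for n
      proof -
        have xk: "(fst n, snd n) \<in> p" using n by simp
        obtain u v where uv: "snd n = {u..v}"
          using tagged_division_ofD(4)[OF ptag xk] by auto
        have n': "fst n \<in> snd n" "snd n \<subseteq> {a..b}"
          using tagged_division_ofD(2,3)[OF ptag xk] by auto
        then have "u \<le> v" using uv by auto
        moreover from n' uv \<open>u \<le> v\<close> have "a \<le> u" "v \<le> b" by auto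
        ultimately show "a \<le> Inf (snd n) \<and> Inf (snd n) \<le> Sup (snd n) \<and> Sup (snd n) \<le> b"
          "snd n = {Inf (snd n)..Sup (snd n)}" "Inf (snd n) \<in> snd n" "Sup (snd n) \<in> snd n"
          "interior (snd n) = {Inf (snd n)<..<Sup (snd n)}" "snd n \<in> lmeasurable"
          "measure lebesgue (snd n) = Sup (snd n) - Inf (snd n)"
          unfolding uv by simp_all
        show "fst n \<in> snd n" "fst n \<in> {a..b}" using n' by auto
        show "snd n \<subseteq> ball (fst n) (d (fst n))"
          using finep xk unfolding fine_def by blast
      qed
      define p1 where "p1 = {(x, K) \<in> p. x \<notin> N}"
      define p2 where "p2 = {(x, K) \<in> p. x \<in> N}"
      have p12: "p = p1 \<union> p2" "p1 \<inter> p2 = {}" "p1 \<subseteq> p" "p2 \<subseteq> p" "finite p1" "finite p2"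
        using fin by (auto simp: p1_def p2_def elim: rev_finite_subset)
      have len: "b - a = (\<Sum>(x,K)\<in>p. Sup K - Inf K)" and fab: "f b - f a = (\<Sum>(x,K)\<in>p. f(Sup K) - f(Inf K))"
        using additive_tagged_division_1[OF ab ptag, of "\<lambda>x. x"] additive_tagged_division_1[OF ab ptag, of f]
        by auto
      have "norm (\<Sum>(x, K) \<in> p1. (measure lborel K *\<^sub>R g0 x) - (f (Sup K) - f (Inf K)))
          \<le> (\<Sum>n\<in>p1. e * (case n of (x, k) \<Rightarrow> Sup k - Inf k))"
      proof (rule sum_norm_le, safe)
        fix x K assume xk: "(x, K) \<in> p1"
        then have xN: "x \<notin> N" and xKp: "(x, K) \<in> p" by (auto simp: p1_def)
        note k = pk[OF xKp, unfolded fst_conv snd_conv]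
        define u v where "u = Inf K" and "v = Sup K"
        have uv: "u \<in> {a..b}" "v \<in> {a..b}" "u \<le> x" "x \<le> v" "x \<in> {a..b}"
          using k(1,2,8,9) atLeastAtMost_iff[of x "Inf K" "Sup K"] unfolding u_def v_def by auto
        have nu: "norm (u - x) < d x" and nv: "norm (v - x) < d x"
          using subsetD[OF k(10) k(3)] subsetD[OF k(10) k(4)] unfolding u_def v_def
          by (auto simp: dist_real_def)
        \<comment> \<open>Straddle estimate: the linear approximation at the tag \<open>x\<close> is
          used at both endpoints, and as the tag lies between them the two errors add up to
          \<open>e\<close> times the length.\<close>
        have "norm ((v - u) *\<^sub>R g x - (f v - f u)) = norm (f u - f x - (u - x) *\<^sub>R g x - (f v - f x - (v - x) *\<^sub>R g x))"
          by (auto simp: algebra_simps)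
        also have "\<dots> \<le> norm (f u - f x - (u - x) *\<^sub>R g x) + norm (f v - f x - (v - x) *\<^sub>R g x)"
          by (rule norm_triangle_ineq4)
        also have "\<dots> \<le> e * norm (u - x) + e * norm (v - x)"
          using uv xN nu nv by (intro add_mono d(3)) auto
        also have "\<dots> = e * (v - u)"
          using uv by (simp add: algebra_simps)
        finally show "norm (measure lborel K *\<^sub>R g0 x - (f (Sup K) - f (Inf K))) \<le> e * (Sup K - Inf K)"
          using k(1,2) xN by (metis (no_types, lifting) DiffI content_real g0_def u_def v_def)
      qed
      also have "\<dots> \<le> (\<Sum>n\<in>p. e * (case n of (x, k) \<Rightarrow> Sup k - Inf k))"
        using pk(1) \<open>e > 0\<close> by (intro sum_mono2[OF fin p12(3)]) (force simp: split_def)+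
      also have "\<dots> = e * (b - a)"
        by (simp add: len sum_distrib_left)
      finally have b1: "norm (\<Sum>(x, K) \<in> p1. (measure lborel K *\<^sub>R g0 x) - (f (Sup K) - f (Inf K))) \<le> e * (b - a)" .
      have b2: "(\<Sum>n\<in>p2. norm (f (Sup (snd n)) - f (Inf (snd n)))) < e"
      proof (rule r[rule_format])
        show "a \<le> Inf (snd n) \<and> Inf (snd n) \<le> Sup (snd n) \<and> Sup (snd n) \<le> b" if "n \<in> p2" for n
          using pk(1) that p12(4) by blast
        show "disjoint_family_on (\<lambda>n. {Inf (snd n)<..<Sup (snd n)}) p2"
          unfolding disjoint_family_on_def
        proof (intro ballI impI)
          fix m n assume mn: "m \<in> p2" "n \<in> p2" "m \<noteq> n"
          then have "interior (snd m) \<inter> interior (snd n) = {}"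
            using tagged_division_ofD(5)[OF ptag] p12(4) by (metis prod.collapse subsetD)
          then show "{Inf (snd m)<..<Sup (snd m)} \<inter> {Inf (snd n)<..<Sup (snd n)} = {}"
            using mn pk(5) p12(4) by blast
        qed
        \<comment> \<open>These intervals lie in \<open>T\<close> and overlap only in null sets, so
          their total length is at most the measure of \<open>T\<close>.\<close>
        have "(\<Sum>n\<in>p2. Sup (snd n) - Inf (snd n)) = (\<Sum>n\<in>p2. measure lebesgue (snd n))"
          using pk(7) p12(4) by (intro sum.cong refl) (metis subsetD)
        also have "\<dots> = measure lebesgue (\<Union>n\<in>p2. snd n)"
        proof (rule measure_negligible_finite_Union_image[symmetric, OF p12(6)])
          show "snd n \<in> lmeasurable" if "n \<in> p2" for n
            using pk(6) that p12(4) by blast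
          show "pairwise (\<lambda>S T. negligible (snd S \<inter> snd T)) p2"
            unfolding pairwise_def
          proof (intro ballI impI)
            fix m n assume mn: "m \<in> p2" "n \<in> p2" "m \<noteq> n"
            then have i: "interior (snd m) \<inter> interior (snd n) = {}"
              using tagged_division_ofD(5)[OF ptag] p12(4) by (metis prod.collapse subsetD)
            have "convex (snd m \<inter> snd n)"
              using pk(2)[of m] pk(2)[of n] mn p12(4) convex_Int convex_real_interval(5) by (metis subsetD)
            then have "negligible (snd m \<inter> snd n) \<longleftrightarrow> interior (snd m \<inter> snd n) = {}"
              using negligible_convex_interior by blast
            with i show "negligible (snd m \<inter> snd n)" by simp
          qed
        qed
        also have "\<dots> \<le> measure lebesgue T"
        proof (rule measure_mono_fmeasurable)
          show "(\<Union>n\<in>p2. snd n) \<subseteq> T"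
            using pk(10) d(2) by (fastforce simp: p2_def)
          show "(\<Union>n\<in>p2. snd n) \<in> sets lebesgue"
            using pk(6) p12(4,6) by (intro sets.finite_UN) (auto dest: fmeasurableD)
        qed (rule Tl)
        also have "\<dots> < r" by (rule mT)
        finally show "(\<Sum>n\<in>p2. Sup (snd n) - Inf (snd n)) < r" .
      qed (rule p12(6))
      have "norm (\<Sum>(x, K) \<in> p2. (measure lborel K *\<^sub>R g0 x) - (f (Sup K) - f (Inf K)))
          \<le> (\<Sum>n\<in>p2. norm (f (Sup (snd n)) - f (Inf (snd n))))"
        by (rule sum_norm_le) (auto simp: p2_def g0_def norm_minus_commute)
      moreover have eq: "(\<Sum>(x, k)\<in>p. measure lborel k *\<^sub>R g0 x) - (f b - f a)
         = (\<Sum>(x, K) \<in> p1. (measure lborel K *\<^sub>R g0 x) - (f (Sup K) - f (Inf K)))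
         + (\<Sum>(x, K) \<in> p2. (measure lborel K *\<^sub>R g0 x) - (f (Sup K) - f (Inf K)))"
        unfolding fab using p12
        by (simp add: sum_subtractf[symmetric] split_def sum.union_disjoint[symmetric])
      moreover note b1 b2 e0 \<open>e0 > 0\<close>
        norm_triangle_ineq[of "\<Sum>(x, K) \<in> p1. (measure lborel K *\<^sub>R g0 x) - (f (Sup K) - f (Inf K))"
          "\<Sum>(x, K) \<in> p2. (measure lborel K *\<^sub>R g0 x) - (f (Sup K) - f (Inf K))"]
      ultimately show "norm ((\<Sum>(x, k)\<in>p. measure lborel k *\<^sub>R g0 x) - (f b - f a)) < e0"
        unfolding eq by linarith
    qed
  qed
qed

text \<open>\<open>abs_continuous_has_integral\<close> gives only gauge integrability, while the
  calibration needs the norm of \<open>g\<close> to be integrable. On intervals shorter than the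
  modulus of absolute continuity for 1, the increments of \<open>f\<close> over any division sum to
  less than 1, so the indefinite integral has bounded variation there; such intervals are then
  glued.\<close>

lemma abs_continuous_absolutely_integrable:
  fixes f :: "real \<Rightarrow> 'a::euclidean_space"
  assumes ab: "a \<le> b" and ac: "abs_continuous_on_Icc a b f" and N: "negligible N"
    and vd: "\<And>x. x \<in> {a..b} - N \<Longrightarrow> (f has_vector_derivative g x) (at x within {a..b})"
  shows "g absolutely_integrable_on {a..b}"
proof -
  have hi: "(g has_integral (f t - f s)) {s..t}" if "a \<le> s" "s \<le> t" "t \<le> b" for s t
    using that by (intro abs_continuous_has_integral[OF _ abs_continuous_on_Icc_subset[OF ac] N])
      (auto intro: has_vector_derivative_within_subset[OF vd])
  obtain r where "r > 0" and r: "\<forall>I s t. finite (I :: real set set) \<longrightarrow>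
        (\<forall>i\<in>I. a \<le> s i \<and> s i \<le> t i \<and> t i \<le> b) \<longrightarrow>
        disjoint_family_on (\<lambda>i. {s i<..<t i}) I \<longrightarrow> (\<Sum>i\<in>I. t i - s i) < r \<longrightarrow>
        (\<Sum>i\<in>I. norm (f (t i) - f (s i))) < 1"
      using abs_continuous_on_Icc_finite[OF ac zero_less_one] by blast
  have small: "g absolutely_integrable_on {s..t}" if st: "a \<le> s" "s \<le> t" "t \<le> b" "t - s < r" for s t
    unfolding box_real(2)[symmetric]
  proof (rule bounded_variation_absolutely_integrable_interval)
    show "g integrable_on cbox s t" using hi[OF st(1-3)] by auto
    fix D assume D: "D division_of cbox s t"
    have dk: "s \<le> Inf K \<and> Inf K \<le> Sup K \<and> Sup K \<le> t" "K = {Inf K..Sup K}"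
      "interior K = {Inf K<..<Sup K}" "measure lborel K = Sup K - Inf K" if K: "K \<in> D" for K
    proof -
      obtain u v where uv: "K = {u..v}" using division_ofD(4)[OF D K] by auto
      have K': "K \<noteq> {}" "K \<subseteq> {s..t}" using division_ofD(2,3)[OF D K] by auto
      then have "u \<le> v" using uv by auto
      moreover from K' uv \<open>u \<le> v\<close> have "s \<le> u" "v \<le> t" by auto
      ultimately show "s \<le> Inf K \<and> Inf K \<le> Sup K \<and> Sup K \<le> t" "K = {Inf K..Sup K}"
        "interior K = {Inf K<..<Sup K}" "measure lborel K = Sup K - Inf K"
        unfolding uv by simp_all
    qed
    have "(\<Sum>K\<in>D. norm (integral K g)) = (\<Sum>K\<in>D. norm (f (Sup K) - f (Inf K)))"
    proof (intro sum.cong refl)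
      fix K assume K: "K \<in> D"
      have "(g has_integral (f (Sup K) - f (Inf K))) {Inf K..Sup K}"
        using dk(1)[OF K] st by (intro hi) auto
      then show "norm (integral K g) = norm (f (Sup K) - f (Inf K))"
        using dk(2)[OF K] integral_unique by metis
    qed
    also have "\<dots> < 1"
    proof (rule r[rule_format])
      show "finite D" using D by blast
      show "a \<le> Inf K \<and> Inf K \<le> Sup K \<and> Sup K \<le> b" if "K \<in> D" for K
        using dk(1)[OF that] st by linarith
      show "disjoint_family_on (\<lambda>K. {Inf K<..<Sup K}) D"
        unfolding disjoint_family_on_def
      proof (intro ballI impI)
        fix K L assume KL: "K \<in> D" "L \<in> D" "K \<noteq> L"
        then have "interior K \<inter> interior L = {}" using D by blast
        then show "{Inf K<..<Sup K} \<inter> {Inf L<..<Sup L} = {}" using KL dk(3) by blast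
      qed
      have "(\<Sum>K\<in>D. Sup K - Inf K) = (\<Sum>K\<in>D. measure lborel K)"
        using dk(4) by (intro sum.cong refl) metis
      also have "\<dots> = measure lborel (cbox s t)"
        using additive_content_division[OF D] by simp
      finally show "(\<Sum>K\<in>D. Sup K - Inf K) < r" using st by simp
    qed
    finally show "(\<Sum>K\<in>D. norm (integral K g)) \<le> 1" by simp
  qed
  \<comment> \<open>The guards sit inside \<open>Q\<close> because the local condition of Bolzano's
    principle ranges over short intervals that may stick out of \<open>{a..b}\<close>.\<close>
  define Q where "Q = (\<lambda>s t. a \<le> s \<longrightarrow> t \<le> b \<longrightarrow> g absolutely_integrable_on {s..t})"
  have "Q a b"
    using ab
  proof (induction rule: Bolzano)
    case (trans x y z)
    have "g absolutely_integrable_on {x..y} \<union> {y..z}" if "a \<le> x" "z \<le> b"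
      using trans that by (intro absolutely_integrable_Un) (auto simp: Q_def)
    moreover have "{x..y} \<union> {y..z} = {x..z}" using trans by auto
    ultimately show ?case by (simp add: Q_def)
  next
    case (local x)
    show ?case using \<open>r > 0\<close> small by (auto simp: Q_def intro!: exI[of _ r])
  qed
  then show ?thesis by (simp add: Q_def)
qed

text \<open>All Saks--Henstock sums of \<open>f\<close> are small, hence so are the Riemann sums of its norm.\<close>

lemma has_integral_subintervals_0_imp_negligible:
  fixes f :: "real \<Rightarrow> 'a::euclidean_space"
  assumes f: "\<And>s t. \<lbrakk>a \<le> s; s \<le> t; t \<le> b\<rbrakk> \<Longrightarrow> (f has_integral 0) {s..t}"
  shows "negligible {x \<in> {a..b}. f x \<noteq> 0}"
proof (cases "a \<le> b")
  case True
  have 0: "((\<lambda>x. norm (f x)) has_integral 0) {a..b}"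
    unfolding has_integral_real
  proof (intro allI impI)
    fix e :: real assume "e > 0"
    have "f integrable_on cbox a b" using f[of a b] True by auto
    then obtain \<gamma> where \<gamma>: "gauge \<gamma>"
      "\<And>p. \<lbrakk>p tagged_partial_division_of (cbox a b); \<gamma> fine p\<rbrakk>
        \<Longrightarrow> (\<Sum>(x,K)\<in>p. norm (measure lborel K *\<^sub>R f x - integral K f)) < e"
      using Henstock_lemma[OF _ \<open>e > 0\<close>] by blast
    have "norm ((\<Sum>(x, k)\<in>p. measure lborel k *\<^sub>R norm (f x)) - 0) < e"
      if p: "p tagged_division_of {a..b}" "\<gamma> fine p" for p
    proof -
      have "norm ((\<Sum>(x, k)\<in>p. measure lborel k *\<^sub>R norm (f x)) - 0) = (\<Sum>(x, k)\<in>p. measure lborel k *\<^sub>R norm (f x))"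
        by (simp add: sum_nonneg split_def)
      also have "\<dots> = (\<Sum>(x,K)\<in>p. norm (measure lborel K *\<^sub>R f x - integral K f))"
      proof (intro sum.cong refl, clarify)
        fix x K assume xk: "(x, K) \<in> p"
        obtain u v where "K = {u..v}" using tagged_division_ofD(4)[OF p(1) xk] by auto
        moreover have "x \<in> K" "K \<subseteq> {a..b}" using tagged_division_ofD(2,3)[OF p(1) xk] by auto
        ultimately have "integral K f = 0" using f[of u v] by (auto simp: integral_unique)
        then show "measure lborel K *\<^sub>R norm (f x) = norm (measure lborel K *\<^sub>R f x - integral K f)" by simp
      qed
      also have "\<dots> < e"
        using \<gamma>(2)[of p] p by (simp add: tagged_division_of_def)
      finally show ?thesis .
    qed
    then show "\<exists>\<gamma>. gauge \<gamma> \<and> (\<forall>\<D>. \<D> tagged_division_of {a..b} \<and> \<gamma> fine \<D> \<longrightarrow>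
         norm ((\<Sum>(x, k)\<in>\<D>. measure lborel k *\<^sub>R norm (f x)) - 0) < e)"
      using \<gamma>(1) by (intro exI[of _ \<gamma>]) simp
  qed
  have "(\<lambda>x. norm (f x)) absolutely_integrable_on {a..b}"
    using 0 by (intro nonnegative_absolutely_integrable_1) auto
  then have "AE x in lebesgue_on {a..b}. norm (f x) = 0"
    using 0 integral_nonneg_eq_0_iff_AE[of "lebesgue_on {a..b}" "\<lambda>x. norm (f x)"]
    by (simp add: lebesgue_integral_eq_integral integral_unique integrable_restrict_space set_integrable_def)
  then show ?thesis
  proof -
    have "AE x in lebesgue. x \<in> {a..b} \<longrightarrow> f x = 0"
      using \<open>AE x in lebesgue_on {a..b}. norm (f x) = 0\<close> by (simp add: AE_restrict_space_iff)
    then obtain N where N: "\<And>x. x \<in> space lebesgue - N \<Longrightarrow> x \<in> {a..b} \<longrightarrow> f x = 0" "N \<in> null_sets lebesgue"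
      by (rule AE_E3) (rule that)
    then have "{x \<in> {a..b}. f x \<noteq> 0} \<subseteq> N" by auto
    with N(2) show ?thesis
      using negligible_iff_null_sets negligible_subset by metis
  qed
next
  case False
  then show ?thesis by simp
qed

section \<open>The middle eigenvalue of a traceless Hermitian matrix\<close>

text \<open>The Hermitian form, conjugate linear in the first argument. The \<open>inner\<close> of
  complex vectors is only its real part, too weak to express complex orthogonality.\<close>

definition hip :: "complex^'n \<Rightarrow> complex^'n \<Rightarrow> complex" where
  "hip v w = (\<Sum>i\<in>UNIV. cnj (v $ i) * w $ i)"

lemma Re_hip: "Re (hip v w) = inner v w"
  by (simp add: hip_def inner_vec_def inner_complex_def)

lemma hip_add_right: "hip v (w + z) = hip v w + hip v z"
  by (simp add: hip_def algebra_simps sum.distrib)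

lemma hip_scale_right: "hip v (c *s w) = c * hip v w"
  by (simp add: hip_def sum_distrib_left algebra_simps)

lemma hip_diff_right: "hip v (w - z) = hip v w - hip v z"
  by (simp add: hip_def algebra_simps sum_subtractf)

lemma hip_scale_left: "hip (c *s v) w = cnj c * hip v w"
  by (simp add: hip_def sum_distrib_left algebra_simps)

lemma hip_commute: "hip w v = cnj (hip v w)"
  by (simp add: hip_def mult.commute)

lemma hip_self: "hip v v = of_real ((norm v)\<^sup>2)"
proof -
  have "Im (hip v v) = 0"
    using hip_commute[of v v] by (metis Im_complex_of_real Reals_cnj_iff complex_is_Real_iff)
  then show ?thesis
    by (simp add: complex_eq_iff Re_hip power2_norm_eq_inner)
qed

lemma scaleR_eq_vec_scale: "r *\<^sub>R (v :: complex^'n) = of_real r *s v"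
  unfolding vec_eq_iff vector_scaleR_component vector_smult_component
  by (simp add: scaleR_conv_of_real)

lemma hip_scaleR_right: "hip v (r *\<^sub>R w) = of_real r * hip v w"
  by (simp add: scaleR_eq_vec_scale hip_scale_right)

lemma matrix_vector_scaleR: "A *v (r *\<^sub>R w) = r *\<^sub>R (A *v w)" for A :: "complex^'n^'m"
  by (simp add: vec_eq_iff matrix_vector_mult_def scaleR_sum_right)

lemma hip_mult_adj: "hip v (A *v w) = hip (adj A *v v) w"
proof -
  have "hip v (A *v w) = (\<Sum>i\<in>UNIV. \<Sum>j\<in>UNIV. cnj (v $ i) * (A $ i $ j * w $ j))"
    by (simp add: hip_def matrix_vector_mult_def sum_distrib_left)
  also have "\<dots> = (\<Sum>j\<in>UNIV. \<Sum>i\<in>UNIV. cnj (v $ i) * (A $ i $ j * w $ j))"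
    by (rule sum.swap)
  also have "\<dots> = hip (adj A *v v) w"
    by (simp add: hip_def matrix_vector_mult_def adj_def sum_distrib_left sum_distrib_right ac_simps)
  finally show ?thesis .
qed

lemma adj_adj [simp]: "adj (adj A) = A"
  by (simp add: adj_def vec_eq_iff)

text \<open>A maximizer of the Rayleigh quotient on the orthogonal complement of a set of eigenvectors is an
  eigenvector.\<close>

lemma hermitian_next_eigenvector:
  fixes A :: "complex^'n^'n"
  assumes A: "adj A = A" and F: "\<And>v. v \<in> F \<Longrightarrow> \<exists>c. A *v v = c *s v"
    and ne: "\<exists>w. w \<noteq> 0 \<and> (\<forall>v\<in>F. hip v w = 0)"
  obtains x and m :: real where "norm x = 1" "\<And>v. v \<in> F \<Longrightarrow> hip v x = 0"
    "A *v x = of_real m *s x"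
    "\<And>w. (\<And>v. v \<in> F \<Longrightarrow> hip v w = 0) \<Longrightarrow> inner w (A *v w) \<le> m * (norm w)\<^sup>2"
proof -
  define W where "W = {w. \<forall>v\<in>F. hip v w = 0}"
  define q where "q w = inner w (A *v w)" for w
  have cont: "continuous_on UNIV (\<lambda>w. A *v w)"
    by (simp add: linear_continuous_on matrix_vector_mul_bounded_linear)
  have "closed W"
  proof -
    have "W = (\<Inter>v\<in>F. {w. hip v w = 0})" by (auto simp: W_def)
    moreover have "closed {w. hip v w = 0}" for v
      unfolding hip_def by (intro closed_Collect_eq continuous_intros)
    ultimately show ?thesis by auto
  qed
  then have "compact (W \<inter> sphere 0 1)"
    by (intro closed_Int_compact) auto
  moreover have "W \<inter> sphere 0 1 \<noteq> {}"
  proof -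
    obtain w where "w \<noteq> 0" "w \<in> W" using ne by (auto simp: W_def)
    then have "inverse (norm w) *\<^sub>R w \<in> W \<inter> sphere 0 1"
      by (simp add: W_def hip_scaleR_right)
    then show ?thesis by blast
  qed
  moreover have "continuous_on (W \<inter> sphere 0 1) q"
    unfolding q_def by (intro continuous_intros continuous_on_subset[OF cont]) auto
  ultimately obtain x where xS: "x \<in> W \<inter> sphere 0 1" "\<forall>y\<in>W \<inter> sphere 0 1. q y \<le> q x"
    using continuous_attains_sup[of "W \<inter> sphere 0 1" q] by blast
  then have x: "x \<in> W" "norm x = 1" and sup: "\<And>y. y \<in> W \<Longrightarrow> norm y = 1 \<Longrightarrow> q y \<le> q x"
    by auto
  have le: "q w \<le> q x * (norm w)\<^sup>2" if w: "w \<in> W" for w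
  proof (cases "w = 0")
    case True
    then show ?thesis by (simp add: q_def)
  next
    case False
    define y where "y = inverse (norm w) *\<^sub>R w"
    have "y \<in> W" "norm y = 1"
      using w False by (simp_all add: y_def W_def hip_scaleR_right)
    then have "q y \<le> q x" by (rule sup)
    moreover have "w = norm w *\<^sub>R y" using False by (simp add: y_def)
    moreover have "q (r *\<^sub>R y) = r\<^sup>2 * q y" for r
      by (simp add: q_def matrix_vector_scaleR power2_eq_square)
    ultimately have "q w = (norm w)\<^sup>2 * q y" by metis
    then show ?thesis
      using mult_right_mono[OF \<open>q y \<le> q x\<close>, of "(norm w)\<^sup>2"] by (simp add: mult.commute)
  qed
  \<comment> \<open>The residual of the eigenvalue equation is itself an admissible direction: the
    orthogonal complement of eigenvectors of a Hermitian matrix is invariant under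
    \<open>A\<close>.\<close>
  define z where "z = A *v x - q x *\<^sub>R x"
  have zW: "z \<in> W"
    unfolding W_def
  proof (intro CollectI ballI)
    fix v assume v: "v \<in> F"
    then obtain c where "A *v v = c *s v" using F by blast
    then show "hip v z = 0"
      using v x(1) by (simp add: z_def hip_diff_right hip_scaleR_right hip_mult_adj A
          hip_scale_left W_def)
  qed
  have sym: "inner v (A *v w) = inner (A *v v) w" for v w
    using hip_mult_adj[of v A w] A by (simp flip: Re_hip)
  define C where "C = q x * (norm z)\<^sup>2 - q z"
  \<comment> \<open>Moving from \<open>x\<close> towards \<open>z\<close> gains
    \<open>2 * t * (norm z)\<^sup>2\<close> to first order; maximality of \<open>x\<close> forces
    the term of second order to outweigh this for every \<open>t > 0\<close>, which fails for small
    \<open>t\<close> unless \<open>z = 0\<close>.\<close>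
  have tC: "2 * (norm z)\<^sup>2 \<le> t * C" if "t > 0" for t
  proof -
    have "x + t *\<^sub>R z \<in> W"
      using x(1) zW by (simp add: W_def hip_add_right hip_scaleR_right)
    then have L: "q (x + t *\<^sub>R z) \<le> q x * (norm (x + t *\<^sub>R z))\<^sup>2" by (rule le)
    have e1: "q (x + t *\<^sub>R z) = q x + 2 * t * inner z (A *v x) + t\<^sup>2 * q z"
      using sym[of x z]
      by (simp add: q_def matrix_vector_right_distrib matrix_vector_scaleR inner_simps
          inner_commute power2_eq_square algebra_simps)
    have e2: "(norm (x + t *\<^sub>R z))\<^sup>2 = 1 + 2 * t * inner z x + t\<^sup>2 * (norm z)\<^sup>2"
    proof -
      have "(norm (x + t *\<^sub>R z))\<^sup>2 = inner x x + 2 * t * inner z x + t\<^sup>2 * inner z z"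
        by (simp only: power2_norm_eq_inner inner_add_left inner_add_right inner_scaleR_left
            inner_scaleR_right inner_commute[of x z]) (simp add: power2_eq_square algebra_simps)
      then show ?thesis using x(2) by (simp add: dot_square_norm)
    qed
    have "(norm z)\<^sup>2 = inner z (A *v x) - q x * inner z x"
      unfolding power2_norm_eq_inner by (subst (2) z_def) (simp add: inner_simps)
    then have i: "inner z (A *v x) = (norm z)\<^sup>2 + q x * inner z x" by linarith
    have "t * (2 * n) - t * (t * (q x * n - q z))
       = q x + 2 * t * (n + q x * j) + t\<^sup>2 * q z - q x * (1 + 2 * t * j + t\<^sup>2 * n)" for n j
      by (simp add: power2_eq_square algebra_simps)
    from this[of "(norm z)\<^sup>2" "inner z x"] L[unfolded e1 e2 i] have "t * (2 * (norm z)\<^sup>2) \<le> t * (t * C)"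
      unfolding C_def by linarith
    then show ?thesis using \<open>t > 0\<close> by simp
  qed
  have "z = 0"
  proof (rule ccontr)
    assume "z \<noteq> 0"
    then have p: "(norm z)\<^sup>2 > 0" by simp
    then have C: "C > 0" using tC[of 1] by linarith
    have "2 * (norm z)\<^sup>2 \<le> (norm z)\<^sup>2 / C * C" using p C by (intro tC divide_pos_pos)
    moreover have "(norm z)\<^sup>2 / C * C = (norm z)\<^sup>2" using C by simp
    ultimately show False using p by linarith
  qed
  then have "A *v x = q x *\<^sub>R x" by (simp add: z_def)
  then have "A *v x = of_real (q x) *s x" by (simp only: scaleR_eq_vec_scale)
  then show ?thesis
    using x le by (intro that[of x "q x"]) (auto simp: W_def q_def)
qed

text \<open>Complex orthogonality to \<open>v i\<close> is real orthogonality to both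
  \<open>v i\<close> and \<open>\<i> *s v i\<close>; these are at most \<open>2 * k\<close> vectors
  in a real space of dimension \<open>2 * CARD('n)\<close>.\<close>

lemma exists_hip_orthogonal:
  fixes v :: "nat \<Rightarrow> complex^'n"
  assumes k: "k < CARD('n)"
  shows "\<exists>w. w \<noteq> 0 \<and> (\<forall>i<k. hip (v i) w = 0)"
proof -
  define S where "S = v ` {..<k} \<union> (\<lambda>i. \<i> *s v i) ` {..<k}"
  have "card S \<le> card (v ` {..<k}) + card ((\<lambda>i. \<i> *s v i) ` {..<k})"
    unfolding S_def by (rule card_Un_le)
  also have "\<dots> \<le> k + k"
    by (intro add_mono) (metis card_image_le card_lessThan finite_lessThan)+
  finally have "card S \<le> 2 * k" by simp
  moreover have "dim S \<le> card S" by (intro dim_le_card') (simp add: S_def)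
  ultimately have "dim S < DIM(complex^'n)" using k by simp
  then obtain w where w: "w \<noteq> 0" "\<And>y. y \<in> span S \<Longrightarrow> orthogonal w y"
    by (rule orthogonal_to_subspace_exists) blast
  have "hip (v i) w = 0" if "i < k" for i
  proof -
    have "v i \<in> span S" "\<i> *s v i \<in> span S"
      using that by (auto simp: S_def intro!: span_base)
    then have "inner w (v i) = 0" "inner w (\<i> *s v i) = 0" using w(2) by (auto simp: orthogonal_def)
    then have "Re (hip (v i) w) = 0" "Re (hip (\<i> *s v i) w) = 0"
      by (simp_all add: Re_hip inner_commute)
    then show ?thesis by (simp add: complex_eq_iff hip_scale_left)
  qed
  with w(1) show ?thesis by blast
qed

text \<open>Induction on \<open>k\<close>, adding a maximizer on the complement of the vectors found
  so far. The third clause keeps the maximality, from which the order of the eigenvalues is later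
  read off without any sorting.\<close>

lemma hermitian_orthonormal_eigenvectors:
  fixes A :: "complex^'n^'n"
  assumes A: "adj A = A" and k: "k \<le> CARD('n)"
  shows "\<exists>(v::nat \<Rightarrow> complex^'n) (a::nat \<Rightarrow> real).
    (\<forall>i<k. \<forall>j<k. hip (v i) (v j) = (if i = j then 1 else 0)) \<and>
    (\<forall>i<k. A *v v i = of_real (a i) *s v i) \<and>
    (\<forall>i<k. \<forall>w. (\<forall>j<i. hip (v j) w = 0) \<longrightarrow> inner w (A *v w) \<le> a i * (norm w)\<^sup>2)"
  using k
proof (induction k)
  case 0
  then show ?case by simp
next
  case (Suc k)
  then obtain v a where IH: "\<And>i j. i < k \<Longrightarrow> j < k \<Longrightarrow> hip (v i) (v j) = (if i = j then 1 else 0)"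
    "\<And>i. i < k \<Longrightarrow> A *v v i = of_real (a i) *s v i"
    "\<And>i w. i < k \<Longrightarrow> (\<forall>j<i. hip (v j) w = 0) \<Longrightarrow> inner w (A *v w) \<le> a i * (norm w)\<^sup>2"
    by (metis Suc_leD)
  obtain x m where x: "norm x = 1" "\<And>u. u \<in> v ` {..<k} \<Longrightarrow> hip u x = 0" "A *v x = of_real m *s x"
    "\<And>w. (\<And>u. u \<in> v ` {..<k} \<Longrightarrow> hip u w = 0) \<Longrightarrow> inner w (A *v w) \<le> m * (norm w)\<^sup>2"
  proof (rule hermitian_next_eigenvector[OF A, of "v ` {..<k}"])
    show "\<exists>c. A *v u = c *s u" if "u \<in> v ` {..<k}" for u using that IH(2) by blast
    show "\<exists>w. w \<noteq> 0 \<and> (\<forall>u\<in>v ` {..<k}. hip u w = 0)"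
      using exists_hip_orthogonal[of k v] Suc.prems by auto
  qed blast
  have xv: "hip (v i) x = 0" "hip x (v i) = 0" if "i < k" for i
    using x(2)[of "v i"] that hip_commute[of x "v i"] by auto
  define v' where "v' = v(k := x)"
  define a' where "a' = a(k := m)"
  have "\<forall>i<Suc k. \<forall>j<Suc k. hip (v' i) (v' j) = (if i = j then 1 else 0)"
    using IH(1) xv x(1) by (auto simp: v'_def less_Suc_eq hip_self)
  moreover have "\<forall>i<Suc k. A *v v' i = of_real (a' i) *s v' i"
    using IH(2) x(3) by (auto simp: v'_def a'_def less_Suc_eq)
  moreover have "\<forall>i<Suc k. \<forall>w. (\<forall>j<i. hip (v' j) w = 0) \<longrightarrow> inner w (A *v w) \<le> a' i * (norm w)\<^sup>2"
    using IH(3) x(4) by (auto simp: v'_def a'_def less_Suc_eq)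
  ultimately show ?case by blast
qed

section \<open>Unitary diagonalization with ordered eigenvalues\<close>

definition cdiag :: "real^'n \<Rightarrow> complex^'n^'n" where
  "cdiag a = diag (\<chi> i. of_real (a $ i))"

lemma cdiag_mult_vector: "(cdiag a *v x) $ i = of_real (a $ i) * x $ i"
  by (simp add: cdiag_def diag_def matrix_vector_mult_def if_distrib[of "\<lambda>z. z * _"] cong: if_cong)

lemma cdiag_mult_cdiag: "cdiag a ** cdiag b = cdiag (\<chi> i. a $ i * b $ i)"
  by (auto simp: cdiag_def diag_def matrix_matrix_mult_def vec_eq_iff if_distrib[of "\<lambda>z. z * _"] cong: if_cong)

lemma trace_cdiag: "trace (cdiag a) = of_real (\<Sum>i\<in>UNIV. a $ i)"
  by (simp add: trace_def cdiag_def diag_def)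

text \<open>The enumeration \<open>ix\<close> fixes what decreasing order means. The rows of
  \<open>U\<close> are the conjugated eigenvectors, so \<open>adj U\<close> has the eigenvectors as
  columns.\<close>

theorem hermitian_diagonalization:
  fixes A :: "complex^'n^'n"
  assumes A: "adj A = A" and ix: "bij_betw ix (UNIV :: 'n set) {..<CARD('n)}"
  obtains U and a :: "real^'n" where "adj U ** U = mat 1" "U ** adj U = mat 1" "A = adj U ** cdiag a ** U"
    "\<And>i j. ix i < ix j \<Longrightarrow> a $ j \<le> a $ i"
proof -
  obtain v and a :: "nat \<Rightarrow> real" where on: "\<And>i j. i < CARD('n) \<Longrightarrow> j < CARD('n) \<Longrightarrow> hip (v i) (v j) = (if i = j then 1 else 0)"
    and ev: "\<And>i. i < CARD('n) \<Longrightarrow> A *v v i = of_real (a i) *s v i"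
    and le: "\<And>i w. i < CARD('n) \<Longrightarrow> (\<forall>j<i. hip (v j) w = 0) \<Longrightarrow> inner w (A *v w) \<le> a i * (norm w)\<^sup>2"
    using hermitian_orthonormal_eigenvectors[OF A order_refl] by metis
  have lt: "ix i < CARD('n)" and inj: "ix i = ix j \<longleftrightarrow> i = j" for i j
    using ix by (auto simp: bij_betw_def inj_def)
  define U :: "complex^'n^'n" where "U = (\<chi> i j. cnj (v (ix i) $ j))"
  define b :: "real^'n" where "b = (\<chi> i. a (ix i))"
  have UU: "U ** adj U = mat 1"
    using on[OF lt lt] by (simp add: U_def adj_def matrix_matrix_mult_def mat_def vec_eq_iff hip_def inj)
  then have UU': "adj U ** U = mat 1" using matrix_left_right_inverse by blast
  have "A ** adj U = adj U ** cdiag b"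
  proof -
    have "(A ** adj U) $ i $ j = (A *v v (ix j)) $ i" for i j
      by (simp add: matrix_matrix_mult_def matrix_vector_mult_def U_def adj_def)
    moreover have "(adj U ** cdiag b) $ i $ j = of_real (a (ix j)) * v (ix j) $ i" for i j
      by (simp add: matrix_matrix_mult_def U_def adj_def cdiag_def diag_def b_def
          if_distrib[of "\<lambda>z. _ * z"] cong: if_cong)
    ultimately show ?thesis by (simp add: vec_eq_iff ev lt)
  qed
  then have "A = adj U ** cdiag b ** U"
    by (metis UU' matrix_mul_assoc matrix_mul_rid)
  moreover have "b $ j \<le> b $ i" if "ix i < ix j" for i j
  proof -
    \<comment> \<open>The later eigenvector is orthogonal to everything before position
      \<open>ix i\<close>, hence competes in the maximum that defines
      \<open>a (ix i)\<close>.\<close>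
    have "inner (v (ix j)) (A *v v (ix j)) \<le> a (ix i) * (norm (v (ix j)))\<^sup>2"
    proof (intro le lt allI impI)
      fix l assume "l < ix i"
      then show "hip (v l) (v (ix j)) = 0"
        using that on[of l "ix j"] lt[of j] by simp
    qed
    moreover have "inner (v (ix j)) (A *v v (ix j)) = a (ix j) * (norm (v (ix j)))\<^sup>2"
      by (simp add: ev lt hip_scale_right hip_self flip: Re_hip)
    moreover have "complex_of_real ((norm (v (ix j)))\<^sup>2) = 1" using on[OF lt lt, of j j] by (simp add: hip_self)
    then have "(norm (v (ix j)))\<^sup>2 = 1" by (simp only: of_real_eq_1_iff)
    ultimately show ?thesis by (simp add: b_def)
  qed
  ultimately show ?thesis using UU UU' by (intro that) auto
qed

lemma inner_diagonalized:
  assumes A: "A = adj U ** cdiag a ** U"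
  shows "inner v (A *v v) = (\<Sum>i\<in>UNIV. a $ i * (cmod ((U *v v) $ i))\<^sup>2)"
proof -
  have "hip v (A *v v) = hip (U *v v) (cdiag a *v (U *v v))"
    by (simp add: A hip_mult_adj[of v "adj U"] flip: matrix_vector_mul_assoc)
  also have "\<dots> = (\<Sum>i\<in>UNIV. of_real (a $ i) * (cnj ((U *v v) $ i) * (U *v v) $ i))"
    by (simp add: hip_def cdiag_mult_vector mult.left_commute)
  also have "\<dots> = of_real (\<Sum>i\<in>UNIV. a $ i * (cmod ((U *v v) $ i))\<^sup>2)"
    by (simp add: mult.commute flip: complex_norm_square)
  finally show ?thesis by (metis Re_complex_of_real Re_hip)
qed

lemma norm_unitary:
  fixes U :: "complex^'n^'n"
  assumes "adj U ** U = mat 1"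
  shows "(norm v)\<^sup>2 = (\<Sum>i\<in>UNIV. (cmod ((U *v v) $ i))\<^sup>2)"
proof -
  have "adj U ** cdiag 1 ** U = mat 1"
  proof -
    have "cdiag 1 = (mat 1 :: complex^'n^'n)" by (simp add: cdiag_def diag_def mat_def vec_eq_iff)
    then show ?thesis using assms by (simp add: matrix_mul_rid)
  qed
  from inner_diagonalized[OF this[symmetric], of v] show ?thesis
    by (simp add: power2_norm_eq_inner)
qed

lemma trace_unitary_conj:
  assumes "U ** adj U = mat 1"
  shows "trace (adj U ** M ** U) = trace M"
  by (metis assms matrix_mul_assoc matrix_mul_rid trace_mul_sym)

text \<open>Since the potential sees only traces of powers, this turns it into a symmetric
  polynomial in the eigenvalues.\<close>

lemma trace_diagonalized:
  assumes U: "U ** adj U = mat 1" and A: "A = adj U ** cdiag a ** U"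
  shows "trace A = of_real (\<Sum>i\<in>UNIV. a $ i)"
    "trace (A ** A) = of_real (\<Sum>i\<in>UNIV. (a $ i)^2)"
    "trace (A ** A ** A ** A) = of_real (\<Sum>i\<in>UNIV. (a $ i)^4)"
proof -
  have m: "(adj U ** M ** U) ** (adj U ** N ** U) = adj U ** (M ** N) ** U" for M N
    by (metis U matrix_mul_assoc matrix_mul_rid)
  show "trace A = of_real (\<Sum>i\<in>UNIV. a $ i)"
    by (simp only: A trace_unitary_conj[OF U] trace_cdiag)
  show "trace (A ** A) = of_real (\<Sum>i\<in>UNIV. (a $ i)^2)"
    by (simp only: A m trace_unitary_conj[OF U] cdiag_mult_cdiag trace_cdiag) (simp add: power2_eq_square)
  show "trace (A ** A ** A ** A) = of_real (\<Sum>i\<in>UNIV. (a $ i)^4)"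
    by (simp only: A m trace_unitary_conj[OF U] cdiag_mult_cdiag trace_cdiag) (simp add: power4_eq_xxxx mult.assoc)
qed

text \<open>For unit \<open>v\<close> the traceless part of \<open>v v\<^sup>\<dagger>\<close> has norm \<open>sqrt (4 / 5)\<close>.\<close>

lemma inner_traceless_le:
  fixes M :: cmat5
  assumes tr: "trace M = 0"
  shows "\<bar>inner v (M *v v)\<bar> \<le> sqrt (4/5) * norm M * (norm v)\<^sup>2"
proof -
  define P :: cmat5 where "P = (\<chi> i j. v $ i * cnj (v $ j))"
  define I :: cmat5 where "I = mat 1"
  \<comment> \<open>The multiple of the identity carries the trace of \<open>P\<close>. Its inner
    product with the traceless \<open>M\<close> is zero, so Cauchy-Schwarz may use \<open>R\<close>,
    whose norm is sqrt(4/5) for unit \<open>v\<close>, in place of \<open>P\<close>, whose norm is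
    1.\<close>
  define R where "R = P - ((norm v)\<^sup>2 / 5) *\<^sub>R I"
  have tP: "Re (\<Sum>i\<in>UNIV. v $ i * cnj (v $ i)) = (norm v)\<^sup>2"
    unfolding power2_norm_eq_inner by (simp add: inner_vec_def inner_complex_def)
  have MI: "inner N I = Re (trace N)" for N :: cmat5
    by (simp add: I_def inner_vec_def mat_def trace_def if_distrib[of "inner _"] complex_inner_1_right cong: if_cong)
  have MP: "inner M P = inner v (M *v v)"
  proof -
    have "inner M P = (\<Sum>i\<in>UNIV. \<Sum>j\<in>UNIV. Re (cnj (v $ i) * (M $ i $ j * v $ j)))"
      unfolding inner_vec_def P_def
      by (intro sum.cong refl) (simp add: inner_complex_def algebra_simps)
    also have "\<dots> = inner v (M *v v)"
      by (simp add: hip_def matrix_vector_mult_def sum_distrib_left flip: Re_hip)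
    finally show ?thesis .
  qed
  have PP: "inner P P = (norm v)^4"
  proof -
    have "inner P P = (\<Sum>i\<in>UNIV. \<Sum>j\<in>UNIV. inner (v $ i) (v $ i) * inner (v $ j) (v $ j))"
      unfolding inner_vec_def P_def
      by (intro sum.cong refl) (simp add: inner_complex_def algebra_simps)
    also have "\<dots> = inner v v * inner v v"
      by (simp add: inner_vec_def sum_product)
    finally show ?thesis by (simp add: power4_eq_xxxx power2_eq_square flip: power2_norm_eq_inner)
  qed
  have PI: "inner P I = (norm v)\<^sup>2" unfolding MI using tP by (simp add: P_def trace_def)
  have II: "inner I I = 5" unfolding MI by (simp add: I_def trace_I)
  have "(norm R)\<^sup>2 = 4/5 * (norm v)^4"
  proof -
    define n where "n = (norm v)\<^sup>2"
    have "inner P P = n\<^sup>2" "inner P I = n" "(norm v)^4 = n\<^sup>2"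
      using PP PI by (simp_all add: n_def)
    moreover have "(norm R)\<^sup>2 = inner P P - 2 * (n/5) * inner P I + (n/5)\<^sup>2 * inner I I"
    proof -
      have Rn: "R = P - (n / 5) *\<^sub>R I" by (simp add: R_def n_def)
      show ?thesis
        by (simp only: Rn power2_norm_eq_inner inner_diff_left inner_diff_right inner_scaleR_left inner_scaleR_right
          inner_commute[of I P]) (simp add: power2_eq_square algebra_simps)
    qed
    ultimately show ?thesis using II by (simp add: power2_eq_square)
  qed
  then have "norm R = sqrt (4/5 * ((norm v)\<^sup>2)\<^sup>2)"
    by (simp add: real_sqrt_unique)
  then have nR: "norm R = sqrt (4/5) * (norm v)\<^sup>2"
    by (simp only: real_sqrt_mult real_sqrt_abs) simp
  have "inner M R = inner v (M *v v)"
    unfolding R_def by (simp add: inner_diff_right MP MI tr)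
  then show ?thesis
    using Cauchy_Schwarz_ineq2[of M R] nR by (simp add: mult.commute mult.left_commute)
qed

text \<open>Only the third position is pinned, with two entries above and two below in no particular
  order among themselves. This is what the dimension count in \<open>is_mid_diff_le\<close> and the
  quartic bound work with, and it makes diagonalizations easy to exhibit.\<close>

definition is_mid :: "cmat5 \<Rightarrow> real \<Rightarrow> bool" where
  "is_mid A x \<longleftrightarrow> (\<exists>U (a::real^5). adj U ** U = mat 1 \<and> U ** adj U = mat 1 \<and>
     A = adj U ** cdiag a ** U \<and> x \<le> a $ 1 \<and> x \<le> a $ 2 \<and> a $ 3 = x \<and> a $ 4 \<le> x \<and> a $ 5 \<le> x)"

lemma is_mid_exists:
  assumes "A \<in> h0"
  shows "\<exists>x. is_mid A x"
proof -
  \<comment> \<open>In the type \<open>5\<close> the numeral 5 equals 0, so the positions are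
    enumerated by hand and 5 goes to the last place.\<close>
  define ix :: "5 \<Rightarrow> nat" where "ix i = (if i = 1 then 0 else if i = 2 then 1 else if i = 3 then 2 else if i = 4 then 3 else 4)" for i
  have "bij_betw ix UNIV {..<CARD(5)}"
  proof -
    have "CARD(5) = 5" by simp
    moreover have "inj_on ix {1, 2, 3, 4, 5}" by (simp add: inj_on_def ix_def)
    moreover have "ix ` {1, 2, 3, 4, 5} = {..<5}" by (auto simp: ix_def)
    ultimately show ?thesis by (simp only: bij_betw_def UNIV_5)
  qed
  from hermitian_diagonalization[OF _ this, of A] assms obtain U a where
    "adj U ** U = mat 1" "U ** adj U = mat 1" "A = adj U ** cdiag a ** U"
    and le: "\<And>i j. ix i < ix j \<Longrightarrow> a $ j \<le> a $ i"
    unfolding h0_def by blast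
  moreover have "a $ 3 \<le> a $ 1" "a $ 3 \<le> a $ 2" "a $ 4 \<le> a $ 3" "a $ 5 \<le> a $ 3"
    by (rule le; simp add: ix_def)+
  ultimately show ?thesis unfolding is_mid_def by blast
qed

lemma h0_diff: "A \<in> h0 \<Longrightarrow> B \<in> h0 \<Longrightarrow> A - B \<in> h0"
  by (simp add: h0_def adj_def vec_eq_iff trace_sub)

text \<open>Courant--Fischer in disguise: the test vector \<open>v\<close> lies in the span of the upper three
  eigenvectors of \<open>A\<close> and of the lower three of \<open>B\<close>.\<close>

lemma is_mid_diff_le:
  assumes "is_mid A x" "is_mid B y" "A \<in> h0" "B \<in> h0"
  shows "x - y \<le> sqrt (4/5) * norm (A - B)"
proof -
  obtain U and a :: "real^5" where A: "adj U ** U = mat 1" "U ** adj U = mat 1" "A = adj U ** cdiag a ** U"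
    "x \<le> a $ 1" "x \<le> a $ 2" "a $ 3 = x"
    using assms(1) unfolding is_mid_def by blast
  obtain W and b :: "real^5" where B: "adj W ** W = mat 1" "W ** adj W = mat 1" "B = adj W ** cdiag b ** W"
    "b $ 3 = y" "b $ 4 \<le> y" "b $ 5 \<le> y"
    using assms(2) unfolding is_mid_def by blast
  \<comment> \<open>Four linear conditions on \<open>v\<close>: two rows of \<open>U\<close> remove
    the components along the lower eigenvectors of \<open>A\<close>, two rows of \<open>W\<close>
    those along the upper ones of \<open>B\<close>. The zero fifth row makes the system square and
    singular, so a nonzero solution exists.\<close>
  define N :: cmat5 where "N = (\<chi> i. if i = 1 then U $ 4 else if i = 2 then U $ 5
     else if i = 3 then W $ 1 else if i = 4 then W $ 2 else 0)"
  have "det N = 0"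
    by (rule det_zero_row(2)[of 5]) (simp add: N_def row_def vec_eq_iff)
  then obtain v where v: "v \<noteq> 0" "N *v v = 0"
    using invertible_det_nz[of N] matrix_left_invertible_ker[of N] invertible_left_inverse by blast
  have rows: "(U *v v) $ 4 = 0" "(U *v v) $ 5 = 0" "(W *v v) $ 1 = 0" "(W *v v) $ 2 = 0"
    using arg_cong[OF v(2), of "\<lambda>z. z $ 1"] arg_cong[OF v(2), of "\<lambda>z. z $ 2"]
      arg_cong[OF v(2), of "\<lambda>z. z $ 3"] arg_cong[OF v(2), of "\<lambda>z. z $ 4"]
    by (simp_all add: N_def matrix_vector_mult_def)
  have "x * (norm v)\<^sup>2 \<le> inner v (A *v v)"
    unfolding inner_diagonalized[OF A(3)] norm_unitary[OF A(1)] sum_distrib_left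
    using A(4-6) rows by (intro sum_mono) (metis (no_types, lifting) UNIV_5 UNIV_I insertE singletonD mult_right_mono norm_zero
       order_refl zero_le_power2 zero_power2 mult_zero_right)
  moreover have "inner v (B *v v) \<le> y * (norm v)\<^sup>2"
    unfolding inner_diagonalized[OF B(3)] norm_unitary[OF B(1)] sum_distrib_left
    using B(4-6) rows by (intro sum_mono) (metis (no_types, lifting) UNIV_5 UNIV_I insertE singletonD mult_right_mono norm_zero
       order_refl zero_le_power2 zero_power2 mult_zero_right)
  moreover have "inner v ((A - B) *v v) = inner v (A *v v) - inner v (B *v v)"
    by (simp add: matrix_vector_mult_diff_rdistrib inner_diff_right)
  moreover have "\<bar>inner v ((A - B) *v v)\<bar> \<le> sqrt (4/5) * norm (A - B) * (norm v)\<^sup>2"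
    using h0_diff[OF assms(3,4)] by (intro inner_traceless_le) (simp add: h0_def)
  ultimately have "(x - y) * (norm v)\<^sup>2 \<le> sqrt (4/5) * norm (A - B) * (norm v)\<^sup>2"
    by (simp add: left_diff_distrib)
  then show ?thesis using v(1) by simp
qed

definition mid :: "cmat5 \<Rightarrow> real" where
  "mid A = (THE x. is_mid A x)"

text \<open>Uniqueness comes from \<open>is_mid_diff_le\<close> with both matrices equal, where the
  right-hand side is zero.\<close>

lemma mid_eq:
  assumes "A \<in> h0" "is_mid A x"
  shows "mid A = x"
  unfolding mid_def
proof (rule the_equality[where P = "is_mid A", OF assms(2)])
  show "y = x" if "is_mid A y" for y
    using is_mid_diff_le[OF that assms(2)] is_mid_diff_le[OF assms(2) that] assms(1) by simp
qed

lemma is_mid_mid: "A \<in> h0 \<Longrightarrow> is_mid A (mid A)"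
  using is_mid_exists mid_eq by metis

lemma mid_lipschitz:
  assumes "A \<in> h0" "B \<in> h0"
  shows "\<bar>mid A - mid B\<bar> \<le> sqrt (4/5) * norm (A - B)"
  using is_mid_diff_le[OF is_mid_mid is_mid_mid, of A B] is_mid_diff_le[OF is_mid_mid is_mid_mid, of B A]
    assms by (simp add: norm_minus_commute abs_le_iff)

lemma continuous_on_mid: "continuous_on h0 mid"
  unfolding continuous_on_iff
proof (intro ballI allI impI)
  fix A and e :: real assume "A \<in> h0" "e > 0"
  then show "\<exists>d>0. \<forall>B\<in>h0. dist B A < d \<longrightarrow> dist (mid B) (mid A) < e"
  proof (intro exI[of _ e] conjI ballI impI)
    fix B assume "B \<in> h0" "dist B A < e"
    have "\<bar>mid B - mid A\<bar> \<le> sqrt (4/5) * norm (B - A)" by (rule mid_lipschitz) fact+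
    also have "\<dots> \<le> 1 * norm (B - A)" by (intro mult_right_mono) (auto simp: real_le_lsqrt)
    finally show "dist (mid B) (mid A) < e" using \<open>dist B A < e\<close> by (simp add: dist_norm)
  qed
qed

section \<open>Smooth cutoff functions\<close>

definition bump :: "real \<Rightarrow> real \<Rightarrow> real poly \<Rightarrow> nat \<Rightarrow> real \<Rightarrow> real" where
  "bump a b p m x = (if a < x \<and> x < b then
     poly p x * inverse ((x - a) * (b - x)) ^ m * exp (- inverse ((x - a) * (b - x))) else 0)"

text \<open>One term of the exponential series is at most its sum. This is the bound by which the
  exponential factor of \<open>bump\<close> beats any pole at the ends of the interval.\<close>

lemma power_mult_exp_minus_le:
  fixes w :: real
  assumes "w \<ge> 0"
  shows "w ^ n * exp (- w) \<le> fact n"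
proof -
  have "w ^ n / fact n \<le> exp w"
  proof -
    have "(\<Sum>k\<in>{n}. inverse (fact k) * w ^ k) \<le> (\<Sum>k. inverse (fact k) * w ^ k)"
      using assms by (intro sum_le_suminf[OF summable_exp]) auto
    then show ?thesis by (simp add: exp_def divide_inverse mult.commute)
  qed
  then show ?thesis
    by (simp add: exp_minus field_simps)
qed

text \<open>Handles the points outside the open interval together with its two endpoints, where the
  formula inside \<open>bump\<close> cannot be differentiated.\<close>

lemma has_field_derivative_0_quadratic:
  fixes f :: "real \<Rightarrow> real"
  assumes "\<And>y. \<bar>f y - f x\<bar> \<le> C * (y - x)\<^sup>2"
  shows "(f has_real_derivative 0) (at x)"
proof -
  have "((\<lambda>y. (f y - f x) / (y - x)) \<longlongrightarrow> 0) (at x)"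
  proof (rule Lim_null_comparison)
    show "\<forall>\<^sub>F y in at x. norm ((f y - f x) / (y - x)) \<le> C * \<bar>y - x\<bar>"
      unfolding eventually_at_filter
    proof (intro always_eventually allI impI)
      fix y assume "y \<noteq> x"
      then show "norm ((f y - f x) / (y - x)) \<le> C * \<bar>y - x\<bar>"
        using assms[of y] by (simp add: divide_le_eq power2_eq_square mult.assoc flip: abs_mult)
    qed
    show "((\<lambda>y. C * \<bar>y - x\<bar>) \<longlongrightarrow> 0) (at x)"
      by (auto intro!: tendsto_eq_intros)
  qed
  then show ?thesis by (simp add: has_field_derivative_iff)
qed

text \<open>Writing \<open>w = 1 / ((x - a) (b - x))\<close>, the functions \<open>p(x) w\<^sup>m exp (- w)\<close>, extended by zero
  outside the interval from \<open>a\<close> to \<open>b\<close>, form a class that is closed under differentiation.\<close>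

lemma bump_has_derivative:
  assumes "a < b"
  shows "\<exists>q. \<forall>x. (bump a b p m has_real_derivative bump a b q (m + 2) x) (at x)"
proof -
  define r where "r = [:- a, 1:] * [:b, - 1:]"
  \<comment> \<open>With \<open>w = 1 / r\<close> and \<open>w' = - r' w^2\<close>, the derivative
    of \<open>p w^m exp (- w)\<close> is
    \<open>(p' w^m - m p r' w^(m+1) + p r' w^(m+2)) exp (- w)\<close>; pulling out
    \<open>w^(m+2)\<close> by means of \<open>w r = 1\<close> leaves \<open>q\<close>.\<close>
  define q where "q = pderiv p * r\<^sup>2 + pderiv r * p * (1 - smult (of_nat m) r)"
  have pr: "poly r x = (x - a) * (b - x)" for x by (simp add: r_def algebra_simps)
  have "(bump a b p m has_real_derivative bump a b q (m + 2) x) (at x)" for x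
  proof (cases "a < x \<and> x < b")
    case True
    define w where "w = inverse (poly r x)"
    have rx: "poly r x \<noteq> 0" using True by (simp add: pr)
    have wr: "w * poly r x = 1" using rx by (simp add: w_def)
    have "((\<lambda>x. poly p x * inverse (poly r x) ^ m * exp (- inverse (poly r x))) has_real_derivative
       (poly (pderiv p) x * w ^ m + poly p x * (of_nat m * w ^ (m - 1) * (- (w * poly (pderiv r) x * w)))) * exp (- w)
         + poly p x * w ^ m * (exp (- w) * (w * poly (pderiv r) x * w))) (at x)"
      unfolding w_def using rx by (auto intro!: derivative_eq_intros simp: algebra_simps)
    also have "(poly (pderiv p) x * w ^ m + poly p x * (of_nat m * w ^ (m - 1) * (- (w * poly (pderiv r) x * w)))) * exp (- w)
         + poly p x * w ^ m * (exp (- w) * (w * poly (pderiv r) x * w))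
        = poly q x * w ^ (m + 2) * exp (- w)"
    proof -
      \<comment> \<open>The factor \<open>m\<close> absorbs the truncated exponent
        \<open>m - 1\<close> when \<open>m = 0\<close>.\<close>
      define X where "X = of_nat m * w ^ (m - 1) * (w * w)"
      have X: "X = of_nat m * w ^ (m + 1)"
        by (cases m) (simp_all add: X_def algebra_simps)
      have "poly q x * w ^ (m + 2) = poly (pderiv p) x * (w * poly r x)\<^sup>2 * w ^ m
         + poly (pderiv r) x * poly p x * (w ^ (m + 2) - of_nat m * (w * poly r x) * w ^ (m + 1))"
        by (simp add: q_def algebra_simps power2_eq_square)
      also have "\<dots> = poly (pderiv p) x * w ^ m + poly (pderiv r) x * poly p x * (w ^ m * (w * w) - X)"
        by (simp add: wr X)
      finally have 1: "poly q x * w ^ (m + 2) = \<dots>" .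
      have 2: "poly p x * (of_nat m * w ^ (m - 1) * (- (w * poly (pderiv r) x * w)))
         = - (poly p x * poly (pderiv r) x * X)"
        by (simp add: X_def)
      show ?thesis unfolding 1 2 by (simp add: algebra_simps)
    qed
    finally have "((\<lambda>x. poly p x * inverse (poly r x) ^ m * exp (- inverse (poly r x)))
       has_real_derivative bump a b q (m + 2) x) (at x)"
      using True by (simp add: bump_def pr w_def)
    moreover have "\<forall>\<^sub>F y in nhds x. poly p y * inverse (poly r y) ^ m * exp (- inverse (poly r y)) = bump a b p m y"
      using True eventually_nhds_in_open[of "{a<..<b}" x]
      by (auto elim!: eventually_mono simp: bump_def pr)
    ultimately show ?thesis
      by (subst (asm) DERIV_cong_ev[OF refl _ refl]) auto
  next
    case False
    obtain M where M: "\<And>y. y \<in> {a..b} \<Longrightarrow> \<bar>poly p y\<bar> \<le> M"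
    proof -
      have "bounded (poly p ` {a..b})"
        by (intro compact_imp_bounded compact_continuous_image continuous_intros) auto
      then obtain M where "\<forall>y\<in>{a..b}. \<bar>poly p y\<bar> \<le> M" by (auto simp: bounded_iff)
      then show ?thesis using that by blast
    qed
    have "(bump a b p m has_real_derivative 0) (at x)"
    proof (rule has_field_derivative_0_quadratic)
      fix y
      \<comment> \<open>\<open>M\<close> bounds the polynomial and \<open>fact (m + 2)\<close>
        bounds \<open>w ^ (m + 2) * exp (- w)\<close>. The two extra powers of \<open>w\<close> are
        paid with \<open>((y - a) * (b - y))\<^sup>2\<close>, which is at most
        \<open>(b - a)\<^sup>2 * (y - x)\<^sup>2\<close> because \<open>x\<close> lies outside the
        interval.\<close>
      show "\<bar>bump a b p m y - bump a b p m x\<bar> \<le> (M * fact (m + 2) * (b - a)\<^sup>2) * (y - x)\<^sup>2"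
      proof (cases "a < y \<and> y < b")
        case y: True
        have M0: "M \<ge> 0" using M[of y] y by simp
        define w where "w = inverse ((y - a) * (b - y))"
        have "(y - a) * (b - y) > 0" using y by simp
        then have w: "w > 0" "w * ((y - a) * (b - y)) = 1"
          unfolding w_def by (metis inverse_positive_iff_positive, metis left_inverse less_numeral_extra(3))
        have "\<bar>bump a b p m y\<bar> = \<bar>poly p y\<bar> * (w ^ m * exp (- w))"
          using y w(1) unfolding bump_def w_def[symmetric] by (simp add: abs_mult)
        also have "w ^ m * exp (- w) = (w ^ (m + 2) * exp (- w)) * ((y - a) * (b - y))\<^sup>2"
        proof -
          have "w ^ (m + 2) * r\<^sup>2 = w ^ m * (w * r)\<^sup>2" for r
            by (simp add: power_mult_distrib power_add power2_eq_square)
          from this[of "(y - a) * (b - y)"] show ?thesis using w(2) by (simp add: ac_simps)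
        qed
        finally have eq: "\<bar>bump a b p m y\<bar> = \<bar>poly p y\<bar> * ((w ^ (m + 2) * exp (- w)) * ((y - a) * (b - y))\<^sup>2)" .
        have "\<bar>poly p y\<bar> * ((w ^ (m + 2) * exp (- w)) * ((y - a) * (b - y))\<^sup>2)
           \<le> M * (fact (m + 2) * ((b - a)\<^sup>2 * (y - x)\<^sup>2))"
        proof (intro mult_mono M)
          show "w ^ (m + 2) * exp (- w) \<le> fact (m + 2)"
            using w by (intro power_mult_exp_minus_le) simp
          have "\<bar>(y - a) * (b - y)\<bar> \<le> \<bar>(b - a) * (y - x)\<bar>"
          proof (cases "x \<le> a")
            case True
            have "(y - a) * (b - y) \<le> (y - x) * (b - a)" using y True by (intro mult_mono) auto
            then show ?thesis using y True by (simp add: abs_mult mult.commute)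
          next
            case False
            then have "b \<le> x" using \<open>\<not> (a < x \<and> x < b)\<close> by simp
            then have "(y - a) * (b - y) \<le> (b - a) * (x - y)" using y by (intro mult_mono) auto
            then show ?thesis using y \<open>b \<le> x\<close> by (simp add: abs_mult)
          qed
          then show "((y - a) * (b - y))\<^sup>2 \<le> (b - a)\<^sup>2 * (y - x)\<^sup>2"
            by (metis power_mult_distrib power2_abs abs_ge_zero power_mono)
        qed (use y M0 w in auto)
        with eq have "\<bar>bump a b p m y\<bar> \<le> M * (fact (m + 2) * ((b - a)\<^sup>2 * (y - x)\<^sup>2))" by (simp only:)
        moreover have "bump a b p m x = 0" using False by (auto simp: bump_def)
        ultimately show ?thesis by (simp add: mult.assoc)
      next
        case y: False
        obtain y' where "y' \<in> {a..b}" using assms by force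
        then have "M \<ge> 0" using M[of y'] by simp
        moreover have "bump a b p m x = 0" "bump a b p m y = 0" using y False by (auto simp: bump_def)
        ultimately show ?thesis by simp
      qed
    qed
    moreover have "bump a b q (m + 2) x = 0" using False by (auto simp: bump_def)
    ultimately show ?thesis by (simp only:)
  qed
  then show ?thesis by blast
qed

text \<open>The smoothness half of \<open>test_function\<close>; supports are treated separately
  because the step functions below are not compactly supported.\<close>

definition smooth :: "(real \<Rightarrow> real) \<Rightarrow> bool" where
  "smooth f \<longleftrightarrow> (\<forall>k z. (deriv ^^ k) f differentiable (at z))"

lemma smooth_bump:
  assumes "a < b"
  shows "smooth (bump a b p m)"
  unfolding smooth_def
proof (intro allI)
  fix k z
  have "\<exists>q n. (deriv ^^ k) (bump a b p m) = bump a b q n"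
  proof (induction k)
    case (Suc k)
    then obtain q n where "(deriv ^^ k) (bump a b p m) = bump a b q n" by blast
    moreover obtain q' where "\<And>x. (bump a b q n has_real_derivative bump a b q' (n + 2) x) (at x)"
      using bump_has_derivative[OF assms] by blast
    then have "deriv (bump a b q n) = bump a b q' (n + 2)"
      by (intro ext DERIV_imp_deriv)
    ultimately show ?case by auto
  qed auto
  then obtain q n where "(deriv ^^ k) (bump a b p m) = bump a b q n" by blast
  then show "(deriv ^^ k) (bump a b p m) differentiable (at z)"
    using bump_has_derivative[OF assms, of q n] real_differentiable_def by metis
qed

lemma smooth_antiderivative:
  assumes "\<And>x. (F has_real_derivative f x) (at x)" "smooth f"
  shows "smooth F"
  unfolding smooth_def
proof (intro allI)
  fix k z
  have "deriv F = f" using assms(1) by (intro ext DERIV_imp_deriv)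
  then show "(deriv ^^ k) F differentiable (at z)"
    using assms unfolding smooth_def
    by (cases k) (auto simp: funpow_Suc_right real_differentiable_def simp del: funpow.simps(2))
qed

lemma smooth_diff:
  assumes "smooth f" "smooth g"
  shows "smooth (\<lambda>x. f x - g x)"
proof -
  have eq: "(deriv ^^ k) (\<lambda>x. f x - g x) = (\<lambda>x. (deriv ^^ k) f x - (deriv ^^ k) g x)" for k
  proof (induction k)
    case (Suc k)
    have "(h has_real_derivative deriv h x) (at x)" if "h differentiable (at x)" for h :: "real \<Rightarrow> real" and x
      using that DERIV_deriv_iff_real_differentiable by blast
    then show ?case
      using assms by (auto simp: Suc smooth_def intro!: ext DERIV_imp_deriv DERIV_diff)
  qed simp
  show ?thesis
    using assms unfolding smooth_def eq by (auto intro!: differentiable_diff)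
qed

text \<open>\<open>R\<close> is the normalized primitive of a bump. Both faces are used later:
  differences of such steps are test functions, and the derivative \<open>\<rho>\<close> is a
  nonnegative kernel of mass one.\<close>

lemma smooth_step_exists:
  fixes a b :: real
  assumes "a < b"
  obtains R \<rho> where "\<And>x. (R has_real_derivative \<rho> x) (at x)" "smooth R" "\<And>x. \<rho> x \<ge> 0"
    "\<And>x. x \<notin> {a..b} \<Longrightarrow> \<rho> x = 0" "continuous_on UNIV \<rho>"
    "\<And>x. x \<le> a \<Longrightarrow> R x = 0" "\<And>x. b \<le> x \<Longrightarrow> R x = 1" "\<And>x. 0 \<le> R x" "\<And>x. R x \<le> 1"
proof -
  define \<rho>0 where "\<rho>0 = bump a b [:1:] 0"
  have cont0: "continuous_on S \<rho>0" for S
    using bump_has_derivative[OF assms, of "[:1:]" 0] unfolding \<rho>0_def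
    by (metis DERIV_isCont continuous_at_imp_continuous_on)
  have nn: "\<rho>0 x \<ge> 0" for x by (simp add: \<rho>0_def bump_def)
  have out: "\<rho>0 x = 0" if "x \<notin> {a<..<b}" for x using that by (auto simp: \<rho>0_def bump_def)
  define I where "I = integral {a..b} \<rho>0"
  have int0: "\<rho>0 integrable_on {c..d}" for c d
    by (intro integrable_continuous_real cont0)
  have "I \<noteq> 0"
  proof
    assume "I = 0"
    then have "(\<rho>0 has_integral 0) (cbox a b)"
      using int0[of a b] by (simp add: I_def has_integral_integral)
    then have "\<rho>0 ((a + b) / 2) = 0"
      using assms by (intro has_integral_0_cbox_imp_0[OF _ nn]) (auto intro: cont0)
    then show False using assms by (simp add: \<rho>0_def bump_def)
  qed
  moreover have "I \<ge> 0" unfolding I_def by (intro integral_nonneg int0 nn)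
  ultimately have I: "I > 0" by simp
  define \<rho> where "\<rho> = bump a b [:1 / I:] 0"
  have \<rho>: "\<rho> x = \<rho>0 x / I" for x by (simp add: \<rho>_def \<rho>0_def bump_def)
  define R where "R x = integral {a..x} \<rho>0 / I" for x
  have low: "integral {c..x} \<rho>0 = 0" if "x \<le> a" for c x
  proof -
    have "integral {c..x} \<rho>0 = integral {c..x} (\<lambda>_. 0)"
      using that by (intro integral_cong out) auto
    then show ?thesis by simp
  qed
  have der: "(R has_real_derivative \<rho> t) (at t)" for t
  proof -
    \<comment> \<open>The integral over \<open>{a..x}\<close> is zero for \<open>x\<close> left of
      \<open>a\<close>, so the primitive is rebased at a point \<open>A\<close> left of both
      \<open>a\<close> and \<open>t\<close>; then \<open>t\<close> is interior to the interval on
      which it is differentiated.\<close>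
    define A where "A = min a t - 1"
    have eq: "R x = integral {A..x} \<rho>0 / I" if "A \<le> x" for x
    proof (cases "x \<le> a")
      case True
      then show ?thesis by (simp add: R_def low)
    next
      case False
      have "integral {A..a} \<rho>0 + integral {a..x} \<rho>0 = integral {A..x} \<rho>0"
        using False by (intro Henstock_Kurzweil_Integration.integral_combine[OF _ _ int0]) (auto simp: A_def)
      then show ?thesis by (simp add: R_def low)
    qed
    have "((\<lambda>x. integral {A..x} \<rho>0) has_real_derivative \<rho>0 t) (at t within {A..t+1})"
      by (intro integral_has_real_derivative cont0) (auto simp: A_def)
    then have "((\<lambda>x. integral {A..x} \<rho>0) has_real_derivative \<rho>0 t) (at t)"
      by (subst (asm) at_within_interior) (auto simp: A_def)
    then have "((\<lambda>x. integral {A..x} \<rho>0 / I) has_real_derivative \<rho> t) (at t)"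
      unfolding \<rho> by (rule DERIV_cdivide)
    moreover have "\<forall>\<^sub>F y in nhds t. integral {A..y} \<rho>0 / I = R y"
    proof (rule eventually_mono)
      show "\<forall>\<^sub>F y in nhds t. y \<in> {A<..}"
        by (intro eventually_nhds_in_open) (auto simp: A_def)
    qed (use eq in auto)
    ultimately show ?thesis
      by (subst (asm) DERIV_cong_ev[OF refl _ refl]) auto
  qed
  have mono: "R x \<le> R y" if "x \<le> y" for x y
    using that nn I by (intro DERIV_nonneg_imp_nondecreasing[OF that]) (metis der \<rho> divide_nonneg_pos)
  have R0: "R x = 0" if "x \<le> a" for x using that by (simp add: R_def low)
  have R1: "R x = 1" if "b \<le> x" for x
  proof -
    have "integral {a..b} \<rho>0 + integral {b..x} \<rho>0 = integral {a..x} \<rho>0"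
      using that assms by (intro Henstock_Kurzweil_Integration.integral_combine[OF _ _ int0]) auto
    moreover have "integral {b..x} \<rho>0 = 0"
    proof -
      have "integral {b..x} \<rho>0 = integral {b..x} (\<lambda>_. 0)"
        by (intro integral_cong out) auto
      then show ?thesis by simp
    qed
    ultimately show ?thesis using I by (simp add: R_def I_def)
  qed
  show ?thesis
  proof (rule that)
    show "smooth R" by (rule smooth_antiderivative[OF der]) (simp add: \<rho>_def smooth_bump assms)
    show "continuous_on UNIV \<rho>" using cont0 I unfolding \<rho> by (intro continuous_intros) auto
    show "0 \<le> R x" for x using mono[of "min a x" x] R0[of "min a x"] by simp
    show "R x \<le> 1" for x using mono[of x "max b x"] R1[of "max b x"] by simp
  qed (use der nn I out R0 R1 in \<open>auto simp: \<rho>\<close>)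
qed

section \<open>Weak derivatives\<close>

lemma absolutely_integrable_supported:
  fixes f :: "real \<Rightarrow> 'a::euclidean_space"
  assumes f: "f absolutely_integrable_on S" and out: "\<And>z. z \<notin> S \<Longrightarrow> f z = 0"
  shows "integrable lebesgue f" "(LINT z|lebesgue. f z) = integral S f"
proof -
  have eq: "(\<lambda>z. indicator S z *\<^sub>R f z) = f" using out by (auto simp: indicator_def)
  show "integrable lebesgue f" "(LINT z|lebesgue. f z) = integral S f"
    using f set_lebesgue_integral_eq_integral(2)[OF f]
    unfolding set_integrable_def set_lebesgue_integral_def eq by simp_all
qed

lemma integral_mollifier_diff_le:
  fixes f :: "real \<Rightarrow> 'a::euclidean_space"
  assumes \<rho>: "continuous_on {a..b} \<rho>" "\<And>x. x \<in> {a..b} \<Longrightarrow> \<rho> x \<ge> 0" "(\<rho> has_integral 1) {a..b}"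
    and f: "continuous_on {a..b} f" and e: "\<And>x. x \<in> {a..b} \<Longrightarrow> norm (f x - c) \<le> e"
  shows "norm (integral {a..b} (\<lambda>x. \<rho> x *\<^sub>R f x) - c) \<le> e"
proof -
  have i: "(\<lambda>x. \<rho> x *\<^sub>R f x) integrable_on {a..b}" "(\<lambda>x. \<rho> x *\<^sub>R (f x - c)) integrable_on {a..b}"
    by (intro integrable_continuous_real continuous_intros \<rho> f)+
  have "((\<lambda>x. \<rho> x *\<^sub>R c) has_integral 1 *\<^sub>R c) {a..b}"
    using has_integral_linear[OF \<rho>(3), of "\<lambda>r. r *\<^sub>R c"] by (simp add: o_def bounded_linear_scaleR_left)
  from has_integral_diff[OF integrable_integral[OF i(1)] this]
  have "((\<lambda>x. \<rho> x *\<^sub>R (f x - c)) has_integral (integral {a..b} (\<lambda>x. \<rho> x *\<^sub>R f x) - c)) {a..b}"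
    by (simp add: algebra_simps)
  then have "norm (integral {a..b} (\<lambda>x. \<rho> x *\<^sub>R f x) - c) = norm (integral {a..b} (\<lambda>x. \<rho> x *\<^sub>R (f x - c)))"
    by (simp add: integral_unique)
  also have "\<dots> \<le> integral {a..b} (\<lambda>x. \<rho> x * e)"
  proof (rule integral_norm_bound_integral[OF i(2)])
    show "(\<lambda>x. \<rho> x * e) integrable_on {a..b}"
      by (intro integrable_continuous_real continuous_intros \<rho>)
    show "norm (\<rho> x *\<^sub>R (f x - c)) \<le> \<rho> x * e" if "x \<in> {a..b}" for x
      using \<rho>(2)[OF that] e[OF that] by (simp add: mult_left_mono)
  qed
  also have "\<dots> = e" using integral_unique[OF has_integral_mult_left[OF \<rho>(3), of e]] by (simp only: mult_1_left)
  finally show ?thesis .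
qed

lemma integral_mollifier_tendsto:
  fixes f :: "real \<Rightarrow> 'a::euclidean_space"
  assumes f: "continuous_on UNIV f" and d: "d \<longlonglongrightarrow> 0"
    and \<rho>: "\<And>n::nat. continuous_on UNIV (\<rho> n)" "\<And>n x. \<rho> n x \<ge> 0" "\<And>n. (\<rho> n has_integral 1) {a..a + d n}"
  shows "(\<lambda>n. integral {a..a + d n} (\<lambda>x. \<rho> n x *\<^sub>R f x)) \<longlonglongrightarrow> f a"
proof (rule LIMSEQ_I)
  fix r :: real assume "r > 0"
  have "continuous (at a) f" using f by (simp add: continuous_on_eq_continuous_at)
  then obtain s where s: "s > 0" "\<And>x. dist x a < s \<Longrightarrow> dist (f x) (f a) < r / 2"
    using \<open>r > 0\<close> unfolding continuous_at_eps_delta by (metis half_gt_zero)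
  obtain N where N: "\<And>n. n \<ge> N \<Longrightarrow> norm (d n - 0) < s" using LIMSEQ_D[OF d \<open>s > 0\<close>] by blast
  have "norm (integral {a..a + d n} (\<lambda>x. \<rho> n x *\<^sub>R f x) - f a) < r" if n: "n \<ge> N" for n
  proof -
    have "norm (integral {a..a + d n} (\<lambda>x. \<rho> n x *\<^sub>R f x) - f a) \<le> r / 2"
    proof (rule integral_mollifier_diff_le[OF _ _ \<rho>(3)])
      show "norm (f x - f a) \<le> r / 2" if "x \<in> {a..a + d n}" for x
        using s(2)[of x] N[OF n] that by (auto simp: dist_norm)
    qed (auto intro: continuous_on_subset[OF f] continuous_on_subset[OF \<rho>(1)] \<rho>(2))
    then show ?thesis using \<open>r > 0\<close> by simp
  qed
  then show "\<exists>no. \<forall>n\<ge>no. norm (integral {a..a + d n} (\<lambda>x. \<rho> n x *\<^sub>R f x) - f a) < r" by blast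
qed

text \<open>Testing against a smoothed indicator function of the interval from \<open>s\<close> to \<open>t\<close>.\<close>

lemma has_weak_deriv_has_integral:
  assumes wd: "has_weak_deriv \<Psi> g" and cont: "continuous_on UNIV \<Psi>" and st: "s \<le> t"
  shows "(g has_integral (\<Psi> t - \<Psi> s)) {s..t}"
proof -
  \<comment> \<open>The widths are at most 1, so all cutoffs built from these steps live in the
    fixed window \<open>{s..t + 1}\<close>, as domination requires.\<close>
  define d :: "nat \<Rightarrow> real" where "d n = inverse (Suc n)" for n
  have d: "d n > 0" "d n \<le> 1" for n by (simp_all add: d_def divide_simps)
  have dlim: "d \<longlonglongrightarrow> 0" unfolding d_def by (rule LIMSEQ_inverse_real_of_nat)
  define step where "step a n R \<rho> \<longleftrightarrow> (\<forall>x. (R has_real_derivative \<rho> x) (at x)) \<and> smooth R \<and> (\<forall>x. \<rho> x \<ge> 0) \<and>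
    (\<forall>x. x \<notin> {a..a + d n} \<longrightarrow> \<rho> x = 0) \<and> continuous_on UNIV \<rho> \<and>
    (\<forall>x. x \<le> a \<longrightarrow> R x = 0) \<and> (\<forall>x. a + d n \<le> x \<longrightarrow> R x = 1) \<and> (\<forall>x. 0 \<le> R x) \<and> (\<forall>x. R x \<le> 1)"
    for a n R \<rho>
  have "\<exists>R \<rho>. step a n R \<rho>" for a n
  proof -
    have "a < a + d n" using d by simp
    then show ?thesis
      by (rule smooth_step_exists) (unfold step_def, blast)
  qed
  then obtain R \<rho> where "step a n (R a n) (\<rho> a n)" for a n by metis
  then have R: "(R a n has_real_derivative \<rho> a n x) (at x)" "smooth (R a n)" "\<rho> a n x \<ge> 0"
    "x \<notin> {a..a + d n} \<Longrightarrow> \<rho> a n x = 0" "continuous_on UNIV (\<rho> a n)"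
    "x \<le> a \<Longrightarrow> R a n x = 0" "a + d n \<le> x \<Longrightarrow> R a n x = 1" "0 \<le> R a n x" "R a n x \<le> 1" for a n x
    unfolding step_def by blast+
  have \<rho>1: "(\<rho> a n has_integral 1) {a..a + d n}" for a n
  proof -
    have "(\<rho> a n has_integral (R a n (a + d n) - R a n a)) {a..a + d n}"
      using R(1) d(1)[of n] by (intro fundamental_theorem_of_calculus)
        (auto simp: has_real_derivative_iff_has_vector_derivative intro: has_vector_derivative_at_within)
    then show ?thesis by (simp add: R(6,7))
  qed
  have int\<rho>: "integrable lebesgue (\<lambda>z. \<rho> a n z *\<^sub>R \<Psi> z)"
    and lint: "(LINT z|lebesgue. \<rho> a n z *\<^sub>R \<Psi> z) = integral {a..a + d n} (\<lambda>x. \<rho> a n x *\<^sub>R \<Psi> x)" for a n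
  proof -
    have "(\<lambda>x. \<rho> a n x *\<^sub>R \<Psi> x) absolutely_integrable_on {a..a + d n}"
      by (intro absolutely_integrable_continuous_real continuous_intros
          continuous_on_subset[OF cont] continuous_on_subset[OF R(5)]) auto
    then show "integrable lebesgue (\<lambda>z. \<rho> a n z *\<^sub>R \<Psi> z)"
      "(LINT z|lebesgue. \<rho> a n z *\<^sub>R \<Psi> z) = integral {a..a + d n} (\<lambda>x. \<rho> a n x *\<^sub>R \<Psi> x)"
      by (rule absolutely_integrable_supported; use R(4) in simp)+
  qed
  have lim\<rho>: "(\<lambda>n. LINT z|lebesgue. \<rho> a n z *\<^sub>R \<Psi> z) \<longlonglongrightarrow> \<Psi> a" for a
    unfolding lint by (rule integral_mollifier_tendsto[OF cont dlim R(5,3) \<rho>1])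
  \<comment> \<open>Rises just to the right of \<open>s\<close> and falls just to the right of
    \<open>t\<close>; its derivative is a difference of two kernels that concentrate at
    \<open>s\<close> and \<open>t\<close>.\<close>
  define \<phi> where "\<phi> n x = R s n x - R t n x" for n x
  have d\<phi>: "deriv (\<phi> n) x = \<rho> s n x - \<rho> t n x" for n x
    unfolding \<phi>_def by (intro DERIV_imp_deriv DERIV_diff R(1))
  have \<phi>0: "\<phi> n x = 0" if "x \<notin> {s..t + 1}" for n x
    using that R(6)[of x s n] R(6)[of x t n] R(7)[of s n x] R(7)[of t n x] d(2)[of n] st
    by (auto simp: \<phi>_def not_le)
  have "test_function (\<phi> n)" for n
  proof -
    have "smooth (\<phi> n)" using smooth_diff[OF R(2)[of s n] R(2)[of t n]] by (simp add: \<phi>_def[abs_def])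
    moreover have "bounded {z. \<phi> n z \<noteq> 0}"
    proof (rule bounded_subset[OF bounded_closed_interval[of s "t + 1"]])
      show "{z. \<phi> n z \<noteq> 0} \<subseteq> {s..t + 1}" using \<phi>0 by blast
    qed
    ultimately show ?thesis unfolding test_function_def smooth_def by (simp add: compact_closure)
  qed
  then have eq: "(LINT z|lebesgue. \<rho> s n z *\<^sub>R \<Psi> z) - (LINT z|lebesgue. \<rho> t n z *\<^sub>R \<Psi> z)
     = - (LINT z|lebesgue. \<phi> n z *\<^sub>R g z)" for n
  proof -
    have "(LINT z|lebesgue. deriv (\<phi> n) z *\<^sub>R \<Psi> z) = - (LINT z|lebesgue. \<phi> n z *\<^sub>R g z)"
      using wd \<open>test_function (\<phi> n)\<close> unfolding has_weak_deriv_def by blast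
    then show ?thesis
      unfolding d\<phi> scaleR_diff_left by (simp add: Bochner_Integration.integral_diff[OF int\<rho> int\<rho>])
  qed
  have gint: "set_integrable lebesgue {a..b} g" for a b
    using wd by (simp add: has_weak_deriv_def loc_integrable_def)
  \<comment> \<open>The limit is half-open: every step vanishes at its left end, so \<open>s\<close>
    is excluded and \<open>t\<close> included.\<close>
  have "(\<lambda>n. LINT z|lebesgue. \<phi> n z *\<^sub>R g z) \<longlonglongrightarrow> (LINT z|lebesgue. indicator {s<..t} z *\<^sub>R g z)"
  proof (rule integral_dominated_convergence[where w = "\<lambda>z. norm (indicator {s..t + 1} z *\<^sub>R g z)"])
    show "(\<lambda>z. indicator {s<..t} z *\<^sub>R g z) \<in> borel_measurable lebesgue"
    proof -
      have "set_integrable lebesgue {s<..t} g"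
        by (rule set_integrable_subset[OF gint[of s t]]) auto
      then show ?thesis unfolding set_integrable_def by (rule borel_measurable_integrable)
    qed
    have eqg: "\<phi> n z *\<^sub>R g z = \<phi> n z *\<^sub>R (indicator {s..t + 1} z *\<^sub>R g z)" for n z
      using \<phi>0[of z n] by (auto simp: indicator_def)
    have cont\<phi>: "continuous_on UNIV (\<phi> n)" for n
      unfolding \<phi>_def by (intro continuous_intros DERIV_continuous_on) (auto intro: R(1) has_field_derivative_at_within)
    show "(\<lambda>z. \<phi> n z *\<^sub>R g z) \<in> borel_measurable lebesgue" for n
    proof -
      have "\<phi> n \<in> borel_measurable lebesgue"
        using borel_measurable_continuous_onI[OF cont\<phi>] by (simp add: measurable_completion)
      then show ?thesis
        unfolding eqg using borel_measurable_integrable[OF gint[of s "t + 1", unfolded set_integrable_def]]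
        by (rule borel_measurable_scaleR)
    qed
    show "integrable lebesgue (\<lambda>z. norm (indicator {s..t + 1} z *\<^sub>R g z))"
      using gint[of s "t + 1"] unfolding set_integrable_def by (rule integrable_norm)
    show "AE z in lebesgue. norm (\<phi> n z *\<^sub>R g z) \<le> norm (indicator {s..t + 1} z *\<^sub>R g z)" for n
    proof (rule AE_I2)
      fix z
      have "\<bar>\<phi> n z\<bar> \<le> 1"
        using R(8)[of s n z] R(8)[of t n z] R(9)[of s n z] R(9)[of t n z] by (simp add: \<phi>_def abs_le_iff)
      then show "norm (\<phi> n z *\<^sub>R g z) \<le> norm (indicator {s..t + 1} z *\<^sub>R g z)"
        using mult_right_mono[of "\<bar>\<phi> n z\<bar>" 1 "norm (indicator {s..t + 1} z *\<^sub>R g z)"]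
        unfolding eqg norm_scaleR[of "\<phi> n z"] by simp
    qed
    show "AE z in lebesgue. (\<lambda>n. \<phi> n z *\<^sub>R g z) \<longlonglongrightarrow> indicator {s<..t} z *\<^sub>R g z"
    proof (rule AE_I2)
      fix z
      have lim: "(\<lambda>n. R a n z) \<longlonglongrightarrow> indicator {a<..} z" for a
      proof (cases "z \<le> a")
        case True
        then show ?thesis by (simp add: R(6))
      next
        case False
        then have "\<forall>\<^sub>F n in sequentially. d n < z - a"
          using order_tendstoD(2)[OF dlim, of "z - a"] by simp
        then have "\<forall>\<^sub>F n in sequentially. 1 = R a n z"
          by eventually_elim (use R(7) in auto)
        then show ?thesis using False by (auto intro: Lim_transform_eventually[OF tendsto_const])
      qed
      have "(indicator {s<..} z :: real) - indicator {t<..} z = indicator {s<..t} z"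
        using st by (auto simp: indicator_def)
      then show "(\<lambda>n. \<phi> n z *\<^sub>R g z) \<longlonglongrightarrow> indicator {s<..t} z *\<^sub>R g z"
        unfolding \<phi>_def using tendsto_diff[OF lim[of s] lim[of t]] by (auto intro!: tendsto_intros)
    qed
  qed
  moreover have "(\<lambda>n. LINT z|lebesgue. \<phi> n z *\<^sub>R g z) \<longlonglongrightarrow> - (\<Psi> s - \<Psi> t)"
    using tendsto_minus[OF tendsto_diff[OF lim\<rho>[of s] lim\<rho>[of t]]] unfolding eq by simp
  ultimately have "(LINT z|lebesgue. indicator {s<..t} z *\<^sub>R g z) = \<Psi> t - \<Psi> s"
    using LIMSEQ_unique by fastforce
  moreover have "(LINT z|lebesgue. indicator {s<..t} z *\<^sub>R g z) = integral {s<..t} g"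
  proof -
    have "set_integrable lebesgue {s<..t} g"
      by (rule set_integrable_subset[OF gint[of s t]]) auto
    then show ?thesis
      using set_lebesgue_integral_eq_integral(2)[of "{s<..t}" g] by (simp add: set_lebesgue_integral_def)
  qed
  moreover have "integral {s<..t} g = integral {s..t} g"
    by (rule integral_subset_negligible) (use st in \<open>auto intro: negligible_subset[of "{s}"]\<close>)
  moreover have "g integrable_on {s..t}"
    using gint[of s t] set_lebesgue_integral_eq_integral(1) by blast
  ultimately show ?thesis by (simp add: has_integral_integrable_integral)
qed

text \<open>Both derivatives integrate to the increments of \<open>\<Psi>\<close>, so all interval
  integrals of their difference vanish. Since \<open>weak_deriv\<close> is an arbitrary choice, this
  is how the energy of an explicit profile becomes computable.\<close>

lemma has_weak_deriv_AE_eq: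
  assumes wd: "has_weak_deriv \<Psi> g" and der: "\<And>z. (\<Psi> has_vector_derivative g' z) (at z)"
  shows "AE z in lebesgue. g z = g' z"
proof -
  have cont: "continuous_on UNIV \<Psi>"
    using der by (auto intro!: continuous_at_imp_continuous_on has_vector_derivative_continuous)
  have "negligible {z \<in> {- real n..real n}. g z - g' z \<noteq> 0}" for n
  proof (rule has_integral_subintervals_0_imp_negligible)
    fix s t :: real assume "s \<le> t"
    have "(g' has_integral (\<Psi> t - \<Psi> s)) {s..t}"
      using der \<open>s \<le> t\<close> by (intro fundamental_theorem_of_calculus) (auto intro: has_vector_derivative_at_within)
    from has_integral_diff[OF has_weak_deriv_has_integral[OF wd cont \<open>s \<le> t\<close>] this]
    show "((\<lambda>z. g z - g' z) has_integral 0) {s..t}" by simp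
  qed
  then have "negligible (\<Union>n. {z \<in> {- real n..real n}. g z - g' z \<noteq> 0})"
    by (intro negligible_countable_Union) auto
  moreover have "{z. g z \<noteq> g' z} \<subseteq> (\<Union>n. {z \<in> {- real n..real n}. g z - g' z \<noteq> 0})"
  proof
    fix z assume "z \<in> {z. g z \<noteq> g' z}"
    moreover obtain n where "\<bar>z\<bar> \<le> real n" using real_arch_simple by blast
    ultimately show "z \<in> (\<Union>n. {z \<in> {- real n..real n}. g z - g' z \<noteq> 0})" by (intro UN_I[of n]) (auto simp: abs_le_iff)
  qed
  ultimately have "negligible {z. g z \<noteq> g' z}" using negligible_subset by blast
  then show ?thesis
    by (intro AE_I'[of "{z. g z \<noteq> g' z}"]) (auto simp: negligible_iff_null_sets)
qed

text \<open>The converse direction integrates \<open>(\<phi> \<Psi>)'\<close> over an interval that contains the support of \<open>\<phi>\<close>.\<close>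

lemma has_weak_derivI:
  assumes der: "\<And>z. (\<Psi> has_vector_derivative g z) (at z)" and cont: "continuous_on UNIV g"
    and h0: "\<And>z. g z \<in> h0"
  shows "has_weak_deriv \<Psi> g"
proof -
  have cont\<Psi>: "continuous_on UNIV \<Psi>"
    using der by (auto intro!: continuous_at_imp_continuous_on has_vector_derivative_continuous)
  have loc: "loc_integrable f" if "continuous_on UNIV f" for f :: "real \<Rightarrow> cmat5"
    unfolding loc_integrable_def
    using absolutely_integrable_continuous_real continuous_on_subset[OF that] by blast
  have "(LINT z|lebesgue. deriv \<phi> z *\<^sub>R \<Psi> z) = - (LINT z|lebesgue. \<phi> z *\<^sub>R g z)" if tf: "test_function \<phi>" for \<phi>
  proof -
    have diff: "(deriv ^^ k) \<phi> differentiable (at z)" for k z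
      using tf by (simp add: test_function_def)
    have d\<phi>: "(\<phi> has_real_derivative deriv \<phi> z) (at z)" for z
      using diff[of 0] by (simp add: DERIV_deriv_iff_real_differentiable)
    have cd: "continuous_on S (deriv \<phi>)" and c: "continuous_on S \<phi>" for S
      using diff[of 1] diff[of 0] by (auto intro!: continuous_at_imp_continuous_on differentiable_imp_continuous_within)
    \<comment> \<open>The strict bound makes \<open>\<phi>\<close> vanish at both endpoints of
      \<open>{-M..M}\<close>, which kills the boundary terms in the integration by parts.\<close>
    obtain M where M: "M > 0" "\<And>z. \<phi> z \<noteq> 0 \<Longrightarrow> \<bar>z\<bar> < M"
    proof -
      have "bounded {z. \<phi> z \<noteq> 0}"
        using tf bounded_subset[OF compact_imp_bounded closure_subset] unfolding test_function_def by blast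
      then obtain B where "\<forall>z\<in>{z. \<phi> z \<noteq> 0}. \<bar>z\<bar> \<le> B" by (auto simp: bounded_iff)
      then show ?thesis by (intro that[of "\<bar>B\<bar> + 1"]) force+
    qed
    have out0: "\<phi> z = 0" if "z \<notin> {-M<..<M}" for z
      using M(2)[of z] that by (cases "\<phi> z = 0") auto
    have out: "\<phi> z = 0" "deriv \<phi> z = 0" if "z \<notin> {-M..M}" for z
    proof -
      show "\<phi> z = 0" using that by (intro out0) auto
      have "\<forall>\<^sub>F y in nhds z. \<phi> y = 0"
      proof (rule eventually_mono)
        show "\<forall>\<^sub>F y in nhds z. y \<in> - {-M..M}"
          using that by (intro eventually_nhds_in_open) auto
      qed (use out0 in auto)
      then have "((\<lambda>_. 0) has_real_derivative deriv \<phi> z) (at z)"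
        using d\<phi>[of z] by (subst (asm) DERIV_cong_ev[OF refl _ refl]) auto
      then show "deriv \<phi> z = 0" using DERIV_unique DERIV_const by blast
    qed
    have LI: "(LINT z|lebesgue. f z) = integral {-M..M} f"
      if "continuous_on {-M..M} f" "\<And>z. z \<notin> {-M..M} \<Longrightarrow> f z = 0" for f :: "real \<Rightarrow> cmat5"
      by (rule absolutely_integrable_supported(2)[OF absolutely_integrable_continuous_real[OF that(1)] that(2)])
    have "((\<lambda>z. \<phi> z *\<^sub>R g z + deriv \<phi> z *\<^sub>R \<Psi> z) has_integral
        (\<phi> M *\<^sub>R \<Psi> M - \<phi> (- M) *\<^sub>R \<Psi> (- M))) {- M..M}"
      using M(1) d\<phi> der
      by (intro fundamental_theorem_of_calculus has_vector_derivative_at_within[OF has_vector_derivative_scaleR]) auto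
    then have "integral {- M..M} (\<lambda>z. \<phi> z *\<^sub>R g z + deriv \<phi> z *\<^sub>R \<Psi> z) = 0"
      using out0[of M] out0[of "- M"] by (simp add: integral_unique)
    moreover have "integral {- M..M} (\<lambda>z. \<phi> z *\<^sub>R g z + deriv \<phi> z *\<^sub>R \<Psi> z)
       = integral {- M..M} (\<lambda>z. \<phi> z *\<^sub>R g z) + integral {- M..M} (\<lambda>z. deriv \<phi> z *\<^sub>R \<Psi> z)"
      by (intro Henstock_Kurzweil_Integration.integral_add integrable_continuous_real continuous_intros cd c
          continuous_on_subset[OF cont] continuous_on_subset[OF cont\<Psi>]) auto
    moreover have "(LINT z|lebesgue. \<phi> z *\<^sub>R g z) = integral {- M..M} (\<lambda>z. \<phi> z *\<^sub>R g z)"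
      "(LINT z|lebesgue. deriv \<phi> z *\<^sub>R \<Psi> z) = integral {- M..M} (\<lambda>z. deriv \<phi> z *\<^sub>R \<Psi> z)"
      using out by (intro LI continuous_intros cd c
          continuous_on_subset[OF cont] continuous_on_subset[OF cont\<Psi>]; simp)+
    ultimately show ?thesis by (simp add: eq_neg_iff_add_eq_0 add.commute)
  qed
  then show ?thesis
    using h0 loc[OF cont] loc[OF cont\<Psi>] by (simp add: has_weak_deriv_def)
qed

section \<open>Calibration and the pointwise bound on the potential\<close>

text \<open>A substitute for the chain rule when \<open>f\<close> has controlled increments but no
  derivative. On short intervals the variation of \<open>P'\<close> and of \<open>w\<close> costs
  less than \<open>e / 2\<close> each, the mean value theorem bounds the increment of
  \<open>P\<close>, and bisection glues the pieces; then \<open>e\<close> tends to 0.\<close>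

lemma calibration_le_integral:
  fixes f m w P P' :: "real \<Rightarrow> real"
  assumes ab: "a \<le> b" and f: "continuous_on {a..b} f" and w: "continuous_on {a..b} w"
    and m: "m integrable_on {a..b}" "\<And>x. x \<in> {a..b} \<Longrightarrow> m x \<ge> 0"
    and fm: "\<And>s t. \<lbrakk>a \<le> s; s \<le> t; t \<le> b\<rbrakk> \<Longrightarrow> \<bar>f t - f s\<bar> \<le> integral {s..t} m"
    and P: "\<And>y. (P has_real_derivative P' y) (at y)" "continuous_on UNIV P'"
    and le: "\<And>x. x \<in> {a..b} \<Longrightarrow> \<bar>P' (f x)\<bar> \<le> w x"
    and wm: "(\<lambda>x. w x * m x) integrable_on {a..b}"
  shows "\<bar>P (f b) - P (f a)\<bar> \<le> integral {a..b} (\<lambda>x. w x * m x)"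
proof -
  have eps: "\<bar>P (f b) - P (f a)\<bar> \<le> integral {a..b} (\<lambda>x. (w x + e) * m x)" if e: "e > 0" for e
  proof -
    have we: "(\<lambda>x. (w x + e) * m x) integrable_on {s..t}" if "a \<le> s" "t \<le> b" for s t
    proof -
      have "(\<lambda>x. w x * m x + e * m x) integrable_on {a..b}"
        by (rule integrable_add[OF wm integrable_on_mult_right[OF m(1)]])
      moreover have "(\<lambda>x. (w x + e) * m x) = (\<lambda>x. w x * m x + e * m x)"
        by (simp add: distrib_right)
      ultimately have "(\<lambda>x. (w x + e) * m x) integrable_on {a..b}" by simp
      then show ?thesis
        by (rule integrable_on_subinterval) (use that in auto)
    qed
    define Q where "Q s t \<longleftrightarrow> (a \<le> s \<longrightarrow> t \<le> b \<longrightarrow> \<bar>P (f t) - P (f s)\<bar> \<le> integral {s..t} (\<lambda>x. (w x + e) * m x))"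
      for s t
    have "Q a b"
      using ab
    proof (induction rule: Bolzano)
      case (trans x y z)
      show ?case
        unfolding Q_def
      proof (intro impI)
        assume xz: "a \<le> x" "z \<le> b"
        have "integral {x..y} (\<lambda>x. (w x + e) * m x) + integral {y..z} (\<lambda>x. (w x + e) * m x)
           = integral {x..z} (\<lambda>x. (w x + e) * m x)"
          by (rule Henstock_Kurzweil_Integration.integral_combine[OF trans(3,4) we[OF xz]])
        then show "\<bar>P (f z) - P (f x)\<bar> \<le> integral {x..z} (\<lambda>x. (w x + e) * m x)"
          using trans xz unfolding Q_def by linarith
      qed
    next
      case (local x)
      then have x: "x \<in> {a..b}" by simp
      have "isCont P' (f x)" using P(2) by (simp add: continuous_on_eq_continuous_at)
      then obtain r where r: "r > 0" "\<And>y. \<bar>y - f x\<bar> < r \<Longrightarrow> \<bar>P' y - P' (f x)\<bar> < e / 2"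
        using e unfolding continuous_at_eps_delta dist_real_def by (metis half_gt_zero)
      obtain d1 where d1: "d1 > 0" "\<And>y. y \<in> {a..b} \<Longrightarrow> \<bar>y - x\<bar> < d1 \<Longrightarrow> \<bar>f y - f x\<bar> < r"
        using f x r(1) unfolding continuous_on_iff dist_real_def by metis
      obtain d2 where d2: "d2 > 0" "\<And>y. y \<in> {a..b} \<Longrightarrow> \<bar>y - x\<bar> < d2 \<Longrightarrow> \<bar>w y - w x\<bar> < e / 2"
        using w x e unfolding continuous_on_iff dist_real_def by (metis half_gt_zero)
      show ?case
      proof (intro exI[of _ "min d1 d2"] conjI allI impI)
        show "min d1 d2 > 0" using d1 d2 by simp
        fix s t assume st: "s \<le> x \<and> x \<le> t \<and> t - s < min d1 d2"
        show "Q s t"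
          unfolding Q_def
        proof (intro impI)
          assume ast: "a \<le> s" "t \<le> b"
          have near: "\<bar>f s - f x\<bar> < r" "\<bar>f t - f x\<bar> < r"
            using st ast by (intro d1(2); auto)+
          have mvt: "\<bar>P (f t) - P (f s)\<bar> \<le> (w x + e / 2) * \<bar>f t - f s\<bar>"
          proof (rule field_differentiable_bound[of "{f x - r<..<f x + r}" P P', unfolded real_norm_def])
            show "(P has_real_derivative P' z) (at z within {f x - r<..<f x + r})" for z
              by (rule has_field_derivative_at_within[OF P(1)])
            show "\<bar>P' z\<bar> \<le> w x + e / 2" if "z \<in> {f x - r<..<f x + r}" for z
            proof -
              have "\<bar>z - f x\<bar> < r" using that by auto
              from r(2)[OF this] le[OF x] show ?thesis by linarith
            qed
          qed (use near in auto)
          also have "\<dots> \<le> (w x + e / 2) * integral {s..t} m"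
            using fm[of s t] st ast le[OF x] e by (intro mult_left_mono) auto
          also have "\<dots> = integral {s..t} (\<lambda>y. (w x + e / 2) * m y)" by simp
          also have "\<dots> \<le> integral {s..t} (\<lambda>y. (w y + e) * m y)"
          proof (rule integral_le)
            show "(\<lambda>y. (w x + e / 2) * m y) integrable_on {s..t}"
              by (rule integrable_on_mult_right[OF integrable_on_subinterval[OF m(1)]]) (use ast in auto)
            show "(\<lambda>y. (w y + e) * m y) integrable_on {s..t}" by (rule we[OF ast])
            show "(w x + e / 2) * m y \<le> (w y + e) * m y" if y: "y \<in> {s..t}" for y
            proof (rule mult_right_mono)
              have yab: "y \<in> {a..b}" using y ast by auto
              then show "0 \<le> m y" by (rule m(2))
              have "\<bar>y - x\<bar> < d2" using y st by auto
              from d2(2)[OF yab this] show "w x + e / 2 \<le> w y + e" by linarith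
            qed
          qed
          finally show "\<bar>P (f t) - P (f s)\<bar> \<le> integral {s..t} (\<lambda>x. (w x + e) * m x)" .
        qed
      qed
    qed
    then show ?thesis by (simp add: Q_def)
  qed
  have split: "integral {a..b} (\<lambda>x. (w x + e) * m x) = integral {a..b} (\<lambda>x. w x * m x) + e * integral {a..b} m" for e
    unfolding distrib_right
    by (simp add: Henstock_Kurzweil_Integration.integral_add[OF wm integrable_on_mult_right[OF m(1)]])
  show ?thesis
  proof (rule field_le_epsilon)
    fix e :: real assume "e > 0"
    define M where "M = integral {a..b} m"
    have "M \<ge> 0" unfolding M_def by (intro integral_nonneg m)
    then have "e / (M + 1) > 0" using \<open>e > 0\<close> by simp
    then have "\<bar>P (f b) - P (f a)\<bar> \<le> integral {a..b} (\<lambda>x. w x * m x) + e / (M + 1) * M"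
      using eps split by (simp only: M_def)
    also have "e / (M + 1) * M \<le> e" using \<open>M \<ge> 0\<close> \<open>e > 0\<close> by (simp add: field_simps)
    finally show "\<bar>P (f b) - P (f a)\<bar> \<le> integral {a..b} (\<lambda>x. w x * m x) + e" by simp
  qed
qed

text \<open>With \<open>x = a\<^sub>3\<close> and the outer pairs written as \<open>s/2 \<plusminus> p - x/4\<close> and \<open>- s/2 \<plusminus> q - x/4\<close>,
  the difference of both sides is \<open>D + (S - 5 k)\<^sup>2 / 10\<close>; the ordering of the eigenvalues forces
  \<open>s \<ge> 5 \<bar>x\<bar> / 2\<close> and hence \<open>D \<ge> 0\<close>.\<close>

lemma quartic_eigenvalue_bound:
  fixes a1 a2 x a4 a5 k :: real
  assumes sum0: "a1 + a2 + x + a4 + a5 = 0" and ord: "x \<le> a1" "x \<le> a2" "a4 \<le> x" "a5 \<le> x"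
  defines "T \<equiv> a1\<^sup>2 + a2\<^sup>2 + x\<^sup>2 + a4\<^sup>2 + a5\<^sup>2"
  shows "(k - 5 / 4 * x\<^sup>2)\<^sup>2 / 2
     \<le> - k * T - 3 / 20 * T\<^sup>2 + (a1 ^ 4 + a2 ^ 4 + x ^ 4 + a4 ^ 4 + a5 ^ 4) + 3 * k\<^sup>2"
proof -
  define s where "s = a1 + a2 + x / 2"
  define p where "p = (a1 - a2) / 2"
  define q where "q = (a4 - a5) / 2"
  define m where "m = p\<^sup>2 + q\<^sup>2"
  define d where "d = p\<^sup>2 - q\<^sup>2"
  define D where "D = 2 * s\<^sup>2 * m + d\<^sup>2 - 3 * x * s * d"
  define S where "S = s\<^sup>2 + 2 * m"
  \<comment> \<open>The upper pair gives \<open>s \<ge> 5 / 2 * x\<close>; the lower pair, through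
    the zero sum, gives \<open>s \<ge> - 5 / 2 * x\<close>.\<close>
  have s: "s \<ge> 5 / 2 * \<bar>x\<bar>"
    using sum0 ord by (simp add: s_def abs_if)
  have a: "a1 = s / 2 + p - x / 4" "a2 = s / 2 - p - x / 4" "a4 = - s / 2 + q - x / 4" "a5 = - s / 2 - q - x / 4"
    using sum0 by (simp_all add: s_def p_def q_def field_simps)
  have "D \<ge> 0"
  proof -
    have m: "m \<ge> \<bar>d\<bar>" by (simp add: m_def d_def abs_le_iff)
    have "5 / 2 * \<bar>x\<bar> * s \<le> s * s" using s by (intro mult_right_mono) auto
    then have "3 * \<bar>x\<bar> * s \<le> 2 * s\<^sup>2"
    proof -
      have "0 \<le> \<bar>x\<bar> * s" using s by simp
      then show ?thesis using \<open>5 / 2 * \<bar>x\<bar> * s \<le> s * s\<close> unfolding power2_eq_square mult.assoc by linarith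
    qed
    then have "3 * \<bar>x\<bar> * s * \<bar>d\<bar> \<le> 2 * s\<^sup>2 * \<bar>d\<bar>" by (intro mult_right_mono) auto
    also have "\<dots> \<le> 2 * s\<^sup>2 * m" using m by (intro mult_left_mono) auto
    moreover have "3 * x * s * d \<le> 3 * \<bar>x\<bar> * s * \<bar>d\<bar>"
      using s abs_ge_self[of "3 * x * s * d"] by (simp add: abs_mult)
    ultimately show ?thesis unfolding D_def using zero_le_power2[of d] by linarith
  qed
  \<comment> \<open>The mixed term drops out because \<open>3 / 20 * 2 * 5 / 4 = 3 / 8\<close>. The
    right-hand side is zero for \<open>p = q = 0\<close> and \<open>s\<^sup>2 = 5 * k\<close>, which
    is the segment between the vacua.\<close>
  moreover have "- k * T - 3 / 20 * T\<^sup>2 + (a1 ^ 4 + a2 ^ 4 + x ^ 4 + a4 ^ 4 + a5 ^ 4) + 3 * k\<^sup>2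
      - (k - 5 / 4 * x\<^sup>2)\<^sup>2 / 2 = D + (S - 5 * k)\<^sup>2 / 10"
  proof -
    define r where "r = s / 2"
    define z where "z = x / 4"
    have x: "x = 4 * z" and s': "s = 2 * r" by (simp_all add: r_def z_def)
    have a': "a1 = (r - z) + p" "a2 = (r - z) - p" "a4 = (- r - z) + q" "a5 = (- r - z) - q"
      unfolding a by (simp_all add: r_def z_def)
    have pair4: "(y + c) ^ 4 + (y - c) ^ 4 = 2 * y ^ 4 + 12 * (y\<^sup>2 * c\<^sup>2) + 2 * (c\<^sup>2)\<^sup>2" for y c :: real
      by (simp only: power4_eq_xxxx power2_eq_square) (simp only: algebra_simps)
    have pair2: "(y + c)\<^sup>2 + (y - c)\<^sup>2 = 2 * y\<^sup>2 + 2 * c\<^sup>2" for y c :: real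
      by (simp only: power2_eq_square) (simp only: algebra_simps)
    \<comment> \<open>\<open>A\<close> and \<open>B\<close> stand for \<open>p\<^sup>2\<close> and
      \<open>q\<^sup>2\<close>, and \<open>r\<close>, \<open>z\<close> take the halves and quarters
      out of the eigenvalues; this keeps the polynomial identities small.\<close>
    have T2: "(2 * (r - z)\<^sup>2 + 2 * A) + (4 * z)\<^sup>2 + (2 * (- r - z)\<^sup>2 + 2 * B)
       = (2 * r)\<^sup>2 + 2 * (A + B) + 5 / 4 * (4 * z)\<^sup>2" for A B :: real
      by (simp only: power2_eq_square) (simp add: algebra_simps)
    have T4: "(2 * (r - z) ^ 4 + 12 * ((r - z)\<^sup>2 * A) + 2 * A\<^sup>2) + (4 * z) ^ 4
        + (2 * (- r - z) ^ 4 + 12 * ((- r - z)\<^sup>2 * B) + 2 * B\<^sup>2)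
       = ((2 * r)\<^sup>2 + 2 * (A + B))\<^sup>2 / 4
        + (2 * (2 * r)\<^sup>2 * (A + B) + (A - B)\<^sup>2 - 3 * (4 * z) * (2 * r) * (A - B))
        + 3 / 8 * (4 * z)\<^sup>2 * ((2 * r)\<^sup>2 + 2 * (A + B)) + 65 / 64 * (4 * z) ^ 4" for A B :: real
      by (simp only: power4_eq_xxxx power2_eq_square) (simp add: algebra_simps)
    have "T = (a1\<^sup>2 + a2\<^sup>2) + x\<^sup>2 + (a4\<^sup>2 + a5\<^sup>2)" by (simp add: T_def)
    also have "\<dots> = S + 5 / 4 * x\<^sup>2"
      unfolding a' pair2 S_def m_def x s' by (rule T2)
    finally have T: "T = S + 5 / 4 * x\<^sup>2" .
    have "a1 ^ 4 + a2 ^ 4 + x ^ 4 + a4 ^ 4 + a5 ^ 4 = (a1 ^ 4 + a2 ^ 4) + x ^ 4 + (a4 ^ 4 + a5 ^ 4)" by simp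
    also have "\<dots> = S\<^sup>2 / 4 + D + 3 / 8 * x\<^sup>2 * S + 65 / 64 * x ^ 4"
      unfolding a' pair4 S_def D_def m_def d_def x s' by (rule T4)
    finally have Q: "a1 ^ 4 + a2 ^ 4 + x ^ 4 + a4 ^ 4 + a5 ^ 4 = \<dots>" .
    show ?thesis unfolding T Q by (simp only: power4_eq_xxxx power2_eq_square) (simp add: field_simps)
  qed
  ultimately show ?thesis using zero_le_power2[of "S - 5 * k"] by linarith
qed

lemma sum_5: "(\<Sum>i\<in>UNIV. f i) = f 1 + f 2 + f 3 + f 4 + f 5" for f :: "5 \<Rightarrow> 'a::comm_monoid_add"
  unfolding UNIV_5 by (simp add: ac_simps)

text \<open>Dividing out \<open>lam\<close> leaves \<open>k = \<mu>\<^sup>2 / lam\<close> as the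
  only parameter, and the claim becomes \<open>quartic_eigenvalue_bound\<close> for the
  eigenvalues.\<close>

lemma potential_ge_is_mid:
  assumes lam: "lam > 0" and A: "A \<in> h0" and x: "is_mid A x"
  shows "potential \<mu> lam (- (3 / 20) * lam) (3 * \<mu> ^ 4 / lam) A \<ge> lam / 2 * (\<mu>\<^sup>2 / lam - 5 / 4 * x\<^sup>2)\<^sup>2"
proof -
  define k where "k = \<mu>\<^sup>2 / lam"
  obtain U and a :: "real^5" where U: "U ** adj U = mat 1" "A = adj U ** cdiag a ** U"
    and ord: "x \<le> a $ 1" "x \<le> a $ 2" "a $ 3 = x" "a $ 4 \<le> x" "a $ 5 \<le> x"
    using x unfolding is_mid_def by blast
  note tr = trace_diagonalized[OF U]
  have "trace A = 0" using A by (simp add: h0_def)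
  with tr(1) have "complex_of_real (\<Sum>i\<in>UNIV. a $ i) = 0" by (simp only:)
  then have "(\<Sum>i\<in>UNIV. a $ i) = 0" by (simp only: of_real_eq_0_iff)
  then have sum0: "a $ 1 + a $ 2 + x + a $ 4 + a $ 5 = 0" unfolding sum_5 ord(3) .
  have \<mu>: "\<mu>\<^sup>2 = lam * k" using lam by (simp add: k_def)
  have "3 * \<mu> ^ 4 / lam = 3 * (\<mu>\<^sup>2 * \<mu>\<^sup>2) / lam" by (simp add: power4_eq_xxxx power2_eq_square)
  also have "\<dots> = lam * (3 * k\<^sup>2)" unfolding \<mu> using lam by (simp add: power2_eq_square)
  finally have V0: "3 * \<mu> ^ 4 / lam = lam * (3 * k\<^sup>2)" .
  have "potential \<mu> lam (- (3 / 20) * lam) (3 * \<mu> ^ 4 / lam) A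
    = lam * (- k * (\<Sum>i\<in>UNIV. (a $ i)^2) - 3 / 20 * (\<Sum>i\<in>UNIV. (a $ i)^2)\<^sup>2 + (\<Sum>i\<in>UNIV. (a $ i)^4) + 3 * k\<^sup>2)"
  proof -
    have "- (lam * k) * T + - (3 / 20) * lam * T\<^sup>2 + lam * Q + lam * (3 * k\<^sup>2)
       = lam * (- k * T - 3 / 20 * T\<^sup>2 + Q + 3 * k\<^sup>2)" for T Q :: real
      by (simp add: algebra_simps)
    then show ?thesis unfolding potential_def tr(2,3) Re_complex_of_real V0 \<mu> .
  qed
  moreover have "lam * ((k - 5 / 4 * x\<^sup>2)\<^sup>2 / 2)
    \<le> lam * (- k * (\<Sum>i\<in>UNIV. (a $ i)^2) - 3 / 20 * (\<Sum>i\<in>UNIV. (a $ i)^2)\<^sup>2 + (\<Sum>i\<in>UNIV. (a $ i)^4) + 3 * k\<^sup>2)"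
    unfolding sum_5 ord(3) by (intro mult_left_mono quartic_eigenvalue_bound sum0 ord(1,2,4,5)) (use lam in auto)
  ultimately show ?thesis by (simp add: k_def)
qed

lemma potential_ge_mid:
  assumes "lam > 0" and "A \<in> h0"
  shows "potential \<mu> lam (- (3 / 20) * lam) (3 * \<mu> ^ 4 / lam) A \<ge> lam / 2 * (\<mu>\<^sup>2 / lam - 5 / 4 * (mid A)\<^sup>2)\<^sup>2"
  by (rule potential_ge_is_mid[OF assms is_mid_mid[OF assms(2)]])

section \<open>Continuity of the potential\<close>

lemma continuous_on_matrix_mult [continuous_intros]:
  fixes f :: "'a::topological_space \<Rightarrow> complex^'n^'m" and g :: "'a \<Rightarrow> complex^'k^'n"
  assumes "continuous_on S f" "continuous_on S g"
  shows "continuous_on S (\<lambda>x. f x ** g x)"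
proof -
  have f: "continuous_on S (\<lambda>x. f x $ i $ j)" for i j
    by (intro continuous_on_component assms)
  have g: "continuous_on S (\<lambda>x. g x $ i $ j)" for i j
    by (intro continuous_on_component assms)
  show ?thesis
    unfolding matrix_matrix_mult_def by (intro continuous_on_vec_lambda continuous_intros f g)
qed

lemma continuous_on_trace [continuous_intros]:
  fixes f :: "'a::topological_space \<Rightarrow> complex^'n^'n"
  assumes "continuous_on S f"
  shows "continuous_on S (\<lambda>x. trace (f x))"
  unfolding trace_def by (intro continuous_intros continuous_on_component assms)

lemma continuous_on_potential:
  assumes "continuous_on S f"
  shows "continuous_on S (\<lambda>x. potential \<mu> lam h V0 (f x))"
  unfolding potential_def by (intro continuous_intros assms)

section \<open>The straight segment between the vacua\<close>

lemma forall_5: "(\<forall>i::5. P i) \<longleftrightarrow> P 1 \<and> P 2 \<and> P 3 \<and> P 4 \<and> P 5"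
proof -
  have "(\<forall>i::5. P i) \<longleftrightarrow> (\<forall>i\<in>{1, 2, 3, 4, 5::5}. P i)" using UNIV_5 by blast
  then show ?thesis by simp
qed

lemma adj_mat_1 [simp]: "adj (mat 1) = mat 1"
  by (simp add: adj_def mat_def vec_eq_iff)

lemma adj_cdiag [simp]: "adj (cdiag a) = cdiag a"
  by (auto simp: adj_def cdiag_def diag_def vec_eq_iff)

lemma unitary_conj_in_h0:
  assumes "\<Phi> \<in> h0" "U \<in> SU5"
  shows "adj U ** \<Phi> ** U \<in> h0"
  using assms by (simp add: h0_def SU5_def trace_unitary_conj adj_mult matrix_mul_assoc)

lemma in_SU5_orbit: "\<Phi> \<in> SU5_orbit \<Phi>"
  unfolding SU5_orbit_def SU5_def
  by (intro CollectI exI[of _ "mat 1"]) (simp add: det_I)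

text \<open>The diagonalizing unitary is composed with \<open>W\<close>. Hence the calibration takes
  a single value on each vacuum orbit, whichever points a competitor joins.\<close>

lemma is_mid_unitary_conj:
  assumes "is_mid A x" "adj W ** W = mat 1" "W ** adj W = mat 1"
  shows "is_mid (adj W ** A ** W) x"
proof -
  obtain U and a :: "real^5" where U: "adj U ** U = mat 1" "U ** adj U = mat 1" "A = adj U ** cdiag a ** U"
    and a: "x \<le> a $ 1" "x \<le> a $ 2" "a $ 3 = x" "a $ 4 \<le> x" "a $ 5 \<le> x"
    using assms(1) unfolding is_mid_def by blast
  have "adj (U ** W) ** (U ** W) = adj W ** (adj U ** U) ** W"
    by (simp add: adj_mult matrix_mul_assoc)
  then have 1: "adj (U ** W) ** (U ** W) = mat 1" using U assms by (simp add: matrix_mul_rid)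
  have "(U ** W) ** adj (U ** W) = U ** (W ** adj W) ** adj U"
    by (simp add: adj_mult matrix_mul_assoc)
  then have 2: "(U ** W) ** adj (U ** W) = mat 1" using U assms by (simp add: matrix_mul_rid)
  have "adj W ** A ** W = adj (U ** W) ** cdiag a ** (U ** W)"
    by (simp add: U(3) adj_mult matrix_mul_assoc)
  with 1 2 a show ?thesis unfolding is_mid_def by blast
qed

text \<open>The line through the vacua with its affine parameter kept free: a \<open>tanh\<close> in
  place of \<open>s\<close> gives the kink, an affine function the curve that realizes the weighted
  distance.\<close>

definition wall :: "real \<Rightarrow> real \<Rightarrow> real \<Rightarrow> cmat5" where
  "wall \<mu> lam s = (sqrt 5 * \<mu> / (2 * sqrt lam)) *\<^sub>R
     (diag (vector [1, 1, -1, -1, 0]) + (1 / 5 * s) *\<^sub>R diag (vector [1, 1, 1, 1, -4]))"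

lemma Phi_A_eq_wall: "Phi_A \<mu> lam z = wall \<mu> lam (tanh (\<mu> * z / sqrt 2))"
  by (simp add: Phi_A_def wall_def)

lemma wall_eq_cdiag:
  fixes \<mu> lam :: real
  defines "K \<equiv> sqrt 5 * \<mu> / (2 * sqrt lam)"
  shows "wall \<mu> lam s = cdiag (vector [K * (1 + s / 5), K * (1 + s / 5), K * (s / 5 - 1), K * (s / 5 - 1), - (4 * K * s / 5)])"
  unfolding wall_def K_def[symmetric] cdiag_def diag_def vec_eq_iff forall_5
  by (simp add: scaleR_conv_of_real[where 'a = complex] algebra_simps)

lemma wall_1: "wall \<mu> lam 1 = Phi_A_plus \<mu> lam"
  unfolding wall_def Phi_A_plus_def vac_scale_def diag_def vec_eq_iff forall_5
  by (simp add: scaleR_conv_of_real[where 'a = complex] field_simps)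

lemma wall_minus_1: "wall \<mu> lam (- 1) = Phi_A_minus \<mu> lam"
  unfolding wall_def Phi_A_minus_def vac_scale_def diag_def vec_eq_iff forall_5
  by (simp add: scaleR_conv_of_real[where 'a = complex] field_simps)

lemma wall_in_h0: "wall \<mu> lam s \<in> h0"
proof -
  define K where "K = sqrt 5 * \<mu> / (2 * sqrt lam)"
  have "(\<Sum>i\<in>UNIV. vector [K * (1 + s / 5), K * (1 + s / 5), K * (s / 5 - 1), K * (s / 5 - 1), - (4 * K * s / 5)] $ (i::5)) = 0"
    unfolding sum_5 vector_5 by (simp add: field_simps)
  then show ?thesis
    unfolding wall_eq_cdiag K_def[symmetric] h0_def mem_Collect_eq trace_cdiag by (simp only: adj_cdiag of_real_0)
qed

text \<open>The equality case of \<open>potential_ge_is_mid\<close>: the entry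
  \<open>- (4 * K * s / 5)\<close>, the middle eigenvalue for \<open>s\<close> between -1 and 1, has
  square \<open>4 / 5 * k * s\<^sup>2\<close>, so that \<open>k - 5 / 4 * x\<^sup>2\<close> becomes
  \<open>k * (1 - s\<^sup>2)\<close>.\<close>

lemma potential_wall:
  assumes "lam > 0"
  shows "potential \<mu> lam (- (3 / 20) * lam) (3 * \<mu> ^ 4 / lam) (wall \<mu> lam s) = \<mu> ^ 4 / (2 * lam) * (1 - s\<^sup>2)\<^sup>2"
proof -
  define K where "K = sqrt 5 * \<mu> / (2 * sqrt lam)"
  define k where "k = \<mu>\<^sup>2 / lam"
  have K2: "K\<^sup>2 = 5 / 4 * k"
    using assms by (simp add: K_def k_def power_mult_distrib power_divide)
  have "K ^ 4 = (K\<^sup>2)\<^sup>2" by simp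
  also have "\<dots> = 25 / 16 * k\<^sup>2" unfolding K2 by (simp add: power_mult_distrib power_divide)
  finally have K4: "K ^ 4 = 25 / 16 * k\<^sup>2" .
  have w: "wall \<mu> lam s = adj (mat 1) ** cdiag (vector [K * (1 + s / 5), K * (1 + s / 5), K * (s / 5 - 1),
      K * (s / 5 - 1), - (4 * K * s / 5)]) ** mat 1"
    unfolding wall_eq_cdiag K_def by (simp add: matrix_mul_rid)
  have I: "mat 1 ** adj (mat 1) = (mat 1 :: cmat5)" by (simp add: matrix_mul_rid)
  note tr = trace_diagonalized(2,3)[OF I w, unfolded sum_5 vector_5]
  have T: "(K * (1 + s / 5))\<^sup>2 + (K * (1 + s / 5))\<^sup>2 + (K * (s / 5 - 1))\<^sup>2 + (K * (s / 5 - 1))\<^sup>2 + (- (4 * K * s / 5))\<^sup>2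
     = K\<^sup>2 * (4 + 4 / 5 * s\<^sup>2)"
    by (simp only: power2_eq_square) (simp add: field_simps)
  have Q: "(K * (1 + s / 5)) ^ 4 + (K * (1 + s / 5)) ^ 4 + (K * (s / 5 - 1)) ^ 4 + (K * (s / 5 - 1)) ^ 4 + (- (4 * K * s / 5)) ^ 4
     = K ^ 4 * (4 + 24 / 25 * s\<^sup>2 + 260 / 625 * s ^ 4)"
    by (simp only: power4_eq_xxxx power2_eq_square) (simp add: field_simps)
  have \<mu>: "\<mu>\<^sup>2 = lam * k" using assms by (simp add: k_def)
  have "\<mu> ^ 4 = \<mu>\<^sup>2 * \<mu>\<^sup>2" by (simp add: power4_eq_xxxx power2_eq_square)
  then have \<mu>4: "\<mu> ^ 4 = lam\<^sup>2 * k\<^sup>2" unfolding \<mu> by (simp add: power2_eq_square)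
  have V0: "3 * \<mu> ^ 4 / lam = 3 * lam * k\<^sup>2" "\<mu> ^ 4 / (2 * lam) = lam * k\<^sup>2 / 2"
    unfolding \<mu>4 using assms by (simp_all add: power2_eq_square)
  have tT: "Re (trace (wall \<mu> lam s ** wall \<mu> lam s)) = 5 / 4 * k * (4 + 4 / 5 * s\<^sup>2)"
    unfolding tr Re_complex_of_real T K2 ..
  have tQ: "Re (trace (wall \<mu> lam s ** wall \<mu> lam s ** wall \<mu> lam s ** wall \<mu> lam s))
      = 25 / 16 * k\<^sup>2 * (4 + 24 / 25 * s\<^sup>2 + 260 / 625 * s ^ 4)"
    unfolding tr Re_complex_of_real Q K4 ..
  show ?thesis
    unfolding potential_def tT tQ V0 \<mu>
    by (simp only: power4_eq_xxxx power2_eq_square) (simp add: field_simps)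
qed

section \<open>The middle eigenvalue on the vacuum orbits\<close>

lemma is_mid_Phi_A_plus:
  assumes "\<mu> > 0" "lam > 0"
  shows "is_mid (Phi_A_plus \<mu> lam) (- 2 * vac_scale \<mu> lam)"
proof -
  define u where "u = vac_scale \<mu> lam"
  have u: "u > 0" using assms by (simp add: u_def vac_scale_def)
  have "Phi_A_plus \<mu> lam = adj (mat 1) ** cdiag (vector [3 * u, 3 * u, - 2 * u, - 2 * u, - 2 * u]) ** mat 1"
    unfolding adj_mat_1 matrix_mul_rid matrix_mul_lid Phi_A_plus_def u_def[symmetric] cdiag_def diag_def vec_eq_iff forall_5
    by (simp add: scaleR_conv_of_real[where 'a = complex])
  then show ?thesis
    unfolding is_mid_def u_def[symmetric] using u
    by (intro exI[of _ "mat 1"] exI[of _ "vector [3 * u, 3 * u, - 2 * u, - 2 * u, - 2 * u] :: real^5"])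
      (simp add: matrix_mul_rid)
qed

lemma is_mid_Phi_A_minus:
  assumes "\<mu> > 0" "lam > 0"
  shows "is_mid (Phi_A_minus \<mu> lam) (2 * vac_scale \<mu> lam)"
proof -
  define u where "u = vac_scale \<mu> lam"
  have u: "u > 0" using assms by (simp add: u_def vac_scale_def)
  \<comment> \<open>Swaps coordinates 3 and 5, since the third diagonal entry of
    \<open>Phi_A_minus\<close> is its lowest eigenvalue. The determinant is -1, which the unitary
    matrices in \<open>is_mid\<close> may have.\<close>
  define W :: cmat5 where "W = vector [axis 1 1, axis 2 1, axis 5 1, axis 4 1, axis 3 1]"
  have W1: "W ** W = mat 1" and W2: "adj W = W"
    unfolding W_def matrix_matrix_mult_def adj_def mat_def vec_eq_iff forall_5 sum_5
    by (simp_all add: axis_def)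
  define a :: "real^5" where "a = vector [2 * u, 2 * u, 2 * u, - 3 * u, - 3 * u]"
  have "is_mid (cdiag a) (2 * u)"
    unfolding is_mid_def using u
    by (intro exI[of _ "mat 1"] exI[of _ a]) (simp add: a_def matrix_mul_rid)
  then have "is_mid (adj W ** cdiag a ** W) (2 * u)"
    using W1 W2 by (intro is_mid_unitary_conj) simp_all
  moreover have "adj W ** cdiag a ** W = Phi_A_minus \<mu> lam"
    unfolding W2 unfolding W_def a_def matrix_matrix_mult_def Phi_A_minus_def u_def[symmetric] cdiag_def diag_def vec_eq_iff forall_5 sum_5
    by (simp add: axis_def scaleR_conv_of_real[where 'a = complex])
  ultimately show ?thesis by (simp add: u_def)
qed

lemma Sigma_A_plus_mid:
  assumes "\<mu> > 0" "lam > 0" "A \<in> Sigma_A_plus \<mu> lam"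
  shows "A \<in> h0" "mid A = - 2 * vac_scale \<mu> lam"
proof -
  obtain U where U: "U \<in> SU5" "A = adj U ** Phi_A_plus \<mu> lam ** U"
    using assms(3) by (auto simp: Sigma_A_plus_def SU5_orbit_def)
  show "A \<in> h0" unfolding U(2) wall_1[symmetric] by (rule unitary_conj_in_h0[OF wall_in_h0 U(1)])
  moreover have "is_mid A (- 2 * vac_scale \<mu> lam)"
    using U unfolding U(2) by (intro is_mid_unitary_conj is_mid_Phi_A_plus assms) (auto simp: SU5_def)
  ultimately show "mid A = - 2 * vac_scale \<mu> lam" by (rule mid_eq)
qed

lemma Sigma_A_minus_mid:
  assumes "\<mu> > 0" "lam > 0" "A \<in> Sigma_A_minus \<mu> lam"
  shows "A \<in> h0" "mid A = 2 * vac_scale \<mu> lam"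
proof -
  obtain U where U: "U \<in> SU5" "A = adj U ** Phi_A_minus \<mu> lam ** U"
    using assms(3) by (auto simp: Sigma_A_minus_def SU5_orbit_def)
  show "A \<in> h0" unfolding U(2) wall_minus_1[symmetric] by (rule unitary_conj_in_h0[OF wall_in_h0 U(1)])
  moreover have "is_mid A (2 * vac_scale \<mu> lam)"
    using U unfolding U(2) by (intro is_mid_unitary_conj is_mid_Phi_A_minus assms) (auto simp: SU5_def)
  ultimately show "mid A = 2 * vac_scale \<mu> lam" by (rule mid_eq)
qed

text \<open>The derivative is \<open>2 * sqrt (lam / 2) / sqrt (4 / 5)\<close> times
  \<open>\<mu>\<^sup>2 / lam - 5 / 4 * x\<^sup>2\<close>: up to sign, twice the root of the lower
  bound on the potential, divided by the Lipschitz constant of \<open>mid\<close>. Its critical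
  points are the vacuum values 2u and -2u.\<close>

definition calib :: "real \<Rightarrow> real \<Rightarrow> real \<Rightarrow> real" where
  "calib \<mu> lam x = sqrt (5 * lam / 2) * (\<mu>\<^sup>2 / lam * x - 5 / 12 * x ^ 3)"

lemma calib_difference:
  assumes "\<mu> > 0" "lam > 0"
  shows "calib \<mu> lam (2 * vac_scale \<mu> lam) - calib \<mu> lam (- 2 * vac_scale \<mu> lam) = 4 * sqrt 2 * \<mu> ^ 3 / (3 * lam)"
proof -
  define u where "u = vac_scale \<mu> lam"
  define k where "k = \<mu>\<^sup>2 / lam"
  have u2: "u\<^sup>2 = k / 5"
    using assms by (simp add: u_def k_def vac_scale_def power_mult_distrib power_divide)
  have u3: "u ^ 3 = k / 5 * u" unfolding u2[symmetric] by (simp add: power3_eq_cube power2_eq_square)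
  have su: "sqrt (5 * lam / 2) * u = \<mu> * (sqrt 2 / 2)"
  proof (rule power2_eq_imp_eq)
    show "(sqrt (5 * lam / 2) * u)\<^sup>2 = (\<mu> * (sqrt 2 / 2))\<^sup>2"
      using assms by (simp add: power_mult_distrib u2 k_def power_divide)
  qed (use assms in \<open>simp_all add: u_def vac_scale_def\<close>)
  have "calib \<mu> lam (2 * u) - calib \<mu> lam (- 2 * u) = (sqrt (5 * lam / 2) * u) * (8 / 3 * k)"
    unfolding calib_def k_def[symmetric] by (simp add: power_mult_distrib u3 algebra_simps)
  also have "\<dots> = 4 * sqrt 2 * \<mu> ^ 3 / (3 * lam)"
    unfolding su k_def by (simp add: power3_eq_cube power2_eq_square)
  finally show ?thesis by (simp add: u_def)
qed

text \<open>The part common to energy and distance: the weak derivative of an admissible profile and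
  the almost-everywhere derivative of an absolutely continuous curve both satisfy the hypotheses on
  \<open>g\<close>.\<close>

lemma calibration_curve:
  fixes \<gamma> g :: "real \<Rightarrow> cmat5" and \<mu> :: real
  assumes lam: "lam > 0" and ab: "a \<le> b" and h0: "\<And>t. t \<in> {a..b} \<Longrightarrow> \<gamma> t \<in> h0"
    and g: "g absolutely_integrable_on {a..b}"
    and ftc: "\<And>s t. \<lbrakk>a \<le> s; s \<le> t; t \<le> b\<rbrakk> \<Longrightarrow> (g has_integral (\<gamma> t - \<gamma> s)) {s..t}"
  defines "V \<equiv> potential \<mu> lam (- (3 / 20) * lam) (3 * \<mu> ^ 4 / lam)"
  shows "(\<lambda>t. 2 * sqrt (V (\<gamma> t)) * norm (g t)) absolutely_integrable_on {a..b}"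
    and "\<bar>calib \<mu> lam (mid (\<gamma> b)) - calib \<mu> lam (mid (\<gamma> a))\<bar> \<le> integral {a..b} (\<lambda>t. 2 * sqrt (V (\<gamma> t)) * norm (g t))"
proof -
  define c where "c = sqrt (4 / 5)"
  have c: "c > 0" by (simp add: c_def)
  have gi: "g integrable_on {a..b}" "(\<lambda>t. norm (g t)) integrable_on {a..b}"
    using g by (auto simp: absolutely_integrable_on_def)
  have cont: "continuous_on {a..b} \<gamma>"
  proof -
    have "continuous_on {a..b} (\<lambda>t. \<gamma> a + integral {a..t} g)"
      by (intro continuous_intros indefinite_integral_continuous_1 gi)
    moreover have "\<gamma> a + integral {a..t} g = \<gamma> t" if "t \<in> {a..b}" for t
      using ftc[of a t] that by (simp add: integral_unique)
    ultimately show ?thesis by (rule continuous_on_eq)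
  qed
  have contV: "continuous_on {a..b} (\<lambda>t. sqrt (V (\<gamma> t)))"
    unfolding V_def by (intro continuous_intros continuous_on_potential cont)
  have eq: "(\<lambda>t. (2 * sqrt (V (\<gamma> t)) / c) * (c * norm (g t))) = (\<lambda>t. 2 * sqrt (V (\<gamma> t)) * norm (g t))"
    using c by (simp add: fun_eq_iff)
  show ai: "(\<lambda>t. 2 * sqrt (V (\<gamma> t)) * norm (g t)) absolutely_integrable_on {a..b}"
  proof (rule absolutely_integrable_bounded_measurable_product_real)
    show "(\<lambda>t. 2 * sqrt (V (\<gamma> t))) \<in> borel_measurable (lebesgue_on {a..b})"
      by (intro continuous_imp_measurable_on_sets_lebesgue continuous_intros contV) auto
    show "bounded ((\<lambda>t. 2 * sqrt (V (\<gamma> t))) ` {a..b})"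
      by (intro compact_imp_bounded compact_continuous_image continuous_intros contV) auto
    show "(\<lambda>t. norm (g t)) absolutely_integrable_on {a..b}"
      using g by (rule absolutely_integrable_norm[unfolded o_def])
  qed auto
  have "\<bar>calib \<mu> lam (mid (\<gamma> b)) - calib \<mu> lam (mid (\<gamma> a))\<bar>
      \<le> integral {a..b} (\<lambda>t. (2 * sqrt (V (\<gamma> t)) / c) * (c * norm (g t)))"
  proof (rule calibration_le_integral[OF ab, where f = "\<lambda>t. mid (\<gamma> t)" and P = "calib \<mu> lam"
        and w = "\<lambda>t. 2 * sqrt (V (\<gamma> t)) / c" and m = "\<lambda>t. c * norm (g t)"])
    show "continuous_on {a..b} (\<lambda>t. mid (\<gamma> t))"
      by (rule continuous_on_compose2[OF continuous_on_mid cont]) (use h0 in auto)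
    show "continuous_on {a..b} (\<lambda>t. 2 * sqrt (V (\<gamma> t)) / c)"
      using c by (intro continuous_intros contV) auto
    show "(\<lambda>t. c * norm (g t)) integrable_on {a..b}"
      by (intro integrable_on_mult_right gi)
    show "0 \<le> c * norm (g x)" for x using c by simp
    show "\<bar>mid (\<gamma> t) - mid (\<gamma> s)\<bar> \<le> integral {s..t} (\<lambda>t. c * norm (g t))" if st: "a \<le> s" "s \<le> t" "t \<le> b" for s t
    proof -
      have "\<bar>mid (\<gamma> t) - mid (\<gamma> s)\<bar> \<le> c * norm (\<gamma> t - \<gamma> s)"
        unfolding c_def using st by (intro mid_lipschitz h0) auto
      also have "\<gamma> t - \<gamma> s = integral {s..t} g" using ftc[OF st] by (simp add: integral_unique)
      also have "norm (integral {s..t} g) \<le> integral {s..t} (\<lambda>t. norm (g t))"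
        using gi st by (intro integral_norm_bound_integral) (auto intro: integrable_on_subinterval)
      finally show ?thesis using c by (simp add: mult_left_mono)
    qed
    show "(calib \<mu> lam has_real_derivative sqrt (5 * lam / 2) * (\<mu>\<^sup>2 / lam - 5 / 4 * y\<^sup>2)) (at y)" for y
      unfolding calib_def using lam by (auto intro!: derivative_eq_intros simp: power2_eq_square)
    show "continuous_on UNIV (\<lambda>y. sqrt (5 * lam / 2) * (\<mu>\<^sup>2 / lam - 5 / 4 * y\<^sup>2))"
      by (intro continuous_intros)
    show "\<bar>sqrt (5 * lam / 2) * (\<mu>\<^sup>2 / lam - 5 / 4 * (mid (\<gamma> t))\<^sup>2)\<bar> \<le> 2 * sqrt (V (\<gamma> t)) / c" if t: "t \<in> {a..b}" for t
    proof -
      define y where "y = \<mu>\<^sup>2 / lam - 5 / 4 * (mid (\<gamma> t))\<^sup>2"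
      have "lam / 2 * y\<^sup>2 \<le> V (\<gamma> t)"
        unfolding V_def y_def by (rule potential_ge_mid[OF lam h0[OF t]])
      then have "sqrt (lam / 2 * y\<^sup>2) \<le> sqrt (V (\<gamma> t))" by simp
      then have "sqrt (lam / 2) * \<bar>y\<bar> \<le> sqrt (V (\<gamma> t))" by (simp only: real_sqrt_mult real_sqrt_abs)
      \<comment> \<open>Here \<open>sqrt 5\<close> is \<open>2 / c\<close>, which makes the
        derivative of \<open>calib\<close> match the weight.\<close>
      then have "sqrt 5 * (sqrt (lam / 2) * \<bar>y\<bar>) \<le> sqrt 5 * sqrt (V (\<gamma> t))" by simp
      moreover have "sqrt 5 * (sqrt (lam / 2) * \<bar>y\<bar>) = \<bar>sqrt (5 * lam / 2) * y\<bar>"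
        using lam by (simp add: abs_mult real_sqrt_mult real_sqrt_divide)
      moreover have "sqrt 5 * sqrt (V (\<gamma> t)) = 2 * sqrt (V (\<gamma> t)) / c"
        by (simp add: c_def real_sqrt_divide)
      ultimately show ?thesis by (simp only: y_def)
    qed
    show "(\<lambda>t. (2 * sqrt (V (\<gamma> t)) / c) * (c * norm (g t))) integrable_on {a..b}"
      unfolding eq using ai unfolding absolutely_integrable_on_def by blast
  qed
  then show "\<bar>calib \<mu> lam (mid (\<gamma> b)) - calib \<mu> lam (mid (\<gamma> a))\<bar>
      \<le> integral {a..b} (\<lambda>t. 2 * sqrt (V (\<gamma> t)) * norm (g t))"
    unfolding eq .
qed

lemma potential_nonneg:
  assumes "lam > 0" "A \<in> h0"
  shows "potential \<mu> lam (- (3 / 20) * lam) (3 * \<mu> ^ 4 / lam) A \<ge> 0"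
  using potential_ge_mid[OF assms, of \<mu>] assms(1)
  by (smt (verit) divide_pos_pos mult_nonneg_nonneg zero_le_power2)

section \<open>Energy and weighted distance\<close>

lemma norm_diag: "norm (diag (vector [1, 1, 1, 1, -4]) :: cmat5) = sqrt 20"
proof -
  have h: "(diag (vector [1, 1, 1, 1, -4]) :: cmat5) \<in> h0"
    unfolding h0_def adj_def diag_def vec_eq_iff forall_5 trace_def mem_Collect_eq sum_5 by simp
  have "frob_inner (diag (vector [1, 1, 1, 1, -4])) (diag (vector [1, 1, 1, 1, -4])) = 20"
    unfolding frob_inner_def trace_def matrix_matrix_mult_def diag_def sum_5 by simp
  then show ?thesis using frob_norm_eq_norm[OF h] by (simp add: frob_norm_def)
qed

definition wall_dir :: "real \<Rightarrow> real \<Rightarrow> cmat5" where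
  "wall_dir \<mu> lam = (sqrt 5 * \<mu> / (10 * sqrt lam)) *\<^sub>R diag (vector [1, 1, 1, 1, -4])"

lemma wall_affine: "wall \<mu> lam s = wall \<mu> lam 0 + s *\<^sub>R wall_dir \<mu> lam"
  by (simp add: wall_def wall_dir_def scaleR_add_right)

lemma wall_dir_in_h0: "r *\<^sub>R wall_dir \<mu> lam \<in> h0"
proof -
  have "r *\<^sub>R wall_dir \<mu> lam = wall \<mu> lam r - wall \<mu> lam 0" by (subst wall_affine) simp
  then show ?thesis using h0_diff[OF wall_in_h0 wall_in_h0] by simp
qed

lemma norm_wall_dir:
  assumes "\<mu> > 0" "lam > 0"
  shows "norm (wall_dir \<mu> lam) = \<mu> / sqrt lam"
proof -
  have s: "sqrt 5 * sqrt 20 = (10::real)" by (simp flip: real_sqrt_mult)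
  have "norm (wall_dir \<mu> lam) = (sqrt 5 * sqrt 20) * \<mu> / (10 * sqrt lam)"
    using assms by (simp add: wall_dir_def norm_diag)
  also have "\<dots> = \<mu> / sqrt lam" unfolding s by simp
  finally show ?thesis .
qed

lemma norm_wall_dir_sq:
  assumes "\<mu> > 0" "lam > 0"
  shows "(norm (wall_dir \<mu> lam))\<^sup>2 = \<mu>\<^sup>2 / lam"
  using assms by (simp add: norm_wall_dir power_divide)

lemma has_vector_derivative_wall:
  assumes "(f has_real_derivative f') (at z within S)"
  shows "((\<lambda>z. wall \<mu> lam (f z)) has_vector_derivative (f' *\<^sub>R wall_dir \<mu> lam)) (at z within S)"
  by (subst wall_affine) (use assms in \<open>auto intro!: derivative_eq_intros simp: has_real_derivative_iff_has_vector_derivative\<close>)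

text \<open>\<open>h0\<close> is the common kernel of two real linear maps, and derivatives pass
  through these. This is needed because \<open>frob_norm\<close> is identified with the norm on
  \<open>h0\<close>, while \<open>weighted_dist\<close> does not confine \<open>g\<close> to
  it.\<close>

lemma has_vector_derivative_in_h0:
  fixes \<gamma> :: "real \<Rightarrow> cmat5"
  assumes ab: "a < b" "t \<in> {a..b}" and h0: "\<And>s. s \<in> {a..b} \<Longrightarrow> \<gamma> s \<in> h0"
    and der: "(\<gamma> has_vector_derivative g) (at t within {a..b})"
  shows "g \<in> h0"
proof -
  have lin1: "bounded_linear (\<lambda>A::cmat5. adj A - A)"
    by (intro linear_conv_bounded_linear[THEN iffD1] linearI)
      (simp_all add: adj_def vec_eq_iff algebra_simps scaleR_conv_of_real[where 'a = complex])
  have lin2: "bounded_linear (\<lambda>A::cmat5. trace A)"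
    by (intro linear_conv_bounded_linear[THEN iffD1] linearI)
      (simp_all add: trace_def sum.distrib scaleR_sum_right)
  have zero: "L g = 0" if L: "bounded_linear L" "\<And>s. s \<in> {a..b} \<Longrightarrow> L (\<gamma> s) = 0"
    for L :: "cmat5 \<Rightarrow> 'b::real_normed_vector"
  proof -
    have "((\<lambda>s. L (\<gamma> s)) has_vector_derivative L g) (at t within cbox a b)"
      using bounded_linear.has_vector_derivative[OF L(1) der] by simp
    moreover have "((\<lambda>s. L (\<gamma> s)) has_vector_derivative 0) (at t within cbox a b)"
      using ab L(2) by (intro has_vector_derivative_transform[OF _ _ has_vector_derivative_const[of 0]]) auto
    ultimately show "L g = 0"
      using ab by (intro vector_derivative_unique_within_closed_interval[of a b t]) auto
  qed
  have "adj g - g = 0" by (rule zero[OF lin1]) (use h0 in \<open>simp add: h0_def\<close>)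
  moreover have "trace g = 0" by (rule zero[OF lin2]) (use h0 in \<open>simp add: h0_def\<close>)
  ultimately show ?thesis by (simp add: h0_def)
qed

section \<open>The kink profile and its energy integral\<close>

lemma tendsto_tanh_scaled:
  assumes "(\<mu>::real) > 0"
  shows "((\<lambda>z. tanh (\<mu> * z / sqrt 2)) \<longlongrightarrow> 1) at_top"
    and "((\<lambda>z. tanh (\<mu> * z / sqrt 2)) \<longlongrightarrow> - 1) at_bot"
proof -
  have c: "\<mu> / sqrt 2 > 0" using assms by simp
  have "filterlim (\<lambda>z. \<mu> / sqrt 2 * z) at_top at_top" "filterlim (\<lambda>z. \<mu> / sqrt 2 * z) at_bot at_bot"
    by (rule filterlim_tendsto_pos_mult_at_top[OF tendsto_const c filterlim_ident]
        filterlim_tendsto_pos_mult_at_bot[OF tendsto_const c filterlim_ident])+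
  then show "((\<lambda>z. tanh (\<mu> * z / sqrt 2)) \<longlongrightarrow> 1) at_top" "((\<lambda>z. tanh (\<mu> * z / sqrt 2)) \<longlongrightarrow> - 1) at_bot"
    using filterlim_compose[OF tanh_real_at_top] filterlim_compose[OF tanh_real_at_bot] by fastforce+
qed

lemma tanh_scaled_derivative:
  "((\<lambda>z. tanh (\<mu> * z / sqrt 2)) has_real_derivative (1 - (tanh (\<mu> * z / sqrt 2))\<^sup>2) * (\<mu> / sqrt 2)) (at z)"
proof -
  have "((\<lambda>z. tanh (c * z)) has_real_derivative (1 - (tanh (c * z))\<^sup>2) * c) (at z)" for c :: real
    by (auto intro!: derivative_eq_intros)
  from this[of "\<mu> / sqrt 2"] show ?thesis by (simp only: times_divide_eq_left)
qed

lemma wall_profile_integral: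
  assumes "\<mu> > 0" "lam > 0"
  shows "integrable lebesgue (\<lambda>z. (1 - (tanh (\<mu> * z / sqrt 2))\<^sup>2)\<^sup>2)"
    and "(LINT z|lebesgue. (1 - (tanh (\<mu> * z / sqrt 2))\<^sup>2)\<^sup>2) = 4 * sqrt 2 / (3 * \<mu>)"
proof -
  define f where "f z = (1 - (tanh (\<mu> * z / sqrt 2))\<^sup>2)\<^sup>2" for z :: real
  \<comment> \<open>Substituting \<open>t = tanh (\<mu> * z / sqrt 2)\<close>, with
    \<open>dt = (1 - t^2) * \<mu> / sqrt 2 * dz\<close>, leaves the integral of
    \<open>1 - t^2\<close>, whose primitive is \<open>t - t^3 / 3\<close>.\<close>
  define F where "F z = sqrt 2 / \<mu> * (tanh (\<mu> * z / sqrt 2) - tanh (\<mu> * z / sqrt 2) ^ 3 / 3)" for z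
  have D: "(F has_real_derivative f z) (at z)" for z
  proof -
    define t where "t = tanh (\<mu> * z / sqrt 2)"
    have "((\<lambda>z. tanh (\<mu> * z / sqrt 2)) has_real_derivative (1 - t\<^sup>2) * (\<mu> / sqrt 2)) (at z)"
      unfolding t_def by (rule tanh_scaled_derivative)
    moreover have "(F has_real_derivative (sqrt 2 / \<mu> * (d - t\<^sup>2 * d))) (at z)"
      if "((\<lambda>z. tanh (\<mu> * z / sqrt 2)) has_real_derivative d) (at z)" for d
    proof -
      have "((\<lambda>z. c * (T z - T z ^ 3 / 3)) has_real_derivative (c * (d - (T z)\<^sup>2 * d))) (at z)"
        if "(T has_real_derivative d) (at z)" for T and c :: real
        by (auto intro!: derivative_eq_intros that)
      from this[OF that, of "sqrt 2 / \<mu>"] show ?thesis unfolding F_def[abs_def] t_def .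
    qed
    ultimately have "(F has_real_derivative (sqrt 2 / \<mu> * ((1 - t\<^sup>2) * (\<mu> / sqrt 2) - t\<^sup>2 * ((1 - t\<^sup>2) * (\<mu> / sqrt 2))))) (at z)"
      by blast
    also have "sqrt 2 / \<mu> * ((1 - t\<^sup>2) * (\<mu> / sqrt 2) - t\<^sup>2 * ((1 - t\<^sup>2) * (\<mu> / sqrt 2))) = f z"
      using assms by (simp add: f_def t_def[symmetric] field_simps power2_eq_square)
    finally show ?thesis .
  qed
  have cont: "isCont f z" for z unfolding f_def by (intro continuous_intros) auto
  have top: "(F \<longlongrightarrow> sqrt 2 / \<mu> * (1 - 1 ^ 3 / 3)) at_top"
    unfolding F_def by (intro tendsto_intros tendsto_tanh_scaled assms) simp
  have bot: "(F \<longlongrightarrow> sqrt 2 / \<mu> * (- 1 - (- 1) ^ 3 / 3)) at_bot"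
    unfolding F_def by (intro tendsto_intros tendsto_tanh_scaled assms) simp
  have FTC: "set_integrable lborel (einterval (- \<infinity>) \<infinity>) f"
    "(LBINT x=-\<infinity>..\<infinity>. f x) = sqrt 2 / \<mu> * (1 - 1 ^ 3 / 3) - sqrt 2 / \<mu> * (- 1 - (- 1) ^ 3 / 3)"
    using top bot
    by (intro interval_integral_FTC_nonneg[where F = F] D cont; simp add: f_def ereal_tendsto_simps)+
  have int: "integrable lborel f" using FTC(1) by (simp add: set_integrable_def einterval_def)
  then have meas: "f \<in> borel_measurable lborel" by (rule borel_measurable_integrable)
  have "(LINT z|lborel. f z) = 4 * sqrt 2 / (3 * \<mu>)"
    using FTC(2) assms by (simp add: interval_lebesgue_integral_def set_lebesgue_integral_def einterval_def field_simps)
  then show "(LINT z|lebesgue. (1 - (tanh (\<mu> * z / sqrt 2))\<^sup>2)\<^sup>2) = 4 * sqrt 2 / (3 * \<mu>)"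
    using integral_completion[OF meas] by (simp add: f_def[abs_def])
  show "integrable lebesgue (\<lambda>z. (1 - (tanh (\<mu> * z / sqrt 2))\<^sup>2)\<^sup>2)"
    using integrable_completion[OF meas] int by (simp add: f_def[abs_def])
qed

text \<open>On each symmetric window the calibration bounds the increment of \<open>calib\<close> by
  the integral of \<open>2 * sqrt V * norm g\<close>, and the inequality of arithmetic and geometric
  means turns this into energy density. The windows exhaust the line; the endpoint values pass to
  the limit by continuity of \<open>mid\<close> on \<open>h0\<close>.\<close>

lemma admissible_pts_energy_ge:
  assumes \<mu>: "\<mu> > 0" and lam: "lam > 0" and Am: "Am \<in> h0" and Ap: "Ap \<in> h0"
  defines "V \<equiv> potential \<mu> lam (- (3 / 20) * lam) (3 * \<mu> ^ 4 / lam)"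
  assumes \<Psi>: "\<Psi> \<in> admissible_pts V Am Ap"
  shows "\<bar>calib \<mu> lam (mid Ap) - calib \<mu> lam (mid Am)\<bar> \<le> energy V \<Psi>"
proof -
  define g where "g = weak_deriv \<Psi>"
  have H: "\<Psi> \<in> H1_loc" "continuous_on UNIV \<Psi>" "L2 g" "integrable lebesgue (\<lambda>z. V (\<Psi> z))"
    "(\<Psi> \<longlongrightarrow> Am) at_bot" "(\<Psi> \<longlongrightarrow> Ap) at_top"
    using \<Psi> by (auto simp: admissible_pts_def g_def)
  have h0: "\<Psi> z \<in> h0" for z using H(1) by (auto simp: H1_loc_def)
  have wd: "has_weak_deriv \<Psi> g"
  proof -
    obtain g0 where "has_weak_deriv \<Psi> g0" using H(1) by (auto simp: H1_loc_def)
    then show ?thesis unfolding g_def weak_deriv_def by (rule someI[where P = "has_weak_deriv \<Psi>"])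
  qed
  have gh0: "g z \<in> h0" for z using wd by (simp add: has_weak_deriv_def)
  have gi: "g absolutely_integrable_on {a..b}" for a b
    using wd by (simp add: has_weak_deriv_def loc_integrable_def)
  define e where "e z = (norm (g z))\<^sup>2 + V (\<Psi> z)" for z
  have en: "energy V \<Psi> = (LINT z|lebesgue. e z)"
    unfolding energy_def e_def g_def[symmetric] by (simp add: frob_norm_eq_norm[OF gh0])
  have eint: "integrable lebesgue e"
    unfolding e_def using H(3,4) by (simp add: L2_def frob_norm_eq_norm[OF gh0])
  have V0: "V (\<Psi> z) \<ge> 0" for z unfolding V_def by (rule potential_nonneg[OF lam h0])
  have e0: "e z \<ge> 0" for z using V0[of z] by (simp add: e_def)
  have bound: "\<bar>calib \<mu> lam (mid (\<Psi> r)) - calib \<mu> lam (mid (\<Psi> (- r)))\<bar> \<le> energy V \<Psi>" if r: "r \<ge> 0" for r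
  proof -
    have eai: "e absolutely_integrable_on {- r..r}"
      using eint unfolding set_integrable_def by (intro integrable_mult_indicator) auto
    have rr: "- r \<le> r" using r by simp
    have ftc: "(g has_integral (\<Psi> t - \<Psi> s)) {s..t}" if "s \<le> t" for s t
      by (rule has_weak_deriv_has_integral[OF wd H(2) that])
    note cc = calibration_curve[OF lam rr h0 gi ftc, where \<mu> = \<mu>, folded V_def]
    have "\<bar>calib \<mu> lam (mid (\<Psi> r)) - calib \<mu> lam (mid (\<Psi> (- r)))\<bar>
        \<le> integral {- r..r} (\<lambda>t. 2 * sqrt (V (\<Psi> t)) * norm (g t))"
      by (rule cc(2)) simp_all
    also have "\<dots> \<le> integral {- r..r} e"
    proof (rule integral_le)
      show "(\<lambda>t. 2 * sqrt (V (\<Psi> t)) * norm (g t)) integrable_on {- r..r}"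
        using cc(1) by (auto simp: absolutely_integrable_on_def)
      show "e integrable_on {- r..r}"
        using eai by (auto simp: absolutely_integrable_on_def)
      show "2 * sqrt (V (\<Psi> t)) * norm (g t) \<le> e t" for t
        using sum_squares_bound[of "sqrt (V (\<Psi> t))" "norm (g t)"] V0[of t] by (simp add: e_def)
    qed
    also have "\<dots> = (LINT z|lebesgue. indicator {- r..r} z *\<^sub>R e z)"
      using set_lebesgue_integral_eq_integral(2)[OF eai] by (simp add: set_lebesgue_integral_def)
    also have "\<dots> \<le> (LINT z|lebesgue. e z)"
      using eai eint e0 unfolding set_integrable_def
      by (intro integral_mono) (auto simp: indicator_def)
    finally show ?thesis by (simp add: en)
  qed
  have contc: "isCont (calib \<mu> lam) y" for y
    unfolding calib_def using lam by (intro continuous_intros) auto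
  have top: "((\<lambda>r. calib \<mu> lam (mid (\<Psi> r))) \<longlongrightarrow> calib \<mu> lam (mid Ap)) at_top"
    by (rule isCont_tendsto_compose[OF contc continuous_on_tendsto_compose[OF continuous_on_mid H(6) Ap]])
      (simp add: h0)
  have bot: "((\<lambda>r. calib \<mu> lam (mid (\<Psi> r))) \<longlongrightarrow> calib \<mu> lam (mid Am)) at_bot"
    by (rule isCont_tendsto_compose[OF contc continuous_on_tendsto_compose[OF continuous_on_mid H(5) Am]])
      (simp add: h0)
  have bot': "((\<lambda>r. calib \<mu> lam (mid (\<Psi> (- r)))) \<longlongrightarrow> calib \<mu> lam (mid Am)) at_top"
    by (rule filterlim_compose[OF bot filterlim_uminus_at_bot_at_top])
  show ?thesis
  proof (rule tendsto_upperbound)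
    show "((\<lambda>r. \<bar>calib \<mu> lam (mid (\<Psi> r)) - calib \<mu> lam (mid (\<Psi> (- r)))\<bar>) \<longlongrightarrow>
        \<bar>calib \<mu> lam (mid Ap) - calib \<mu> lam (mid Am)\<bar>) at_top"
      by (intro tendsto_intros top bot')
    show "\<forall>\<^sub>F r in at_top. \<bar>calib \<mu> lam (mid (\<Psi> r)) - calib \<mu> lam (mid (\<Psi> (- r)))\<bar> \<le> energy V \<Psi>"
      using bound by (intro eventually_at_top_linorderI[of 0])
  qed simp
qed

text \<open>The exceptional null set is absorbed by the fundamental theorem for absolutely
  continuous curves. What remains is to pass from the gauge integral to the \<open>ennreal\<close>
  integral, and from \<open>norm\<close> to \<open>frob_norm\<close> off that null set.\<close>

lemma weighted_length_ge:
  assumes \<mu>: "\<mu> > 0" and lam: "lam > 0"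
  defines "V \<equiv> potential \<mu> lam (- (3 / 20) * lam) (3 * \<mu> ^ 4 / lam)"
  assumes ac: "abs_continuous_on_Icc 0 1 \<gamma>" and h0: "\<forall>t\<in>{0..1}. \<gamma> t \<in> h0"
    and der: "AE t in lebesgue_on {0..1}. (\<gamma> has_vector_derivative g t) (at t within {0..1})"
  shows "ennreal \<bar>calib \<mu> lam (mid (\<gamma> 1)) - calib \<mu> lam (mid (\<gamma> 0))\<bar>
    \<le> 2 * (\<integral>\<^sup>+t\<in>{0..1}. ennreal (sqrt (V (\<gamma> t)) * frob_norm (g t)) \<partial>lebesgue)"
proof -
  have "AE t in lebesgue. t \<in> {0..1} \<longrightarrow> (\<gamma> has_vector_derivative g t) (at t within {0..1})"
    using der by (simp add: AE_restrict_space_iff)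
  then obtain N where N: "N \<in> null_sets lebesgue"
    "\<And>t. t \<in> {0..1} - N \<Longrightarrow> (\<gamma> has_vector_derivative g t) (at t within {0..1})"
    by (elim AE_E3) (use that in force)
  have neg: "negligible N" using N(1) negligible_iff_null_sets by blast
  have gai: "g absolutely_integrable_on {0..1}"
    by (rule abs_continuous_absolutely_integrable[OF _ ac neg N(2)]) auto
  have ftc: "(g has_integral (\<gamma> t - \<gamma> s)) {s..t}" if "0 \<le> s" "s \<le> t" "t \<le> 1" for s t
    using that
    by (intro abs_continuous_has_integral[OF _ abs_continuous_on_Icc_subset[OF ac] neg])
      (auto intro: has_vector_derivative_within_subset[OF N(2)])
  have h0': "\<gamma> t \<in> h0" if "t \<in> {0..1}" for t using h0 that by blast
  note cc = calibration_curve[OF lam zero_le_one h0' gai ftc, where \<mu> = \<mu>, folded V_def]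
  have V0: "V (\<gamma> t) \<ge> 0" if "t \<in> {0..1}" for t
    unfolding V_def by (rule potential_nonneg[OF lam h0'[OF that]])
  define I where "I = integral {0..1} (\<lambda>t. sqrt (V (\<gamma> t)) * norm (g t))"
  have hi2: "((\<lambda>t. 2 * sqrt (V (\<gamma> t)) * norm (g t)) has_integral integral {0..1} (\<lambda>t. 2 * sqrt (V (\<gamma> t)) * norm (g t))) {0..1}"
    using cc(1) by (auto simp: absolutely_integrable_on_def)
  from has_integral_mult_right[OF this, of "1 / 2"]
  have hi: "((\<lambda>t. sqrt (V (\<gamma> t)) * norm (g t)) has_integral I) {0..1}"
    by (simp add: I_def has_integral_integrable_integral)
  have I2: "integral {0..1} (\<lambda>t. 2 * sqrt (V (\<gamma> t)) * norm (g t)) = 2 * I"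
    unfolding I_def by (simp add: mult.assoc)
  have "ennreal \<bar>calib \<mu> lam (mid (\<gamma> 1)) - calib \<mu> lam (mid (\<gamma> 0))\<bar> \<le> ennreal (2 * I)"
    using cc(2) unfolding I2 by (intro ennreal_leI) auto
  also have "\<dots> = 2 * ennreal I"
    by (simp add: ennreal_mult')
  also have "ennreal I = (\<integral>\<^sup>+t. ennreal (sqrt (V (\<gamma> t)) * norm (g t)) * indicator {0..1} t \<partial>lebesgue)"
    using nn_integral_has_integral_lebesgue'[OF _ hi] V0 by (simp add: nn_integral_completion)
  also have "\<dots> = (\<integral>\<^sup>+t\<in>{0..1}. ennreal (sqrt (V (\<gamma> t)) * frob_norm (g t)) \<partial>lebesgue)"
  proof (rule nn_integral_cong_AE, rule AE_I'[OF N(1)], rule subsetI)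
    fix t assume t: "t \<in> {t \<in> space lebesgue. ennreal (sqrt (V (\<gamma> t)) * norm (g t)) * indicator {0..1} t
        \<noteq> ennreal (sqrt (V (\<gamma> t)) * frob_norm (g t)) * indicator {0..1} t}"
    show "t \<in> N"
    proof (rule ccontr)
      assume "t \<notin> N"
      moreover have t01: "t \<in> {0..1}" using t by (cases "t \<in> {0..1}") auto
      ultimately have "(\<gamma> has_vector_derivative g t) (at t within {0..1})" by (intro N(2)) auto
      then have "g t \<in> h0" by (rule has_vector_derivative_in_h0[OF zero_less_one t01, rotated]) (rule h0')
      then show False using t by (simp add: frob_norm_eq_norm)
    qed
  qed
  finally show ?thesis .
qed

text \<open>The weighted length ignores parametrization, so the segment is traversed at constant
  speed; the \<open>tanh\<close> profile never reaches the vacua in finite time.\<close>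

lemma weighted_dist_wall_le:
  assumes \<mu>: "\<mu> > 0" and lam: "lam > 0"
  defines "V \<equiv> potential \<mu> lam (- (3 / 20) * lam) (3 * \<mu> ^ 4 / lam)"
  shows "weighted_dist V (Sigma_A_minus \<mu> lam) (Sigma_A_plus \<mu> lam) \<le> ennreal (4 * sqrt 2 * \<mu> ^ 3 / (3 * lam))"
proof -
  define \<gamma> where "\<gamma> t = wall \<mu> lam (2 * t - 1)" for t
  define g where "g t = 2 *\<^sub>R wall_dir \<mu> lam" for t :: real
  have d: "(\<gamma> has_vector_derivative g t) (at t within S)" for t S
    unfolding \<gamma>_def g_def by (rule has_vector_derivative_wall) (auto intro!: derivative_eq_intros)
  have \<gamma>diff: "\<gamma> t - \<gamma> s = (t - s) *\<^sub>R g 0" for s t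
    unfolding \<gamma>_def by (subst (1 2) wall_affine) (simp add: g_def algebra_simps)
  define L where "L = norm (g 0)"
  have ac: "abs_continuous_on_Icc 0 1 \<gamma>"
    unfolding abs_continuous_on_Icc_def
  proof (intro allI impI)
    fix e :: real assume "e > 0"
    have "(\<Sum>i<n. norm (\<gamma> (t i) - \<gamma> (s i))) < e"
      if "(\<forall>i<n. 0 \<le> s i \<and> s i \<le> t i \<and> t i \<le> 1)" "(\<Sum>i<n. t i - s i) < e / (L + 1)" for n and s t :: "nat \<Rightarrow> real"
    proof -
      have L: "L \<ge> 0" by (simp add: L_def)
      have "(\<Sum>i<n. norm (\<gamma> (t i) - \<gamma> (s i))) = (\<Sum>i<n. L * (t i - s i))"
        using that(1) by (intro sum.cong refl) (simp add: \<gamma>diff L_def)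
      also have "\<dots> \<le> (L + 1) * (\<Sum>i<n. t i - s i)"
        unfolding sum_distrib_left using that(1) by (intro sum_mono mult_right_mono) auto
      also have "\<dots> < e" using that(2) L by (simp add: field_simps)
      finally show ?thesis .
    qed
    moreover have "e / (L + 1) > 0" using \<open>e > 0\<close> by (simp add: L_def add_nonneg_pos)
    ultimately show "\<exists>\<delta>>0. \<forall>(n::nat) s t. (\<forall>i<n. 0 \<le> s i \<and> s i \<le> t i \<and> t i \<le> 1) \<and>
        disjoint_family_on (\<lambda>i. {s i<..<t i}) {..<n} \<and> (\<Sum>i<n. t i - s i) < \<delta>
        \<longrightarrow> (\<Sum>i<n. norm (\<gamma> (t i) - \<gamma> (s i))) < e" by blast
  qed
  define c where "c = sqrt (\<mu> ^ 4 / (2 * lam)) * (2 * (\<mu> / sqrt lam))"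
  have c: "c = sqrt 2 * \<mu> ^ 3 / lam"
  proof -
    have "sqrt (\<mu> ^ 4) = \<mu>\<^sup>2" using real_sqrt_abs[of "\<mu>\<^sup>2"] by simp
    then show ?thesis
      using lam by (simp add: c_def real_sqrt_mult real_sqrt_divide field_simps power3_eq_cube power2_eq_square)
  qed
  have fn: "frob_norm (g t) = 2 * (\<mu> / sqrt lam)" for t
    unfolding g_def by (subst frob_norm_eq_norm[OF wall_dir_in_h0]) (simp add: norm_wall_dir[OF \<mu> lam])
  have integrand: "sqrt (V (\<gamma> t)) * frob_norm (g t) = c * (1 - (2 * t - 1)\<^sup>2)" if "t \<in> {0..1}" for t
  proof -
    have "(2 * t - 1)\<^sup>2 \<le> 1\<^sup>2" using that by (intro power2_le_iff_abs_le[THEN iffD2]) auto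
    then have "sqrt (V (\<gamma> t)) = sqrt (\<mu> ^ 4 / (2 * lam)) * (1 - (2 * t - 1)\<^sup>2)"
      unfolding V_def \<gamma>_def potential_wall[OF lam] real_sqrt_mult real_sqrt_abs by simp
    then show ?thesis by (simp add: fn c_def)
  qed
  \<comment> \<open>The primitive is that of
    \<open>1 - (2 * t - 1)\<^sup>2 = 4 * t - 4 * t\<^sup>2\<close>.\<close>
  have "((\<lambda>t. c * (1 - (2 * t - 1)\<^sup>2)) has_integral (c * (2 * 1\<^sup>2 - 4 / 3 * 1 ^ 3) - c * (2 * 0\<^sup>2 - 4 / 3 * 0 ^ 3))) {0..1}"
    by (rule fundamental_theorem_of_calculus)
      (auto intro!: derivative_eq_intros simp: has_real_derivative_iff_has_vector_derivative[symmetric] power2_eq_square algebra_simps)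
  then have hi: "((\<lambda>t. c * (1 - (2 * t - 1)\<^sup>2)) has_integral (2 / 3 * c)) {0..1}" by (simp add: mult.commute)
  have "(\<integral>\<^sup>+t\<in>{0..1}. ennreal (sqrt (V (\<gamma> t)) * frob_norm (g t)) \<partial>lebesgue)
     = (\<integral>\<^sup>+t\<in>{0..1}. ennreal (c * (1 - (2 * t - 1)\<^sup>2)) \<partial>lebesgue)"
    by (intro nn_integral_cong) (auto simp: indicator_def integrand)
  also have "\<dots> = ennreal (2 / 3 * c)"
  proof -
    have "0 \<le> c * (1 - (2 * t - 1)\<^sup>2)" if "t \<in> {0..1}" for t
    proof -
      have "V (\<gamma> t) \<ge> 0" unfolding V_def \<gamma>_def by (rule potential_nonneg[OF lam wall_in_h0])
      then show ?thesis unfolding integrand[OF that, symmetric] fn using \<mu> lam by simp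
    qed
    from nn_integral_has_integral_lebesgue'[OF this hi] show ?thesis
      by (simp add: nn_integral_completion)
  qed
  finally have int: "2 * (\<integral>\<^sup>+t\<in>{0..1}. ennreal (sqrt (V (\<gamma> t)) * frob_norm (g t)) \<partial>lebesgue)
      = ennreal (4 * sqrt 2 * \<mu> ^ 3 / (3 * lam))"
    unfolding c by (simp add: ennreal_mult'[symmetric] mult.assoc flip: ennreal_numeral)
  have "\<gamma> 0 \<in> Sigma_A_minus \<mu> lam" "\<gamma> 1 \<in> Sigma_A_plus \<mu> lam"
    by (simp_all add: \<gamma>_def wall_1 wall_minus_1 Sigma_A_minus_def Sigma_A_plus_def in_SU5_orbit)
  then show ?thesis
    unfolding weighted_dist_def int[symmetric]
    by (intro Inf_lower CollectI exI[of _ \<gamma>] exI[of _ g])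
      (use ac d in \<open>auto simp: \<gamma>_def wall_in_h0\<close>)
qed

section \<open>The kink as a competitor\<close>

lemma Phi_A_has_vector_derivative:
  "(Phi_A \<mu> lam has_vector_derivative ((1 - (tanh (\<mu> * z / sqrt 2))\<^sup>2) * (\<mu> / sqrt 2)) *\<^sub>R wall_dir \<mu> lam) (at z)"
  unfolding Phi_A_eq_wall[abs_def]
  by (rule has_vector_derivative_wall[OF tanh_scaled_derivative])

text \<open>Equipartition: squared speed and potential are the same multiple of the profile
  \<open>p\<close>, so the energy is twice one integral. The chosen \<open>weak_deriv\<close> is
  known to equal the classical derivative only almost everywhere, so integrability and energy are
  transported along \<open>ae\<close>.\<close>

lemma Phi_A_admissible_energy:
  assumes \<mu>: "\<mu> > 0" and lam: "lam > 0"
  defines "V \<equiv> potential \<mu> lam (- (3 / 20) * lam) (3 * \<mu> ^ 4 / lam)"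
  shows "Phi_A \<mu> lam \<in> admissible V (Sigma_A_minus \<mu> lam) (Sigma_A_plus \<mu> lam)"
    and "energy V (Phi_A \<mu> lam) = 4 * sqrt 2 * \<mu> ^ 3 / (3 * lam)"
proof -
  define p where "p z = (1 - (tanh (\<mu> * z / sqrt 2))\<^sup>2)\<^sup>2" for z
  define g where "g z = ((1 - (tanh (\<mu> * z / sqrt 2))\<^sup>2) * (\<mu> / sqrt 2)) *\<^sub>R wall_dir \<mu> lam" for z
  note der = Phi_A_has_vector_derivative[of \<mu> lam, folded g_def]
  have contg: "continuous_on UNIV g" unfolding g_def by (intro continuous_intros) auto
  have cont: "continuous_on UNIV (Phi_A \<mu> lam)"
    using der by (auto intro!: continuous_at_imp_continuous_on has_vector_derivative_continuous)
  have h0: "Phi_A \<mu> lam z \<in> h0" for z by (simp add: Phi_A_eq_wall wall_in_h0)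
  have gh0: "g z \<in> h0" for z unfolding g_def by (rule wall_dir_in_h0)
  have wd: "has_weak_deriv (Phi_A \<mu> lam) g" by (rule has_weak_derivI[OF der contg gh0])
  define w where "w = weak_deriv (Phi_A \<mu> lam)"
  have wdw: "has_weak_deriv (Phi_A \<mu> lam) w"
    unfolding w_def weak_deriv_def by (rule someI[where P = "has_weak_deriv (Phi_A \<mu> lam)", OF wd])
  have ae: "AE z in lebesgue. w z = g z" by (rule has_weak_deriv_AE_eq[OF wdw der])
  have wh0: "w z \<in> h0" for z using wdw by (simp add: has_weak_deriv_def)
  have meas: "f \<in> borel_measurable lebesgue" if "continuous_on UNIV f" for f :: "real \<Rightarrow> cmat5"
    using borel_measurable_continuous_onI[OF that] by (simp add: measurable_completion)
  have measw: "w \<in> borel_measurable lebesgue"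
    using ae by (intro borel_measurable_AE[OF meas[OF contg]]) (auto simp: eq_commute)
  have g2: "(norm (g z))\<^sup>2 = \<mu> ^ 4 / (2 * lam) * p z" for z
    unfolding g_def norm_scaleR power_mult_distrib norm_wall_dir_sq[OF \<mu> lam] power2_abs
    using lam by (simp add: p_def power_mult_distrib power_divide power2_eq_square power4_eq_xxxx)
  have Vp: "V (Phi_A \<mu> lam z) = \<mu> ^ 4 / (2 * lam) * p z" for z
    unfolding V_def Phi_A_eq_wall p_def by (rule potential_wall[OF lam])
  note P = wall_profile_integral[OF \<mu> lam, folded p_def]
  have intV: "integrable lebesgue (\<lambda>z. V (Phi_A \<mu> lam z))" unfolding Vp using P(1) by simp
  have aew: "AE z in lebesgue. (frob_norm (w z))\<^sup>2 = \<mu> ^ 4 / (2 * lam) * p z"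
    using ae by eventually_elim (simp add: frob_norm_eq_norm gh0 g2)
  have measp: "(\<lambda>z. \<mu> ^ 4 / (2 * lam) * p z) \<in> borel_measurable lebesgue"
    using P(1) by (intro borel_measurable_integrable) simp
  have measw2: "(\<lambda>z. (frob_norm (w z))\<^sup>2) \<in> borel_measurable lebesgue"
    using measw by (simp add: frob_norm_eq_norm[OF wh0])
  have intw: "integrable lebesgue (\<lambda>z. (frob_norm (w z))\<^sup>2)"
    using integrable_cong_AE[OF measw2 measp aew] P(1) by simp
  have L2loc: "L2_loc f" if "continuous_on UNIV f" "\<And>z. f z \<in> h0" for f
    unfolding L2_loc_def frob_norm_eq_norm[OF that(2)]
    using meas[OF that(1)] continuous_on_subset[OF that(1)]
    by (auto intro!: absolutely_integrable_continuous_real continuous_intros)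
  have pts: "Phi_A \<mu> lam \<in> admissible_pts V (Phi_A_minus \<mu> lam) (Phi_A_plus \<mu> lam)"
    unfolding admissible_pts_def mem_Collect_eq
  proof (intro conjI)
    show "Phi_A \<mu> lam \<in> H1_loc"
      unfolding H1_loc_def using h0 L2loc[OF cont h0] wd L2loc[OF contg gh0] by blast
    show "L2 (weak_deriv (Phi_A \<mu> lam))" using measw intw by (simp add: L2_def w_def)
    have "((\<lambda>z. wall \<mu> lam (tanh (\<mu> * z / sqrt 2))) \<longlongrightarrow> wall \<mu> lam 0 + 1 *\<^sub>R wall_dir \<mu> lam) at_top"
      by (subst wall_affine) (intro tendsto_intros tendsto_tanh_scaled \<mu>)
    then show "(Phi_A \<mu> lam \<longlongrightarrow> Phi_A_plus \<mu> lam) at_top"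
      unfolding wall_affine[symmetric] wall_1 Phi_A_eq_wall[abs_def] .
    have "((\<lambda>z. wall \<mu> lam (tanh (\<mu> * z / sqrt 2))) \<longlongrightarrow> wall \<mu> lam 0 + (- 1) *\<^sub>R wall_dir \<mu> lam) at_bot"
      by (subst wall_affine) (intro tendsto_intros tendsto_tanh_scaled \<mu>)
    then show "(Phi_A \<mu> lam \<longlongrightarrow> Phi_A_minus \<mu> lam) at_bot"
      unfolding wall_affine[symmetric] wall_minus_1 Phi_A_eq_wall[abs_def] .
  qed (rule cont intV)+
  then show "Phi_A \<mu> lam \<in> admissible V (Sigma_A_minus \<mu> lam) (Sigma_A_plus \<mu> lam)"
    unfolding admissible_def Sigma_A_minus_def Sigma_A_plus_def using in_SU5_orbit by blast
  have "energy V (Phi_A \<mu> lam) = (LINT z|lebesgue. \<mu> ^ 4 / (2 * lam) * p z) + (LINT z|lebesgue. \<mu> ^ 4 / (2 * lam) * p z)"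
    unfolding energy_def w_def[symmetric] Bochner_Integration.integral_add[OF intw intV]
    using integral_cong_AE[OF measw2 measp aew] by (simp add: Vp)
  also have "\<dots> = 4 * sqrt 2 * \<mu> ^ 3 / (3 * lam)"
    using P(2) \<mu> lam by (simp add: field_simps power4_eq_xxxx power3_eq_cube)
  finally show "energy V (Phi_A \<mu> lam) = 4 * sqrt 2 * \<mu> ^ 3 / (3 * lam)" .
qed

theorem theorem5:
  fixes \<mu> lam h V0 :: real
  assumes "\<mu> > 0" and "lam > 0" and "h = - (3 / 20) * lam" and "V0 = 3 * \<mu> ^ 4 / lam"
  defines "V \<equiv> potential \<mu> lam h V0"
  shows "is_global_minimizer (energy V)
           (admissible V (Sigma_A_minus \<mu> lam) (Sigma_A_plus \<mu> lam)) (Phi_A \<mu> lam) \<and>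
         Phi_A \<mu> lam \<in> admissible V (Sigma_A_minus \<mu> lam) (Sigma_A_plus \<mu> lam) \<and>
         (\<forall>\<Psi> \<in> admissible V (Sigma_A_minus \<mu> lam) (Sigma_A_plus \<mu> lam).
            energy V \<Psi> \<ge> energy V (Phi_A \<mu> lam)) \<and>
         energy V (Phi_A \<mu> lam) = 4 * sqrt 2 * \<mu> ^ 3 / (3 * lam) \<and>
         weighted_dist V (Sigma_A_minus \<mu> lam) (Sigma_A_plus \<mu> lam)
           = ennreal (energy V (Phi_A \<mu> lam))"
proof -
  have V: "V = potential \<mu> lam (- (3 / 20) * lam) (3 * \<mu> ^ 4 / lam)" using assms by simp
  define E where "E = 4 * sqrt 2 * \<mu> ^ 3 / (3 * lam)"
  note wall = Phi_A_admissible_energy[OF assms(1,2), folded V E_def]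
  \<comment> \<open>Conjugation invariance of \<open>mid\<close> makes the gap the same for every
    pair of endpoints; it is the lower bound for both functionals.\<close>
  have gap: "\<bar>calib \<mu> lam (mid Ap) - calib \<mu> lam (mid Am)\<bar> = E"
    if "Am \<in> Sigma_A_minus \<mu> lam" "Ap \<in> Sigma_A_plus \<mu> lam" for Am Ap
  proof -
    have "E > 0" using assms(1,2) by (simp add: E_def)
    then show ?thesis
      using calib_difference[OF assms(1,2)] unfolding E_def[symmetric]
      by (simp add: Sigma_A_minus_mid[OF assms(1,2) that(1)] Sigma_A_plus_mid[OF assms(1,2) that(2)] abs_if)
  qed
  have lower: "E \<le> energy V \<Psi>" if adm: "\<Psi> \<in> admissible V (Sigma_A_minus \<mu> lam) (Sigma_A_plus \<mu> lam)" for \<Psi>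
  proof -
    obtain Am Ap where A: "Am \<in> Sigma_A_minus \<mu> lam" "Ap \<in> Sigma_A_plus \<mu> lam" and "\<Psi> \<in> admissible_pts V Am Ap"
      using adm unfolding admissible_def by blast
    then have "\<bar>calib \<mu> lam (mid Ap) - calib \<mu> lam (mid Am)\<bar> \<le> energy V \<Psi>"
      unfolding V by (intro admissible_pts_energy_ge[OF assms(1,2) Sigma_A_minus_mid(1)[OF assms(1,2) A(1)]
            Sigma_A_plus_mid(1)[OF assms(1,2) A(2)]])
    then show ?thesis by (simp add: gap[OF A])
  qed
  have "weighted_dist V (Sigma_A_minus \<mu> lam) (Sigma_A_plus \<mu> lam) = ennreal E"
  proof (rule antisym)
    show "weighted_dist V (Sigma_A_minus \<mu> lam) (Sigma_A_plus \<mu> lam) \<le> ennreal E"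
      unfolding V E_def by (rule weighted_dist_wall_le[OF assms(1,2)])
    show "ennreal E \<le> weighted_dist V (Sigma_A_minus \<mu> lam) (Sigma_A_plus \<mu> lam)"
      unfolding weighted_dist_def
    proof (rule Inf_greatest, clarify)
      fix \<gamma> :: "real \<Rightarrow> cmat5" and g
      assume \<gamma>: "abs_continuous_on_Icc 0 1 \<gamma>" "\<forall>t\<in>{0..1}. \<gamma> t \<in> h0" "\<gamma> 0 \<in> Sigma_A_minus \<mu> lam"
        "\<gamma> 1 \<in> Sigma_A_plus \<mu> lam"
        "AE t in lebesgue_on {0..1}. (\<gamma> has_vector_derivative g t) (at t within {0..1})"
      show "ennreal E \<le> 2 * (\<integral>\<^sup>+t\<in>{0..1}. ennreal (sqrt (V (\<gamma> t)) * frob_norm (g t)) \<partial>lebesgue)"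
        using weighted_length_ge[OF assms(1,2) \<gamma>(1,2,5)] unfolding gap[OF \<gamma>(3,4)] V .
    qed
  qed
  then show ?thesis
    using wall lower by (simp add: is_global_minimizer_def E_def)
qed

end
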